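(* Let $\mathcal{C}$ be the class of simple connected graphs of minimum degree at least $4$. A graph $G$ is a minimal critical graph in $\mathcal{C}$ if and only if either $G$ is the square of a cycle of length at least $5$, or $G$ arises from a nonempty connected multihypergraph $H$ of minimum degree at least $2$ in which every hyperedge $e$ satisfies $|V(e)| \in \{1,2,3\}$, by replacing each hyperedge $e$ by a brick $B_e$ such that the vertices of attachment of $B_e$ are exactly the vertices in $V(e)$, and these vertices of attachment are at the same time the only objects (vertices or edges) of $B_e$ contained in more than one brick, and such that the following condition (TB) holds: (TB) $B_e$ is triangular (i.e. isomorphic to $K_3$) only if every vertex $x$ of $e$ is incident with precisely one hyperedge $f_x \neq e$, where $B_{f_x}$ is isomorphic to none of $K_5^-, K_{2,2,2}^-, K_5, K_{2,2,2}$, and for distinct vertices $x \ne y$ of $V(e)$ we have $V(f_x) \cap V(f_y) \neq \emptyset$ only if not both of $B_{f_x}, B_{f_y}$ are triangular, and $f_x = f_y$ only if $B_{f_x}$ is isomorphic to $K_5^{\triangleright\triangleleft}$ or $K_{2,2,2}^{\triangleright\triangleleft}$.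
   Context: For $G \in \mathcal{C}$, an edge $e$ is called essential if $G-e \notin \mathcal{C}$, and critical if the graph $G/e$ obtained by contracting $e$ to a single vertex and then deleting loops and multiple edges (simplifying) is not in $\mathcal{C}$. A graph $G \in \mathcal{C}$ is minimal critical if every edge of $G$ is both essential and critical. The square of a cycle $C$ has vertex set $V(C)$, two vertices being adjacent if their distance on $C$ is $1$ or $2$. Bricks: $K_{2,2,2}$ is the octahedron. For $Q \in \{K_5, K_{2,2,2}\}$: $Q^-$ is obtained from $Q$ by deleting one edge; $Q^{\triangledown}$ is obtained by deleting the three edges of a triangle; $Q^{\triangleright\triangleleft}$ is obtained by choosing a vertex $w$ and two independent edges $e',f'$ with both endpoints in $N_Q(w)$, deleting $w$, adding two new vertices $y,z$, and adding two edges from $y$ to the endpoints of $e'$ and two edges from $z$ to the endpoints of $f'$ (by symmetry of $K_5$ and $K_{2,2,2}$ these are well defined up to isomorphism). A brick is a graph isomorphic to one of $K_5, K_{2,2,2}, K_5^-, K_{2,2,2}^-, K_5^{\triangledown}, K_{2,2,2}^{\triangledown}, K_5^{\triangleright\triangleleft}, K_{2,2,2}^{\triangleright\triangleleft}, K_3$. Its vertices of attachment are: for $K_5$ and $K_{2,2,2}$ one arbitrary chosen vertex; for the other seven bricks, its vertices of degree less than $4$ (in the brick). A brick is triangular if it is isomorphic to $K_3$. In the multihypergraph $H$, each hyperedge $e$ has a vertex set $V(e)$, and the degree of a vertex is the number of hyperedges containing it. *)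

theory Defs
  imports Main "HOL-Library.Extended_Nat"
begin

section \<open>Finite simple graphs\<close>

record 'a ugraph =
  verts :: "'a set"
  edges :: "'a set set"

definition simple_graph :: "'a ugraph \<Rightarrow> bool" where
  "simple_graph G \<longleftrightarrow> finite (verts G) \<and> (\<forall>e\<in>edges G. e \<subseteq> verts G \<and> card e = 2)"

definition adj :: "'a ugraph \<Rightarrow> 'a rel" where
  "adj G = {(u, v). {u, v} \<in> edges G}"

definition nbrs :: "'a ugraph \<Rightarrow> 'a \<Rightarrow> 'a set" where
  "nbrs G v = {u. {v, u} \<in> edges G}"

definition degree :: "'a ugraph \<Rightarrow> 'a \<Rightarrow> nat" where
  "degree G v = card {e \<in> edges G. v \<in> e}"

definition connected_graph :: "'a ugraph \<Rightarrow> bool" where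
  "connected_graph G \<longleftrightarrow>
     verts G \<noteq> {} \<and> (\<forall>u\<in>verts G. \<forall>v\<in>verts G. (u, v) \<in> (adj G)\<^sup>*)"

definition graph_iso :: "'a ugraph \<Rightarrow> 'b ugraph \<Rightarrow> bool" (infix \<open>\<simeq>\<^sub>g\<close> 50) where
  "G \<simeq>\<^sub>g H \<longleftrightarrow>
     (\<exists>f. bij_betw f (verts G) (verts H) \<and>
          (\<forall>u\<in>verts G. \<forall>v\<in>verts G. {u, v} \<in> edges G \<longleftrightarrow> {f u, f v} \<in> edges H))"

definition delete_edges :: "'a ugraph \<Rightarrow> 'a set set \<Rightarrow> 'a ugraph" where
  "delete_edges G F = \<lparr>verts = verts G, edges = edges G - F\<rparr>"

text \<open>
  The vertices of the contracted graph are the blocks of the partition of the vertex set into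
  \<open>e\<close> and singletons; as edges are sets of two distinct blocks, loops and multiple edges disappear.
\<close>
definition contract :: "'a ugraph \<Rightarrow> 'a set \<Rightarrow> 'a set ugraph" where
  "contract G e =
     (let W = insert e {{v} | v. v \<in> verts G - e} in
      \<lparr>verts = W,
       edges = {{p, q} | p q. p \<in> W \<and> q \<in> W \<and> p \<noteq> q \<and> (\<exists>u\<in>p. \<exists>v\<in>q. {u, v} \<in> edges G)}\<rparr>)"


section \<open>Minimal critical graphs\<close>

definition class_C :: "'a ugraph set" where
  "class_C = {G. simple_graph G \<and> connected_graph G \<and> (\<forall>v\<in>verts G. 4 \<le> degree G v)}"

definition essential :: "'a ugraph \<Rightarrow> 'a set \<Rightarrow> bool" where
  "essential G e \<longleftrightarrow> delete_edges G {e} \<notin> class_C"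

definition critical :: "'a ugraph \<Rightarrow> 'a set \<Rightarrow> bool" where
  "critical G e \<longleftrightarrow> contract G e \<notin> class_C"

definition minimal_critical :: "'a ugraph \<Rightarrow> bool" where
  "minimal_critical G \<longleftrightarrow> G \<in> class_C \<and> (\<forall>e\<in>edges G. essential G e \<and> critical G e)"


section \<open>Squares of cycles\<close>

definition cycle_graph :: "nat \<Rightarrow> nat ugraph" where
  "cycle_graph n = \<lparr>verts = {..<n}, edges = {{i, (i + 1) mod n} | i. i < n}\<rparr>"

definition is_cycle :: "'a ugraph \<Rightarrow> nat \<Rightarrow> bool" where
  "is_cycle C n \<longleftrightarrow> 3 \<le> n \<and> simple_graph C \<and> C \<simeq>\<^sub>g cycle_graph n"

definition graph_dist :: "'a ugraph \<Rightarrow> 'a \<Rightarrow> 'a \<Rightarrow> enat" where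
  "graph_dist G u v = Inf (enat ` {k. (u, v) \<in> adj G ^^ k})"

definition square :: "'a ugraph \<Rightarrow> 'a ugraph" where
  "square G =
     \<lparr>verts = verts G,
      edges = {{u, v} | u v. u \<in> verts G \<and> v \<in> verts G \<and> graph_dist G u v \<in> {1, 2}}\<rparr>"


section \<open>Bricks\<close>

definition complete_graph :: "nat \<Rightarrow> nat ugraph" where
  "complete_graph n = \<lparr>verts = {..<n}, edges = {{i, j} | i j. i < n \<and> j < n \<and> i \<noteq> j}\<rparr>"

abbreviation K3 :: "nat ugraph" where "K3 \<equiv> complete_graph 3"
abbreviation K5 :: "nat ugraph" where "K5 \<equiv> complete_graph 5"

text \<open>The octahedron; its colour classes are the residue classes modulo 3.\<close>
definition K222 :: "nat ugraph" where
  "K222 = \<lparr>verts = {..<6}, edges = {{i, j} | i j. i < 6 \<and> j < 6 \<and> i mod 3 \<noteq> j mod 3}\<rparr>"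

text \<open>
  The operations on \<open>Q\<close> depend on choices, so they are rendered as predicates:
  \<open>B\<close> is isomorphic to a graph obtained from \<open>Q\<close> by the operation.
\<close>
definition is_minus :: "'b ugraph \<Rightarrow> 'a ugraph \<Rightarrow> bool" where
  "is_minus Q B \<longleftrightarrow> (\<exists>e\<in>edges Q. B \<simeq>\<^sub>g delete_edges Q {e})"

definition is_triangle_deleted :: "'b ugraph \<Rightarrow> 'a ugraph \<Rightarrow> bool" where
  "is_triangle_deleted Q B \<longleftrightarrow>
     (\<exists>a b c. {{a, b}, {b, c}, {a, c}} \<subseteq> edges Q \<and>
              B \<simeq>\<^sub>g delete_edges Q {{a, b}, {b, c}, {a, c}})"

definition split_vertex ::
  "'b ugraph \<Rightarrow> 'b \<Rightarrow> 'b set \<Rightarrow> 'b set \<Rightarrow> 'b \<Rightarrow> 'b \<Rightarrow> 'b ugraph" where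
  "split_vertex Q w e' f' y z =
     \<lparr>verts = (verts Q - {w}) \<union> {y, z},
      edges = {d \<in> edges Q. w \<notin> d} \<union> {{y, u} | u. u \<in> e'} \<union> {{z, u} | u. u \<in> f'}\<rparr>"

definition is_bowtie :: "'b ugraph \<Rightarrow> 'a ugraph \<Rightarrow> bool" where
  "is_bowtie Q B \<longleftrightarrow>
     (\<exists>w\<in>verts Q. \<exists>e'\<in>edges Q. \<exists>f'\<in>edges Q. \<exists>y z.
        e' \<inter> f' = {} \<and> e' \<union> f' \<subseteq> nbrs Q w \<and>
        y \<notin> verts Q \<and> z \<notin> verts Q \<and> y \<noteq> z \<and>
        B \<simeq>\<^sub>g split_vertex Q w e' f' y z)"

definition brick :: "'a ugraph \<Rightarrow> bool" where
  "brick B \<longleftrightarrow> simple_graph B \<and>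
     (B \<simeq>\<^sub>g K5 \<or> B \<simeq>\<^sub>g K222 \<or>
      is_minus K5 B \<or> is_minus K222 B \<or>
      is_triangle_deleted K5 B \<or> is_triangle_deleted K222 B \<or>
      is_bowtie K5 B \<or> is_bowtie K222 B \<or>
      B \<simeq>\<^sub>g K3)"

definition triangular :: "'a ugraph \<Rightarrow> bool" where
  "triangular B \<longleftrightarrow> B \<simeq>\<^sub>g K3"

text \<open>
  A relation rather than a function, because the attachment vertex of a copy of \<open>K5\<close> or \<open>K222\<close>
  may be chosen arbitrarily.
\<close>
definition attachment :: "'a ugraph \<Rightarrow> 'a set \<Rightarrow> bool" where
  "attachment B A \<longleftrightarrow>
     (if B \<simeq>\<^sub>g K5 \<or> B \<simeq>\<^sub>g K222 then \<exists>x\<in>verts B. A = {x}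
      else A = {x \<in> verts B. degree B x < 4})"


section \<open>Multihypergraphs\<close>

text \<open>Hyperedges are names, so that distinct hyperedges may have the same vertex set.\<close>
record ('a, 'e) mhgraph =
  hverts :: "'a set"
  hedges :: "'e set"
  ends :: "'e \<Rightarrow> 'a set"

definition multihypergraph :: "('a, 'e) mhgraph \<Rightarrow> bool" where
  "multihypergraph H \<longleftrightarrow>
     finite (hverts H) \<and> finite (hedges H) \<and> (\<forall>e\<in>hedges H. ends H e \<subseteq> hverts H)"

definition hdegree :: "('a, 'e) mhgraph \<Rightarrow> 'a \<Rightarrow> nat" where
  "hdegree H x = card {e \<in> hedges H. x \<in> ends H e}"

definition hadj :: "('a, 'e) mhgraph \<Rightarrow> 'a rel" where
  "hadj H = {(x, y). \<exists>e\<in>hedges H. x \<in> ends H e \<and> y \<in> ends H e}"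

definition connected_mhgraph :: "('a, 'e) mhgraph \<Rightarrow> bool" where
  "connected_mhgraph H \<longleftrightarrow> (\<forall>x\<in>hverts H. \<forall>y\<in>hverts H. (x, y) \<in> (hadj H)\<^sup>*)"


section \<open>Replacing hyperedges by bricks\<close>

definition arises_from ::
  "'a ugraph \<Rightarrow> ('a, 'e) mhgraph \<Rightarrow> ('e \<Rightarrow> 'a ugraph) \<Rightarrow> bool" where
  "arises_from G H B \<longleftrightarrow>
     (\<forall>e\<in>hedges H.
        brick (B e) \<and> attachment (B e) (ends H e) \<and>
        {x \<in> verts (B e). \<exists>f\<in>hedges H. f \<noteq> e \<and> x \<in> verts (B f)} = ends H e \<and>
        {d \<in> edges (B e). \<exists>f\<in>hedges H. f \<noteq> e \<and> d \<in> edges (B f)} = {}) \<and>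
     G = \<lparr>verts = hverts H \<union> (\<Union>e\<in>hedges H. verts (B e)),
          edges = (\<Union>e\<in>hedges H. edges (B e))\<rparr>"

definition TB :: "('a, 'e) mhgraph \<Rightarrow> ('e \<Rightarrow> 'a ugraph) \<Rightarrow> bool" where
  "TB H B \<longleftrightarrow>
     (\<forall>e\<in>hedges H. triangular (B e) \<longrightarrow>
        (\<exists>f. (\<forall>x\<in>ends H e.
                {g \<in> hedges H. g \<noteq> e \<and> x \<in> ends H g} = {f x} \<and>
                \<not> is_minus K5 (B (f x)) \<and> \<not> is_minus K222 (B (f x)) \<and>
                \<not> B (f x) \<simeq>\<^sub>g K5 \<and> \<not> B (f x) \<simeq>\<^sub>g K222) \<and>
             (\<forall>x\<in>ends H e. \<forall>y\<in>ends H e. x \<noteq> y \<longrightarrow>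
                (ends H (f x) \<inter> ends H (f y) \<noteq> {} \<longrightarrow>
                   \<not> (triangular (B (f x)) \<and> triangular (B (f y)))) \<and>
                (f x = f y \<longrightarrow> is_bowtie K5 (B (f x)) \<or> is_bowtie K222 (B (f x))))))"

end

theory Submission imports Defs begin

text \<open>
  Deleting an edge destroys membership in the class only through an end of degree four, and
  contracting it only through a common neighbour of degree four or through ends of degree four with
  the same closed neighbourhood. So minimal criticality is a local condition, and it forces every
  edge into a triangle. A neighbourhood of four vertices without isolated vertices induces \<open>2K\<^sub>2\<close>,
  \<open>P\<^sub>4\<close>, \<open>K\<^sub>1\<^sub>,\<^sub>3\<close>, \<open>C\<^sub>4\<close>, a paw, a diamond or \<open>K\<^sub>4\<close>. Unless it is \<open>2K\<^sub>2\<close>, the local condition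
  determines the surroundings of the vertex: they form one of the eight bricks other than the
  triangle, or a square of a path that can only be continued, so that the whole graph is the square
  of a cycle. The interiors of these bricks are the components of the subgraph induced by the
  vertices of degree four whose neighbourhood is not \<open>2K\<^sub>2\<close>. The edges that remain form
  edge-disjoint triangles on vertices whose neighbourhood is \<open>2K\<^sub>2\<close>, and (TB) excludes just the
  configurations that would violate the latter.
\<close>

text \<open>The classification rests on one observation: if \<open>u\<close> has a neighbour other
  than \<open>v\<close> that \<open>v\<close> does not see, then \<open>u\<close> and
  \<open>v\<close> cannot be twins, so the edge \<open>u v\<close> needs a common neighbour of
  degree four. Applied to the edge from a vertex of degree four to its last unknown neighbour, this
  usually leaves a single candidate, whose neighbourhood is thereby completed; the known region
  grows until it closes up. \<open>K5\<close> and the octahedron sit on the border between the two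
  outcomes: they are the squares of the cycles of length five and six, and they become bricks only
  if one vertex has larger degree in \<open>G\<close>. Bricks are defined up to isomorphism and with
  free choices. Both disappear once a brick is given by a list of index pairs and a list of
  vertices: the symmetry of \<open>Q\<close> enters once for each operation, and most further facts
  about the nine shapes are finite checks. The number behind (TB) is \<open>4 = 2 + 2\<close>: a
  triangle uses two of the four edges at each of its vertices, so the brick next to it has to supply
  exactly two.\<close>

lemma edge_commute: "{u, v} \<in> edges G \<longleftrightarrow> {v, u} \<in> edges G"
  by (simp add: insert_commute)

lemma in_nbrs [simp]: "u \<in> nbrs G v \<longleftrightarrow> {v, u} \<in> edges G"
  by (simp add: nbrs_def)

text \<open>Edge sets such as that of a contraction or a square are comprehensions over ordered
  pairs; an unordered pair gives back the relation only if the relation is symmetric.\<close>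

lemma doubleton_in_Collect_iff:
  assumes "\<And>p q. R p q \<Longrightarrow> R q p"
  shows "{a, b} \<in> {{p, q} | p q. R p q} \<longleftrightarrow> R a b"
  using assms by (auto simp: doubleton_eq_iff)

lemma simple_edge:
  assumes "simple_graph G" "{u, v} \<in> edges G"
  shows "u \<in> verts G" "v \<in> verts G" "u \<noteq> v"
  using assms by (force simp: simple_graph_def)+

lemma simple_no_loop: "simple_graph G \<Longrightarrow> {u} \<notin> edges G"
  by (force simp: simple_graph_def)

lemma simple_edgeE:
  assumes "simple_graph G" "e \<in> edges G"
  obtains u v where "e = {u, v}" "u \<noteq> v" "u \<in> verts G" "v \<in> verts G"
  using assms by (metis card_2_iff simple_graph_def insert_subset)

lemma finite_nbrs:
  assumes "simple_graph G"
  shows "finite (nbrs G v)"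
proof (rule finite_subset)
  show "nbrs G v \<subseteq> verts G" using simple_edge[OF assms] by auto
qed (use assms in \<open>simp add: simple_graph_def\<close>)

lemma degree_eq_card_nbrs:
  assumes "simple_graph G"
  shows "degree G v = card (nbrs G v)"
proof -
  have "bij_betw (\<lambda>u. {v, u}) (nbrs G v) {e \<in> edges G. v \<in> e}"
    unfolding bij_betw_def
  proof (intro conjI subset_antisym subsetI)
    show "inj_on (\<lambda>u. {v, u}) (nbrs G v)"
      by (auto simp: inj_on_def doubleton_eq_iff)
  next
    fix e assume e: "e \<in> {e \<in> edges G. v \<in> e}"
    then obtain a b where "e = {a, b}" using simple_edgeE[OF assms] by blast
    with e show "e \<in> (\<lambda>u. {v, u}) ` nbrs G v"
      by (auto simp: insert_commute)
  qed auto
  from bij_betw_same_card[OF this] show ?thesis by (simp add: degree_def)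
qed

lemma sym_adj: "sym (adj G)"
  by (auto simp: sym_def adj_def insert_commute)

lemma rtrancl_adj_sym: "(u, v) \<in> (adj G)\<^sup>* \<Longrightarrow> (v, u) \<in> (adj G)\<^sup>*"
  by (meson sym_adj sym_rtrancl symD)

lemma class_C_iff:
  "G \<in> class_C \<longleftrightarrow> simple_graph G \<and> connected_graph G \<and> (\<forall>v\<in>verts G. 4 \<le> card (nbrs G v))"
  by (auto simp: class_C_def degree_eq_card_nbrs)

text \<open>Turns local knowledge into global knowledge: once the known vertices have no neighbours
  elsewhere, they are the whole graph.\<close>

lemma connected_graph_closed:
  assumes "connected_graph G" "v \<in> S" "v \<in> verts G"
    and "\<And>x y. x \<in> S \<Longrightarrow> {x, y} \<in> edges G \<Longrightarrow> y \<in> S"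
  shows "verts G \<subseteq> S"
proof
  fix w assume "w \<in> verts G"
  then have "(v, w) \<in> (adj G)\<^sup>*" using assms by (auto simp: connected_graph_def)
  then show "w \<in> S"
  proof induction
    case (step x y)
    then show ?case using assms(4)[of x y] by (simp add: adj_def)
  qed (rule assms(2))
qed

section \<open>Essential and critical edges\<close>

lemma delete_edge_simple: "simple_graph G \<Longrightarrow> simple_graph (delete_edges G F)"
  by (auto simp: simple_graph_def delete_edges_def)

lemma nbrs_delete_edge:
  assumes "simple_graph G" "{x, y} \<in> edges G"
  shows "nbrs (delete_edges G {{x, y}}) v =
    (if v = x then nbrs G v - {y} else if v = y then nbrs G v - {x} else nbrs G v)"
  using simple_edge[OF assms] by (auto simp: delete_edges_def doubleton_eq_iff)

text \<open>An edge in a triangle is no bridge: the path through \<open>w\<close> replaces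
  it.\<close>

lemma connected_delete_edge:
  assumes "connected_graph G" "{x, w} \<in> edges G" "{y, w} \<in> edges G" "x \<noteq> y" "w \<noteq> x" "w \<noteq> y"
  shows "connected_graph (delete_edges G {{x, y}})"
proof -
  let ?D = "delete_edges G {{x, y}}"
  have "adj G \<subseteq> (adj ?D)\<^sup>*"
  proof (rule subrelI)
    fix u v assume uv: "(u, v) \<in> adj G"
    have "(x, w) \<in> adj ?D" "(w, y) \<in> adj ?D" "(y, w) \<in> adj ?D" "(w, x) \<in> adj ?D"
      using assms by (auto simp: adj_def delete_edges_def doubleton_eq_iff edge_commute[of w])
    then have "(x, y) \<in> (adj ?D)\<^sup>*" "(y, x) \<in> (adj ?D)\<^sup>*"
      by (meson converse_rtrancl_into_rtrancl r_into_rtrancl)+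
    moreover have "(u, v) \<in> adj ?D" if "{u, v} \<noteq> {x, y}"
      using uv that by (simp add: adj_def delete_edges_def)
    ultimately show "(u, v) \<in> (adj ?D)\<^sup>*"
      by (cases "{u, v} = {x, y}") (auto simp only: doubleton_eq_iff intro: r_into_rtrancl)
  qed
  then have "(adj G)\<^sup>* \<subseteq> (adj ?D)\<^sup>*" by (rule rtrancl_subset_rtrancl)
  then show ?thesis using assms(1) by (auto simp: connected_graph_def delete_edges_def)
qed

lemma essential_if_degree_4:
  assumes "simple_graph G" "{x, y} \<in> edges G" "card (nbrs G x) = 4"
  shows "essential G {x, y}"
proof -
  have "card (nbrs (delete_edges G {{x, y}}) x) = 3"
    using assms finite_nbrs[OF assms(1)] by (simp add: nbrs_delete_edge)
  moreover have "x \<in> verts (delete_edges G {{x, y}})"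
    using simple_edge[OF assms(1,2)] by (simp add: delete_edges_def)
  ultimately show ?thesis unfolding essential_def class_C_iff by force
qed

text \<open>The common neighbour \<open>w\<close> keeps the graph connected after the deletion, so
  only the degrees of \<open>x\<close> and \<open>y\<close> can leave the class.\<close>

lemma essential_imp_degree_4:
  assumes G: "G \<in> class_C" and xy: "{x, y} \<in> edges G" and ess: "essential G {x, y}"
    and w: "{x, w} \<in> edges G" "{y, w} \<in> edges G"
  shows "card (nbrs G x) = 4 \<or> card (nbrs G y) = 4"
proof (rule ccontr)
  assume neg: "\<not> ?thesis"
  have s: "simple_graph G" and c: "connected_graph G"
    and d: "\<And>v. v \<in> verts G \<Longrightarrow> 4 \<le> card (nbrs G v)"
    using G by (auto simp: class_C_iff)
  note xy' = simple_edge[OF s xy]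
  have "5 \<le> card (nbrs G x)" "5 \<le> card (nbrs G y)"
    using neg d[of x] d[of y] xy' by linarith+
  then have "4 \<le> card (nbrs (delete_edges G {{x, y}}) v)" if "v \<in> verts G" for v
    using d[OF that] xy finite_nbrs[OF s]
    by (auto simp: nbrs_delete_edge[OF s xy] insert_commute)
  then have "delete_edges G {{x, y}} \<in> class_C"
    unfolding class_C_iff
    using delete_edge_simple[OF s] connected_delete_edge[OF c w] xy' simple_edge[OF s w(1)]
      simple_edge[OF s w(2)]
    by (auto simp: delete_edges_def)
  then show False using ess by (simp add: essential_def)
qed

section \<open>Contraction of one edge\<close>

context
  fixes G :: "'a ugraph" and x y :: 'a
  assumes simple: "simple_graph G" and xy: "{x, y} \<in> edges G"
begin

private lemma xy_verts: "x \<in> verts G" "y \<in> verts G" "x \<noteq> y"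
  using simple_edge[OF simple xy] .

private lemma verts_contract:
  "verts (contract G {x, y}) = insert {x, y} ((\<lambda>v. {v}) ` (verts G - {x, y}))"
  by (auto simp: contract_def Let_def)

private lemma edges_contract:
  "{p, q} \<in> edges (contract G {x, y}) \<longleftrightarrow>
     p \<in> verts (contract G {x, y}) \<and> q \<in> verts (contract G {x, y}) \<and> p \<noteq> q \<and>
     (\<exists>u\<in>p. \<exists>v\<in>q. {u, v} \<in> edges G)"
proof -
  define R where "R p q \<longleftrightarrow> p \<in> verts (contract G {x, y}) \<and> q \<in> verts (contract G {x, y}) \<and>
    p \<noteq> q \<and> (\<exists>u\<in>p. \<exists>v\<in>q. {u, v} \<in> edges G)" for p q
  have "R q p" if "R p q" for p q
  proof -
    from that obtain u v where "u \<in> p" "v \<in> q" "{v, u} \<in> edges G"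
      unfolding R_def by (metis insert_commute)
    with that show ?thesis unfolding R_def by blast
  qed
  note sym = doubleton_in_Collect_iff[of R, OF this]
  have "edges (contract G {x, y}) = {{p, q} | p q. R p q}"
    unfolding R_def contract_def Let_def by (simp only: ugraph.select_convs)
  then have "{p, q} \<in> edges (contract G {x, y}) \<longleftrightarrow> R p q"
    by (simp only: sym)
  then show ?thesis by (simp add: R_def)
qed

private lemma simple_contract: "simple_graph (contract G {x, y})"
  unfolding simple_graph_def
proof (intro conjI ballI)
  show "finite (verts (contract G {x, y}))"
    using simple by (simp add: verts_contract simple_graph_def)
next
  fix e assume "e \<in> edges (contract G {x, y})"
  moreover from this obtain p q where "e = {p, q}" by (auto simp: contract_def Let_def)
  ultimately show "e \<subseteq> verts (contract G {x, y})" "card e = 2"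
    by (auto simp: edges_contract)
qed

text \<open>Passing to blocks sends an edge to an edge or to a single block, hence walks to
  walks.\<close>

private lemma connected_contract:
  assumes "connected_graph G"
  shows "connected_graph (contract G {x, y})"
proof -
  let ?K = "contract G {x, y}"
  define block where "block v = (if v \<in> {x, y} then {x, y} else {v})" for v
  have block: "v \<in> block v" for v by (simp add: block_def)
  have block_verts: "verts ?K = block ` verts G"
    using xy_verts by (auto simp: verts_contract block_def)
  have path: "(block u, block v) \<in> (adj ?K)\<^sup>*" if "(u, v) \<in> (adj G)\<^sup>*" for u v
    using that
  proof induction
    case (step v w)
    then have vw: "{v, w} \<in> edges G" by (simp add: adj_def)
    have "(block v, block w) \<in> (adj ?K)\<^sup>*"
    proof (cases "block v = block w")
      case False
      have "\<exists>a\<in>block v. \<exists>b\<in>block w. {a, b} \<in> edges G"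
        using vw block by blast
      then have "{block v, block w} \<in> edges ?K"
        using False simple_edge[OF simple vw] by (auto simp: edges_contract block_verts)
      then have "(block v, block w) \<in> adj ?K" by (simp add: adj_def)
      then show ?thesis by (rule r_into_rtrancl)
    qed simp
    with step.IH show ?case by (rule rtrancl_trans)
  qed simp
  show ?thesis
    using assms path unfolding connected_graph_def block_verts by auto
qed

private lemma nbrs_contract_edge:
  "nbrs (contract G {x, y}) {x, y} = (\<lambda>v. {v}) ` (nbrs G x \<union> nbrs G y - {x, y})"
proof -
  have "{{x, y}, q} \<in> edges (contract G {x, y}) \<longleftrightarrow>
    q \<in> (\<lambda>v. {v}) ` (nbrs G x \<union> nbrs G y - {x, y})" for q
    unfolding edges_contract using simple_edge[OF simple] xy_verts
    by (auto simp: verts_contract)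
  then show ?thesis by (intro set_eqI) (simp only: in_nbrs)
qed

private lemma nbrs_contract_other:
  assumes "w \<in> verts G" "w \<noteq> x" "w \<noteq> y"
  shows "nbrs (contract G {x, y}) {w} =
    (\<lambda>v. {v}) ` (nbrs G w - {x, y}) \<union> (if nbrs G w \<inter> {x, y} = {} then {} else {{x, y}})"
proof -
  have "{{w}, q} \<in> edges (contract G {x, y}) \<longleftrightarrow>
    q \<in> (\<lambda>v. {v}) ` (nbrs G w - {x, y}) \<union> (if nbrs G w \<inter> {x, y} = {} then {} else {{x, y}})" for q
    unfolding edges_contract using simple_edge[OF simple, of w] simple_no_loop[OF simple, of w] xy_verts assms
    by (auto simp: verts_contract edge_commute[of _ w])
  then show ?thesis by (intro set_eqI) (simp only: in_nbrs)
qed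

text \<open>Merging \<open>x\<close> and \<open>y\<close> costs \<open>w\<close> one neighbour if it
  saw both of them, and none otherwise.\<close>

private lemma card_nbrs_contract_other:
  assumes "w \<in> verts G" "w \<noteq> x" "w \<noteq> y"
  shows "card (nbrs (contract G {x, y}) {w}) =
    (if w \<in> nbrs G x \<inter> nbrs G y then card (nbrs G w) - 1 else card (nbrs G w))"
proof -
  note fin = finite_nbrs[OF simple, of w]
  have sing: "card ((\<lambda>v. {v}) ` A) = card A" for A :: "'a set"
    by (rule card_image) simp
  have notin: "{x, y} \<notin> (\<lambda>v. {v}) ` A" for A :: "'a set"
    using xy_verts by auto
  have "card (nbrs (contract G {x, y}) {w}) =
    card (nbrs G w - {x, y}) + (if nbrs G w \<inter> {x, y} = {} then 0 else 1)"
    unfolding nbrs_contract_other[OF assms] using fin notin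
    by (simp add: card_insert_if sing)
  moreover have "card (nbrs G w - {x, y}) = card (nbrs G w) - card (nbrs G w \<inter> {x, y})"
    using fin by (simp add: card_Diff_subset_Int)
  moreover have "card (nbrs G w \<inter> {x, y}) \<le> card (nbrs G w)"
    using fin by (simp add: card_mono)
  moreover have "nbrs G w \<inter> {x, y} =
      (if {x, w} \<in> edges G then {x} else {}) \<union> (if {y, w} \<in> edges G then {y} else {})"
    by (auto simp: insert_commute)
  ultimately show ?thesis using xy_verts(3) by (auto split: if_splits)
qed

text \<open>A contraction stays simple and connected, so it can leave the class only through a
  degree: off the edge at a common neighbour, or at the merged vertex, when only three vertices
  surround the edge.\<close>

lemma critical_iff:
  assumes G: "G \<in> class_C"
  shows "critical G {x, y} \<longleftrightarrow>
    (\<exists>w\<in>nbrs G x \<inter> nbrs G y. card (nbrs G w) = 4) \<or>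
    card (nbrs G x) = 4 \<and> card (nbrs G y) = 4 \<and> insert x (nbrs G x) = insert y (nbrs G y)"
    (is "_ \<longleftrightarrow> ?A \<or> ?B")
proof -
  let ?K = "contract G {x, y}" and ?X = "nbrs G x" and ?Y = "nbrs G y"
  have d: "\<And>v. v \<in> verts G \<Longrightarrow> 4 \<le> card (nbrs G v)" and conn: "connected_graph G"
    using G by (auto simp: class_C_iff)
  note fin = finite_nbrs[OF simple]
  have "critical G {x, y} \<longleftrightarrow> (\<exists>p\<in>verts ?K. card (nbrs ?K p) < 4)"
    using simple_contract connected_contract[OF conn]
    by (auto simp: critical_def class_C_iff not_le)
  also have "\<dots> \<longleftrightarrow> card (nbrs ?K {x, y}) < 4 \<or>
      (\<exists>w\<in>verts G. w \<noteq> x \<and> w \<noteq> y \<and> card (nbrs ?K {w}) < 4)"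
    by (auto simp: verts_contract)
  also have "(\<exists>w\<in>verts G. w \<noteq> x \<and> w \<noteq> y \<and> card (nbrs ?K {w}) < 4) \<longleftrightarrow> ?A"
  proof
    assume "\<exists>w\<in>verts G. w \<noteq> x \<and> w \<noteq> y \<and> card (nbrs ?K {w}) < 4"
    then obtain w where w: "w \<in> verts G" "w \<noteq> x" "w \<noteq> y" "card (nbrs ?K {w}) < 4" by blast
    then have "w \<in> ?X \<inter> ?Y" "card (nbrs G w) = 4"
      using d[OF w(1)] card_nbrs_contract_other[OF w(1-3)] by (auto split: if_splits)
    then show ?A by blast
  next
    assume ?A
    then obtain w where w: "w \<in> ?X \<inter> ?Y" "card (nbrs G w) = 4" by blast
    then have "w \<in> verts G" "w \<noteq> x" "w \<noteq> y"
      using simple_edge[OF simple, of x w] simple_edge[OF simple, of y w] by auto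
    with w card_nbrs_contract_other show "\<exists>w\<in>verts G. w \<noteq> x \<and> w \<noteq> y \<and> card (nbrs ?K {w}) < 4"
      by (intro bexI[of _ w]) auto
  qed
  also have "card (nbrs ?K {x, y}) = card (?X \<union> ?Y - {x, y})"
    unfolding nbrs_contract_edge by (rule card_image) simp
  also have "card (?X \<union> ?Y - {x, y}) < 4 \<longleftrightarrow> ?B"
  proof -
    have x: "x \<notin> ?X" "y \<in> ?X" and y: "y \<notin> ?Y" "x \<in> ?Y"
      using xy simple_no_loop[OF simple] by (auto simp: insert_commute)
    have d4: "4 \<le> card ?X" "4 \<le> card ?Y" using d xy_verts by auto
    \<comment> \<open>Both punctured neighbourhoods have at least three elements and lie in the set
      that surrounds the edge. If that set has at most three elements, all three sets
      coincide.\<close>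
    have subX: "?X - {y} \<subseteq> ?X \<union> ?Y - {x, y}" and subY: "?Y - {x} \<subseteq> ?X \<union> ?Y - {x, y}"
      using x y by auto
    have fU: "finite (?X \<union> ?Y - {x, y})" using fin by auto
    show ?thesis
    proof
      assume "card (?X \<union> ?Y - {x, y}) < 4"
      then have le: "card (?X \<union> ?Y - {x, y}) \<le> 3" by simp
      have cX: "card (?X - {y}) = card ?X - 1" and cY: "card (?Y - {x}) = card ?Y - 1"
        using x y fin by auto
      have mX: "card (?X - {y}) \<le> card (?X \<union> ?Y - {x, y})"
        and mY: "card (?Y - {x}) \<le> card (?X \<union> ?Y - {x, y})"
        using card_mono[OF fU] subX subY by auto
      have "card ?X = 4" "card ?Y = 4" using mX mY cX cY d4 le by linarith+
      moreover have "?X - {y} = ?X \<union> ?Y - {x, y}" "?Y - {x} = ?X \<union> ?Y - {x, y}"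
        using card_subset_eq[OF fU subX] card_subset_eq[OF fU subY] mX mY cX cY le calculation
        by linarith+
      then have "?X - {y} = ?Y - {x}" by simp
      then have "insert x ?X = insert y ?Y" using x y by blast
      ultimately show ?B by blast
    next
      assume B: ?B
      then have "?X \<union> ?Y - {x, y} = ?X - {y}" using x y by blast
      then show "card (?X \<union> ?Y - {x, y}) < 4" using B x fin by simp
    qed
  qed
  finally show ?thesis by blast
qed

end

definition locally_critical :: "'a ugraph \<Rightarrow> bool" where
  "locally_critical G \<longleftrightarrow> (\<forall>x y. {x, y} \<in> edges G \<longrightarrow>
     (card (nbrs G x) = 4 \<or> card (nbrs G y) = 4) \<and>
     ((\<exists>w\<in>nbrs G x \<inter> nbrs G y. card (nbrs G w) = 4) \<or>
      card (nbrs G x) = 4 \<and> card (nbrs G y) = 4 \<and>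
      insert x (nbrs G x) = insert y (nbrs G y)))"

lemma minimal_critical_iff: "minimal_critical G \<longleftrightarrow> G \<in> class_C \<and> locally_critical G"
proof (cases "G \<in> class_C")
  case True
  then have s: "simple_graph G" by (simp add: class_C_iff)
  have "minimal_critical G \<longleftrightarrow>
    (\<forall>x y. {x, y} \<in> edges G \<longrightarrow> essential G {x, y} \<and> critical G {x, y})"
    using True simple_edgeE[OF s] unfolding minimal_critical_def by metis
  also have "\<dots> \<longleftrightarrow> locally_critical G"
    unfolding locally_critical_def
  proof (intro iff_allI imp_cong refl)
    fix x y assume xy: "{x, y} \<in> edges G"
    note crit = critical_iff[OF s xy True]
    show "essential G {x, y} \<and> critical G {x, y} \<longleftrightarrow>
      (card (nbrs G x) = 4 \<or> card (nbrs G y) = 4) \<and>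
      ((\<exists>w\<in>nbrs G x \<inter> nbrs G y. card (nbrs G w) = 4) \<or>
       card (nbrs G x) = 4 \<and> card (nbrs G y) = 4 \<and>
       insert x (nbrs G x) = insert y (nbrs G y))"
    proof (cases "card (nbrs G x) = 4 \<or> card (nbrs G y) = 4")
      case deg: True
      then have "essential G {x, y}"
        using essential_if_degree_4[OF s] xy by (metis insert_commute)
      with deg crit show ?thesis by blast
    next
      \<comment> \<open>Criticality must now come from a common neighbour, and with a common
        neighbour essentiality would force an end of degree four.\<close>
      case False
      then show ?thesis
        using crit essential_imp_degree_4[OF True xy] by auto
    qed
  qed
  finally show ?thesis using True by simp
qed (simp add: minimal_critical_def)

section \<open>Graphs given by index pairs on a list of vertices\<close>

text \<open>\<open>es\<close> is a shape and \<open>ys\<close> names its vertices. Isomorphism with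
  a fixed brick thus becomes an equation for some \<open>ys\<close>, and properties of the brick
  become finite checks on indices.\<close>

definition lgraph :: "(nat \<times> nat) list \<Rightarrow> 'a list \<Rightarrow> 'a ugraph" where
  "lgraph es ys = \<lparr>verts = set ys, edges = (\<lambda>(i, j). {ys ! i, ys ! j}) ` set es\<rparr>"

text \<open>The orientation \<open>i < j\<close> gives each edge exactly one index pair, so that
  \<open>length es\<close> counts edges and removing pairs removes edges.\<close>

definition wf_shape :: "nat \<Rightarrow> (nat \<times> nat) list \<Rightarrow> bool" where
  "wf_shape n es \<longleftrightarrow> distinct es \<and> (\<forall>(i, j)\<in>set es. i < j \<and> j < n)"

definition ladj :: "(nat \<times> nat) list \<Rightarrow> nat \<Rightarrow> nat \<Rightarrow> bool" where
  "ladj es i j \<longleftrightarrow> (i, j) \<in> set es \<or> (j, i) \<in> set es"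

definition lnbrs :: "nat \<Rightarrow> (nat \<times> nat) list \<Rightarrow> nat \<Rightarrow> nat list" where
  "lnbrs n es i = filter (ladj es i) [0..<n]"

definition copy :: "nat \<Rightarrow> (nat \<times> nat) list \<Rightarrow> 'a ugraph \<Rightarrow> bool" where
  "copy n es B \<longleftrightarrow> (\<exists>ys. distinct ys \<and> length ys = n \<and> B = lgraph es ys)"

lemma verts_lgraph [simp]: "verts (lgraph es ys) = set ys"
  by (simp add: lgraph_def)

lemma lgraph_edge_iff:
  assumes "wf_shape n es" "distinct ys" "length ys = n" "i < n" "j < n"
  shows "{ys ! i, ys ! j} \<in> edges (lgraph es ys) \<longleftrightarrow> ladj es i j"
proof
  assume "{ys ! i, ys ! j} \<in> edges (lgraph es ys)"
  then obtain a b where ab: "(a, b) \<in> set es" "{ys ! i, ys ! j} = {ys ! a, ys ! b}"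
    by (auto simp: lgraph_def)
  then have "a < n" "b < n" using assms(1) by (auto simp: wf_shape_def)
  then show "ladj es i j"
    using ab assms by (auto simp: doubleton_eq_iff nth_eq_iff_index_eq ladj_def)
next
  assume "ladj es i j"
  then show "{ys ! i, ys ! j} \<in> edges (lgraph es ys)"
    by (force simp: lgraph_def ladj_def insert_commute)
qed

lemma simple_lgraph:
  assumes "wf_shape n es" "distinct ys" "length ys = n"
  shows "simple_graph (lgraph es ys)"
  unfolding simple_graph_def
proof (intro conjI ballI)
  fix e assume "e \<in> edges (lgraph es ys)"
  then obtain i j where "(i, j) \<in> set es" and e: "e = {ys ! i, ys ! j}"
    by (auto simp: lgraph_def)
  then have "i < j" "j < n" using assms(1) by (auto simp: wf_shape_def)
  then show "e \<subseteq> verts (lgraph es ys)" "card e = 2"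
    using e assms by (auto simp: nth_eq_iff_index_eq card_insert_if)
qed (simp add: lgraph_def)

lemma lgraph_eqI:
  assumes "simple_graph Q" "wf_shape n es" "distinct ys" "length ys = n" "verts Q = set ys"
    and "\<And>i j. i < n \<Longrightarrow> j < n \<Longrightarrow> {ys ! i, ys ! j} \<in> edges Q \<longleftrightarrow> ladj es i j"
  shows "Q = lgraph es ys"
proof -
  have idx: "\<exists>i<n. u = ys ! i" if "u \<in> verts Q" for u
    using that assms by (metis in_set_conv_nth)
  have "{u, v} \<in> edges Q \<longleftrightarrow> {u, v} \<in> edges (lgraph es ys)" if "u \<in> verts Q" "v \<in> verts Q" for u v
    using idx[OF that(1)] idx[OF that(2)] assms lgraph_edge_iff[OF assms(2-4)] by auto
  then have "edges Q = edges (lgraph es ys)"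
    using simple_edgeE[OF assms(1)] simple_edgeE[OF simple_lgraph[OF assms(2-4)]]
      assms(5) verts_lgraph[of es ys]
    by (intro set_eqI) metis
  then show ?thesis using assms(5) by (simp add: lgraph_def)
qed

lemma copy_imp_iso:
  assumes "copy n es B" "wf_shape n es" "distinct xs" "length xs = n"
  shows "B \<simeq>\<^sub>g lgraph es xs"
proof -
  obtain ys where ys: "distinct ys" "length ys = n" "B = lgraph es ys"
    using assms(1) by (auto simp: copy_def)
  \<comment> \<open>Relabelling by position: \<open>f\<close> sends \<open>ys ! i\<close> to
    \<open>xs ! i\<close>.\<close>
  define f where "f u = xs ! (THE i. i < n \<and> u = ys ! i)" for u
  have f: "f (ys ! i) = xs ! i" if "i < n" for i
  proof -
    have "(THE j. j < n \<and> ys ! i = ys ! j) = i"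
      using that ys by (intro the_equality) (auto simp: nth_eq_iff_index_eq)
    then show ?thesis by (simp add: f_def)
  qed
  have idx: "\<exists>i<n. u = ys ! i" if "u \<in> set ys" for u
    using that ys by (metis in_set_conv_nth)
  have "map f ys = xs"
    using f ys assms(4) by (intro nth_equalityI) auto
  then have "bij_betw f (set ys) (set xs)"
    using assms(3) by (metis bij_betw_def distinct_map set_map)
  moreover have "{u, v} \<in> edges B \<longleftrightarrow> {f u, f v} \<in> edges (lgraph es xs)"
    if "u \<in> set ys" "v \<in> set ys" for u v
    using idx[OF that(1)] idx[OF that(2)] f lgraph_edge_iff[OF assms(2) ys(1,2)]
      lgraph_edge_iff[OF assms(2-4)] ys(3) by auto
  ultimately show ?thesis unfolding graph_iso_def using ys(3) by auto
qed

lemma iso_imp_copy: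
  assumes "simple_graph B" "B \<simeq>\<^sub>g lgraph es xs" "wf_shape n es" "distinct xs" "length xs = n"
  shows "copy n es B"
proof -
  obtain f where f: "bij_betw f (verts B) (set xs)"
    "\<And>u v. u \<in> verts B \<Longrightarrow> v \<in> verts B \<Longrightarrow> {u, v} \<in> edges B \<longleftrightarrow> {f u, f v} \<in> edges (lgraph es xs)"
    using assms(2) by (auto simp: graph_iso_def)
  define g where "g = inv_into (verts B) f"
  have g: "bij_betw g (set xs) (verts B)" unfolding g_def by (rule bij_betw_inv_into[OF f(1)])
  have fg: "f (g x) = x" if "x \<in> set xs" for x
    unfolding g_def using f(1) that by (simp add: bij_betw_inv_into_right)
  have gv: "g x \<in> verts B" if "x \<in> set xs" for x using g that by (auto simp: bij_betw_def)
  have "B = lgraph es (map g xs)"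
  proof (rule lgraph_eqI[OF assms(1,3)])
    show "distinct (map g xs)" "verts B = set (map g xs)"
      using g assms(4) by (auto simp: distinct_map bij_betw_def)
    fix i j assume "i < n" "j < n"
    then show "{map g xs ! i, map g xs ! j} \<in> edges B \<longleftrightarrow> ladj es i j"
      using assms f(2)[OF gv gv, of "xs ! i" "xs ! j"] fg lgraph_edge_iff[OF assms(3-5)] by auto
  qed (simp add: assms)
  then show ?thesis
    using g assms(4,5) unfolding copy_def
    by (intro exI[of _ "map g xs"]) (auto simp: distinct_map bij_betw_def)
qed

lemma iso_lgraph_iff_copy:
  assumes "simple_graph B" "wf_shape n es" "distinct xs" "length xs = n"
  shows "B \<simeq>\<^sub>g lgraph es xs \<longleftrightarrow> copy n es B"
  using assms copy_imp_iso iso_imp_copy by metis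

lemma inj_on_index_pairs:
  assumes "distinct ys" "\<And>i j. (i, j) \<in> S \<Longrightarrow> i < j \<and> j < length ys"
  shows "inj_on (\<lambda>(i, j). {ys ! i, ys ! j}) S"
proof (rule inj_onI, clarsimp simp only: split_paired_all prod.case)
  fix i j k l assume ij: "(i, j) \<in> S" and kl: "(k, l) \<in> S"
    and eq: "{ys ! i, ys ! j} = {ys ! k, ys ! l}"
  have "i < j" "k < l" "i < length ys" "j < length ys" "k < length ys" "l < length ys"
    using assms(2)[OF ij] assms(2)[OF kl] by auto
  then show "i = k \<and> j = l"
    using eq assms(1) by (auto simp: doubleton_eq_iff nth_eq_iff_index_eq)
qed

text \<open>These two numbers are the invariant by which the shapes are told apart.\<close>

lemma card_copy:
  assumes "copy n es B" "wf_shape n es"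
  shows "card (verts B) = n" "card (edges B) = length es"
proof -
  obtain ys where ys: "distinct ys" "length ys = n" "B = lgraph es ys"
    using assms(1) by (auto simp: copy_def)
  show "card (verts B) = n" using ys by (simp add: distinct_card)
  have "inj_on (\<lambda>(i, j). {ys ! i, ys ! j}) (set es)"
    using assms(2) ys by (intro inj_on_index_pairs) (auto simp: wf_shape_def)
  then show "card (edges B) = length es"
    using ys assms(2) by (simp add: lgraph_def card_image distinct_card wf_shape_def)
qed

lemma nbrs_lgraph:
  assumes "wf_shape n es" "distinct ys" "length ys = n" "i < n"
  shows "nbrs (lgraph es ys) (ys ! i) = (!) ys ` set (lnbrs n es i)"
proof -
  have idx: "\<exists>j<n. u = ys ! j" if "{ys ! i, u} \<in> edges (lgraph es ys)" for u
    using simple_edge(2)[OF simple_lgraph[OF assms(1-3)] that] assms(3)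
    by (metis in_set_conv_nth verts_lgraph)
  show ?thesis
    using idx lgraph_edge_iff[OF assms(1-4)] by (auto simp: lnbrs_def image_iff) blast
qed

lemma degree_lgraph:
  assumes "wf_shape n es" "distinct ys" "length ys = n" "i < n"
  shows "degree (lgraph es ys) (ys ! i) = length (lnbrs n es i)"
proof -
  have "inj_on ((!) ys) (set (lnbrs n es i))"
    using assms by (auto simp: inj_on_def nth_eq_iff_index_eq lnbrs_def)
  then have "card (nbrs (lgraph es ys) (ys ! i)) = card (set (lnbrs n es i))"
    unfolding nbrs_lgraph[OF assms] by (rule card_image)
  also have "\<dots> = length (lnbrs n es i)" by (rule distinct_card) (simp add: lnbrs_def)
  finally show ?thesis by (simp add: degree_eq_card_nbrs[OF simple_lgraph[OF assms(1-3)]])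
qed

lemma delete_edges_lgraph:
  assumes "wf_shape n es" "wf_shape n ds" "distinct ys" "length ys = n"
  shows "delete_edges (lgraph es ys) (edges (lgraph ds ys)) = lgraph (filter (\<lambda>d. d \<notin> set ds) es) ys"
proof -
  have "inj_on (\<lambda>(i, j). {ys ! i, ys ! j}) (set es \<union> set ds)"
    using assms by (intro inj_on_index_pairs) (auto simp: wf_shape_def)
  from inj_on_image_set_diff[OF this, of "set es" "set ds"] show ?thesis
    by (simp add: delete_edges_def lgraph_def set_diff_eq Collect_mono_iff subset_eq)
qed

section \<open>The shapes of the bricks\<close>

text \<open>In every list of index pairs the vertices of attachment come first; in \<open>K222_es\<close>
  the indices \<open>i\<close> and \<open>i + 3\<close> are antipodal.\<close>

definition "K3_es = [(0::nat, 1::nat), (0, 2), (1, 2)]"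
definition "K5_es = [(0::nat, 1::nat), (0, 2), (0, 3), (0, 4), (1, 2), (1, 3), (1, 4), (2, 3), (2, 4), (3, 4)]"
definition "K222_es = [(0::nat, 1::nat), (0, 2), (0, 4), (0, 5), (1, 2), (1, 3), (1, 5), (2, 3), (2, 4),
  (3, 4), (3, 5), (4, 5)]"
definition "K5m_es = [(0::nat, 2::nat), (0, 3), (0, 4), (1, 2), (1, 3), (1, 4), (2, 3), (2, 4), (3, 4)]"
definition "K222m_es = [(0::nat, 2::nat), (0, 4), (0, 5), (1, 2), (1, 3), (1, 5), (2, 3), (2, 4),
  (3, 4), (3, 5), (4, 5)]"
definition "K5t_es = [(0::nat, 3::nat), (0, 4), (1, 3), (1, 4), (2, 3), (2, 4), (3, 4)]"
definition "K222t_es = [(0::nat, 4::nat), (0, 5), (1, 3), (1, 5), (2, 3), (2, 4), (3, 4), (3, 5), (4, 5)]"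
text \<open>Indices 0 and 1 are the new vertices \<open>y\<close> and \<open>z\<close>, 2 and 3 the
  ends of \<open>e'\<close>, 4 and 5 those of \<open>f'\<close>. In \<open>K222b_es\<close> index 6
  is the antipode of the removed vertex.\<close>

definition "K5b_es = [(0::nat, 2::nat), (0, 3), (1, 4), (1, 5), (2, 3), (2, 4), (2, 5), (3, 4), (3, 5), (4, 5)]"
definition "K222b_es = [(0::nat, 2::nat), (0, 3), (1, 4), (1, 5), (2, 3), (3, 4), (4, 5), (2, 5),
  (2, 6), (3, 6), (4, 6), (5, 6)]"

lemmas es_defs = K3_es_def K5_es_def K222_es_def K5m_es_def K222m_es_def K5t_es_def K222t_es_def
  K5b_es_def K222b_es_def

lemma wf_shapes [simp]:
  "wf_shape 3 K3_es" "wf_shape 5 K5_es" "wf_shape 6 K222_es" "wf_shape 5 K5m_es" "wf_shape 6 K222m_es"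
  "wf_shape 5 K5t_es" "wf_shape 6 K222t_es" "wf_shape 6 K5b_es" "wf_shape 7 K222b_es"
  by (simp_all add: wf_shape_def es_defs)

section \<open>Enumerations of \<open>K3\<close>, \<open>K5\<close> and the octahedron\<close>

lemma complete_graph_edge_iff: "{u, v} \<in> edges (complete_graph n) \<longleftrightarrow> u < n \<and> v < n \<and> u \<noteq> v"
  unfolding complete_graph_def by (auto simp: doubleton_eq_iff)

lemma K222_edge_iff: "{u, v} \<in> edges K222 \<longleftrightarrow> u < 6 \<and> v < 6 \<and> u mod 3 \<noteq> v mod 3"
  unfolding K222_def by (auto simp: doubleton_eq_iff)

lemma simple_complete_graph: "simple_graph (complete_graph n)"
  by (auto simp: simple_graph_def complete_graph_def card_insert_if)

lemma simple_K222: "simple_graph K222"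
proof -
  have "card {i, j} = 2" if "i mod 3 \<noteq> j mod 3" for i j :: nat
    using that by (cases "i = j") (auto simp: card_insert_if)
  then show ?thesis by (auto simp: simple_graph_def K222_def)
qed

lemma ladj_K3: "i < 3 \<Longrightarrow> j < 3 \<Longrightarrow> ladj K3_es i j \<longleftrightarrow> i \<noteq> j"
proof -
  have "\<forall>i\<in>set [0..<3]. \<forall>j\<in>set [0..<3]. ladj K3_es i j \<longleftrightarrow> i \<noteq> j" by code_simp
  then show "i < 3 \<Longrightarrow> j < 3 \<Longrightarrow> ladj K3_es i j \<longleftrightarrow> i \<noteq> j" by simp
qed

lemma ladj_K5: "i < 5 \<Longrightarrow> j < 5 \<Longrightarrow> ladj K5_es i j \<longleftrightarrow> i \<noteq> j"
proof -
  have "\<forall>i\<in>set [0..<5]. \<forall>j\<in>set [0..<5]. ladj K5_es i j \<longleftrightarrow> i \<noteq> j" by code_simp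
  then show "i < 5 \<Longrightarrow> j < 5 \<Longrightarrow> ladj K5_es i j \<longleftrightarrow> i \<noteq> j" by simp
qed

lemma ladj_K222: "i < 6 \<Longrightarrow> j < 6 \<Longrightarrow> ladj K222_es i j \<longleftrightarrow> i mod 3 \<noteq> j mod 3"
proof -
  have "\<forall>i\<in>set [0..<6]. \<forall>j\<in>set [0..<6]. ladj K222_es i j \<longleftrightarrow> i mod 3 \<noteq> j mod 3" by code_simp
  then show "i < 6 \<Longrightarrow> j < 6 \<Longrightarrow> ladj K222_es i j \<longleftrightarrow> i mod 3 \<noteq> j mod 3" by simp
qed

lemma complete_graph_eq_lgraph:
  assumes "distinct xs" "set xs = {..<n}" "wf_shape n es"
    and "\<And>i j. i < n \<Longrightarrow> j < n \<Longrightarrow> ladj es i j \<longleftrightarrow> i \<noteq> j"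
  shows "complete_graph n = lgraph es xs"
proof -
  have len: "length xs = n" using assms(1,2) by (metis card_lessThan distinct_card)
  show ?thesis
  proof (rule lgraph_eqI[OF simple_complete_graph assms(3,1) len])
    show "verts (complete_graph n) = set xs" using assms by (simp add: complete_graph_def)
    fix i j assume ij: "i < n" "j < n"
    then have "xs ! i < n" "xs ! j < n" using len assms(2) nth_mem by blast+
    then show "{xs ! i, xs ! j} \<in> edges (complete_graph n) \<longleftrightarrow> ladj es i j"
      using ij len assms(1,4) by (simp add: complete_graph_edge_iff nth_eq_iff_index_eq)
  qed
qed

lemma K3_eq_lgraph: "distinct xs \<Longrightarrow> set xs = {..<3} \<Longrightarrow> K3 = lgraph K3_es xs"
  by (intro complete_graph_eq_lgraph) (simp_all add: ladj_K3)

lemma K5_eq_lgraph: "distinct xs \<Longrightarrow> set xs = {..<5} \<Longrightarrow> K5 = lgraph K5_es xs"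
  by (intro complete_graph_eq_lgraph) (simp_all add: ladj_K5)

text \<open>The symmetry of the octahedron: three vertices of different colours, followed by their
  antipodes, can be put in the place of any other such triple. Hence all its edges, and all its
  triangles, are alike. Antipodes differ by three modulo six.\<close>

lemma K222_eq_lgraph:
  assumes abc: "a < 6" "b < 6" "c < 6" "a mod 3 \<noteq> b mod 3" "b mod 3 \<noteq> c mod 3" "a mod 3 \<noteq> c mod 3"
  defines "xs \<equiv> [a, b, c, (a + 3) mod 6, (b + 3) mod 6, (c + 3) mod (6::nat)]"
  shows "distinct xs" "K222 = lgraph K222_es xs"
proof -
  have m: "(x + 3) mod 6 mod 3 = x mod (3::nat)" for x
    by (simp add: mod_mod_cancel)
  have ne: "(x + 3) mod 6 \<noteq> x" for x :: nat by presburger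
  show dist: "distinct xs"
    unfolding xs_def using abc ne[of a] ne[of b] ne[of c] m[of a] m[of b] m[of c]
    by (simp; intro conjI; metis)
  have "set xs \<subseteq> {..<6}" using abc by (auto simp: xs_def)
  moreover have "card (set xs) = 6" using distinct_card[OF dist] by (simp add: xs_def)
  ultimately have set: "set xs = {..<6}" by (intro card_subset_eq) auto
  show "K222 = lgraph K222_es xs"
  proof (rule lgraph_eqI[OF simple_K222 _ dist])
    fix i j :: nat assume ij: "i < 6" "j < 6"
    have len: "length xs = 6" by (simp add: xs_def)
    have lt: "xs ! i < 6" "xs ! j < 6" using ij len set nth_mem by (metis lessThan_iff)+
    \<comment> \<open>Adding three keeps the colour, so position \<open>k\<close> has the colour of
      position \<open>k mod 3\<close>.\<close>
    have r: "xs ! k mod 3 = [a mod 3, b mod 3, c mod 3] ! (k mod 3)" if "k < 6" for k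
    proof -
      have "k \<in> {0, 1, 2, 3, 4, 5}" using that by auto
      then show ?thesis using m by (auto simp: xs_def)
    qed
    have d: "distinct [a mod 3, b mod 3, c mod 3]" using abc by auto
    have "[a mod 3, b mod 3, c mod 3] ! (i mod 3) = [a mod 3, b mod 3, c mod 3] ! (j mod 3)
        \<longleftrightarrow> i mod 3 = j mod 3"
      by (rule nth_eq_iff_index_eq[OF d]) auto
    then show "{xs ! i, xs ! j} \<in> edges K222 \<longleftrightarrow> ladj K222_es i j"
      using lt ij r by (simp add: K222_edge_iff ladj_K222)
  qed (use set in \<open>auto simp: xs_def K222_def\<close>)
qed

lemma K3_eq: "K3 = lgraph K3_es [0..<3]"
  by (intro K3_eq_lgraph) auto

lemma K5_eq: "K5 = lgraph K5_es [0..<5]"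
  by (intro K5_eq_lgraph) auto

lemma K222_eq: "K222 = lgraph K222_es [0..<6]"
proof -
  have "[0..<6] = [0, 1, 2, 3, 4, 5::nat]" by code_simp
  then show ?thesis using K222_eq_lgraph(2)[of 0 1 2] by simp
qed

section \<open>The brick operations as shapes\<close>

lemma iso_K3_iff: "simple_graph B \<Longrightarrow> B \<simeq>\<^sub>g K3 \<longleftrightarrow> copy 3 K3_es B"
  unfolding K3_eq by (rule iso_lgraph_iff_copy) simp_all

lemma iso_K5_iff: "simple_graph B \<Longrightarrow> B \<simeq>\<^sub>g K5 \<longleftrightarrow> copy 5 K5_es B"
  unfolding K5_eq by (rule iso_lgraph_iff_copy) simp_all

lemma iso_K222_iff: "simple_graph B \<Longrightarrow> B \<simeq>\<^sub>g K222 \<longleftrightarrow> copy 6 K222_es B"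
  unfolding K222_eq by (rule iso_lgraph_iff_copy) simp_all

text \<open>The premise on \<open>Q\<close> is edge-transitivity: any edge can be moved to positions
  0 and 1, so every choice of the deleted edge leads to the same shape.\<close>

lemma is_minus_iff_copy:
  assumes "simple_graph B" "wf_shape n es" "wf_shape n es'" "2 \<le> n"
    and es': "es' = filter (\<lambda>d. d \<noteq> (0, 1)) es" and ne: "edges Q \<noteq> {}"
    and Q: "\<And>e. e \<in> edges Q \<Longrightarrow>
      \<exists>xs. distinct xs \<and> length xs = n \<and> Q = lgraph es xs \<and> e = {xs ! 0, xs ! 1}"
  shows "is_minus Q B \<longleftrightarrow> copy n es' B"
proof -
  have "B \<simeq>\<^sub>g delete_edges Q {e} \<longleftrightarrow> copy n es' B" if "e \<in> edges Q" for e
  proof -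
    from Q[OF that] obtain xs where xs: "distinct xs" "length xs = n" "Q = lgraph es xs"
      "e = {xs ! 0, xs ! 1}" by blast
    have "delete_edges Q {e} = delete_edges (lgraph es xs) (edges (lgraph [(0, 1)] xs))"
      using xs by (simp add: lgraph_def)
    also have "\<dots> = lgraph es' xs"
      using xs assms(2,4) by (subst delete_edges_lgraph) (auto simp: wf_shape_def es')
    finally show ?thesis using iso_lgraph_iff_copy[OF assms(1,3) xs(1,2)] by simp
  qed
  then show ?thesis using ne by (auto simp: is_minus_def)
qed

text \<open>As for a single edge, with transitivity on triangles expressed by enumerations that
  start with the triangle.\<close>

lemma is_triangle_deleted_iff_copy:
  assumes "simple_graph B" "wf_shape n es" "wf_shape n es'" "3 \<le> n"
    and es': "es' = filter (\<lambda>d. d \<notin> set [(0, 1), (1, 2), (0, 2)]) es"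
    and ne: "{{p, q}, {q, r}, {p, r}} \<subseteq> edges Q"
    and Q: "\<And>a b c. {{a, b}, {b, c}, {a, c}} \<subseteq> edges Q \<Longrightarrow>
      \<exists>xs. distinct xs \<and> length xs = n \<and> Q = lgraph es xs \<and> a = xs ! 0 \<and> b = xs ! 1 \<and> c = xs ! 2"
  shows "is_triangle_deleted Q B \<longleftrightarrow> copy n es' B"
proof -
  have *: "B \<simeq>\<^sub>g delete_edges Q {{a, b}, {b, c}, {a, c}} \<longleftrightarrow> copy n es' B"
    if "{{a, b}, {b, c}, {a, c}} \<subseteq> edges Q" for a b c
  proof -
    from Q[OF that] obtain xs where xs: "distinct xs" "length xs = n" "Q = lgraph es xs"
      "a = xs ! 0" "b = xs ! 1" "c = xs ! 2" by blast
    have "delete_edges Q {{a, b}, {b, c}, {a, c}} =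
        delete_edges (lgraph es xs) (edges (lgraph [(0, 1), (1, 2), (0, 2)] xs))"
      using xs by (simp add: lgraph_def)
    also have "\<dots> = lgraph es' xs"
      unfolding es' using xs assms(2,4)
      by (intro delete_edges_lgraph) (auto simp: wf_shape_def)
    finally show ?thesis using iso_lgraph_iff_copy[OF assms(1,3) xs(1,2)] by simp
  qed
  show ?thesis
  proof
    assume "copy n es' B"
    then show "is_triangle_deleted Q B"
      unfolding is_triangle_deleted_def
      by (intro exI[of _ p] exI[of _ q] exI[of _ r] conjI ne) (simp only: *[OF ne])
  next
    assume "is_triangle_deleted Q B"
    then show "copy n es' B"
      unfolding is_triangle_deleted_def by (elim exE conjE) (simp only: *)
  qed
qed

lemma extend_to_enumeration:
  assumes "distinct zs" "set zs \<subseteq> {..<n}"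
  obtains xs where "distinct (zs @ xs)" "set (zs @ xs) = {..<n}" "length (zs @ xs) = n"
proof -
  define xs where "xs = sorted_list_of_set ({..<n} - set zs)"
  have xs: "distinct (zs @ xs)" "set (zs @ xs) = {..<n}" using assms by (auto simp: xs_def)
  moreover have "length (zs @ xs) = n" using xs by (metis card_lessThan distinct_card)
  ultimately show ?thesis by (rule that)
qed

lemma is_minus_K5_iff: "simple_graph B \<Longrightarrow> is_minus K5 B \<longleftrightarrow> copy 5 K5m_es B"
proof (rule is_minus_iff_copy[where es = K5_es])
  show "edges K5 \<noteq> {}" using complete_graph_edge_iff[of 0 1 5] by auto
next
  fix e assume "e \<in> edges K5"
  then obtain i j where e: "e = {i, j}" "i < 5" "j < 5" "i \<noteq> j"
    by (auto simp: complete_graph_def)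
  then have "distinct [i, j]" "set [i, j] \<subseteq> {..<5}" by auto
  from extend_to_enumeration[OF this] obtain xs where
    xs: "distinct ([i, j] @ xs)" "set ([i, j] @ xs) = {..<5}" "length ([i, j] @ xs) = 5" .
  show "\<exists>xs. distinct xs \<and> length xs = 5 \<and> K5 = lgraph K5_es xs \<and> e = {xs ! 0, xs ! 1}"
    using e by (intro exI[of _ "[i, j] @ xs"] conjI xs K5_eq_lgraph[OF xs(1,2)]) simp
qed (simp_all, simp_all add: es_defs)

lemma is_triangle_deleted_K5_iff:
  "simple_graph B \<Longrightarrow> is_triangle_deleted K5 B \<longleftrightarrow> copy 5 K5t_es B"
proof (rule is_triangle_deleted_iff_copy[where es = K5_es])
  show "{{0, 1}, {1, 2}, {0, 2}} \<subseteq> edges K5" by (simp add: complete_graph_edge_iff)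
next
  fix a b c assume "{{a, b}, {b, c}, {a, c}} \<subseteq> edges K5"
  then have abc: "distinct [a, b, c]" "set [a, b, c] \<subseteq> {..<5}"
    by (auto simp: complete_graph_edge_iff)
  from extend_to_enumeration[OF this] obtain xs where
    xs: "distinct ([a, b, c] @ xs)" "set ([a, b, c] @ xs) = {..<5}" "length ([a, b, c] @ xs) = 5" .
  show "\<exists>xs. distinct xs \<and> length xs = 5 \<and> K5 = lgraph K5_es xs \<and>
      a = xs ! 0 \<and> b = xs ! 1 \<and> c = xs ! 2"
    by (intro exI[of _ "[a, b, c] @ xs"] conjI xs K5_eq_lgraph[OF xs(1,2)]) simp_all
qed (simp_all, simp_all add: es_defs)

lemma third_residue:
  assumes "a mod 3 \<noteq> b mod (3::nat)"
  obtains c where "c < 6" "a mod 3 \<noteq> c mod 3" "b mod 3 \<noteq> c mod 3"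
proof -
  have "\<exists>c\<in>{0, 1, 2}. a mod 3 \<noteq> c mod 3 \<and> b mod 3 \<noteq> c mod (3::nat)"
    using assms by (simp; presburger)
  then obtain c where "c \<in> {0, 1, 2}" "a mod 3 \<noteq> c mod 3" "b mod 3 \<noteq> c mod 3" by blast
  then show ?thesis using that[of c] by auto
qed

lemma is_minus_K222_iff: "simple_graph B \<Longrightarrow> is_minus K222 B \<longleftrightarrow> copy 6 K222m_es B"
proof (rule is_minus_iff_copy[where es = K222_es])
  show "edges K222 \<noteq> {}" using K222_edge_iff[of 0 1] by auto
next
  fix e assume "e \<in> edges K222"
  then obtain i j where e: "e = {i, j}" "i < 6" "j < 6" "i mod 3 \<noteq> j mod 3"
    by (auto simp: K222_def)
  then obtain k where "k < 6" "i mod 3 \<noteq> k mod 3" "j mod 3 \<noteq> k mod 3"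
    using third_residue by metis
  note Q = K222_eq_lgraph[OF e(2,3) this(1) e(4) this(3,2)]
  show "\<exists>xs. distinct xs \<and> length xs = 6 \<and> K222 = lgraph K222_es xs \<and> e = {xs ! 0, xs ! 1}"
    by (rule exI, intro conjI, rule Q(1), simp, rule Q(2), simp add: e(1))
qed (simp_all, simp_all add: es_defs)

lemma is_triangle_deleted_K222_iff:
  "simple_graph B \<Longrightarrow> is_triangle_deleted K222 B \<longleftrightarrow> copy 6 K222t_es B"
proof (rule is_triangle_deleted_iff_copy[where es = K222_es])
  show "{{0, 1}, {1, 2}, {0, 2}} \<subseteq> edges K222" by (simp add: K222_edge_iff)
next
  fix a b c assume "{{a, b}, {b, c}, {a, c}} \<subseteq> edges K222"
  then have "a < 6" "b < 6" "c < 6" "a mod 3 \<noteq> b mod 3" "b mod 3 \<noteq> c mod 3" "a mod 3 \<noteq> c mod 3"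
    by (auto simp: K222_edge_iff)
  note Q = K222_eq_lgraph[OF this]
  show "\<exists>xs. distinct xs \<and> length xs = 6 \<and> K222 = lgraph K222_es xs \<and>
      a = xs ! 0 \<and> b = xs ! 1 \<and> c = xs ! 2"
    by (rule exI, intro conjI, rule Q(1), simp, rule Q(2), simp_all)
qed (simp_all, simp_all add: es_defs)

lemma split_vertex_K5:
  assumes "distinct [p, q, r, s, w]" "set [p, q, r, s, w] = {..<5}"
  shows "split_vertex K5 w {p, q} {r, s} y z = lgraph K5b_es [y, z, p, q, r, s]"
proof -
  have Q: "K5 = lgraph K5_es [p, q, r, s, w]" using assms by (rule K5_eq_lgraph)
  have N: "{{y, u} |u. u \<in> {p, q}} = {{y, p}, {y, q}}" "{{z, u} |u. u \<in> {r, s}} = {{z, r}, {z, s}}"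
    by auto
  have ne: "w \<noteq> p" "w \<noteq> q" "w \<noteq> r" "w \<noteq> s" using assms(1) by auto
  have "{d \<in> edges K5. w \<notin> d} = edges K5 \<inter> {d. w \<notin> d}" by auto
  also have "\<dots> = {{p, q}, {p, r}, {p, s}, {q, r}, {q, s}, {r, s}}"
    using ne by (simp add: Q lgraph_def K5_es_def Int_insert_left)
  finally have "edges (split_vertex K5 w {p, q} {r, s} y z) = edges (lgraph K5b_es [y, z, p, q, r, s])"
    unfolding split_vertex_def N
    by (simp add: lgraph_def K5b_es_def)
      (intro subset_antisym; simp only: insert_subset insert_iff empty_subsetI simp_thms)
  moreover have "verts (split_vertex K5 w {p, q} {r, s} y z) = set [y, z, p, q, r, s]"
    using assms(1) by (auto simp: split_vertex_def Q)
  ultimately show ?thesis by (simp add: lgraph_def)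
qed

lemma split_vertex_K222:
  assumes "distinct [p, q, w, p', q', w']"
    and Q: "K222 = lgraph K222_es [p, q, w, p', q', w']"
  shows "split_vertex K222 w {p, q} {p', q'} y z = lgraph K222b_es [y, z, p, q, p', q', w']"
proof -
  have N: "{{y, u} |u. u \<in> {p, q}} = {{y, p}, {y, q}}" "{{z, u} |u. u \<in> {p', q'}} = {{z, p'}, {z, q'}}"
    by auto
  have ne: "w \<noteq> p" "w \<noteq> q" "w \<noteq> p'" "w \<noteq> q'" "w \<noteq> w'" using assms(1) by auto
  have "{d \<in> edges K222. w \<notin> d} = edges K222 \<inter> {d. w \<notin> d}" by auto
  also have "\<dots> = {{p, q}, {p, q'}, {p, w'}, {q, p'}, {q, w'}, {p', q'}, {p', w'}, {q', w'}}"
    using ne by (simp add: Q lgraph_def K222_es_def Int_insert_left)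
  finally have "edges (split_vertex K222 w {p, q} {p', q'} y z) = edges (lgraph K222b_es [y, z, p, q, p', q', w'])"
    unfolding split_vertex_def N
    by (simp add: lgraph_def K222b_es_def)
      (intro subset_antisym; simp only: insert_subset insert_iff empty_subsetI simp_thms)
  moreover have "verts (split_vertex K222 w {p, q} {p', q'} y z) = set [y, z, p, q, p', q', w']"
    using assms(1) by (auto simp: split_vertex_def Q)
  ultimately show ?thesis by (simp add: lgraph_def)
qed

text \<open>All choices of \<open>w\<close>, of the two edges and of the new vertices lead to one
  shape; the sample choice in \<open>ne\<close> shows that the shape does arise.\<close>

lemma is_bowtie_iff_copy:
  assumes "simple_graph B" "wf_shape n es'"
    and Q: "\<And>w e f y z. w \<in> verts Q \<Longrightarrow> e \<in> edges Q \<Longrightarrow> f \<in> edges Q \<Longrightarrow> e \<inter> f = {} \<Longrightarrow>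
        e \<union> f \<subseteq> nbrs Q w \<Longrightarrow> y \<notin> verts Q \<Longrightarrow> z \<notin> verts Q \<Longrightarrow> y \<noteq> z \<Longrightarrow>
        \<exists>xs. distinct xs \<and> length xs = n \<and> split_vertex Q w e f y z = lgraph es' xs"
    and ne: "w \<in> verts Q" "e \<in> edges Q" "f \<in> edges Q" "e \<inter> f = {}" "e \<union> f \<subseteq> nbrs Q w"
      "y \<notin> verts Q" "z \<notin> verts Q" "y \<noteq> z"
  shows "is_bowtie Q B \<longleftrightarrow> copy n es' B"
proof -
  have *: "B \<simeq>\<^sub>g split_vertex Q w e f y z \<longleftrightarrow> copy n es' B"
    if "w \<in> verts Q" "e \<in> edges Q" "f \<in> edges Q" "e \<inter> f = {}" "e \<union> f \<subseteq> nbrs Q w"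
      "y \<notin> verts Q" "z \<notin> verts Q" "y \<noteq> z" for w e f y z
    using Q[OF that] iso_lgraph_iff_copy[OF assms(1,2)] by metis
  show ?thesis
  proof
    assume "copy n es' B"
    then have "B \<simeq>\<^sub>g split_vertex Q w e f y z" using *[OF ne] by simp
    then show "is_bowtie Q B" unfolding is_bowtie_def using ne by blast
  next
    assume "is_bowtie Q B"
    then obtain w e f y z where ne': "w \<in> verts Q" "e \<in> edges Q" "f \<in> edges Q" "e \<inter> f = {}"
        "e \<union> f \<subseteq> nbrs Q w" "y \<notin> verts Q" "z \<notin> verts Q" "y \<noteq> z"
      and iso: "B \<simeq>\<^sub>g split_vertex Q w e f y z"
      unfolding is_bowtie_def by blast
    from iso show "copy n es' B" using *[OF ne'] by simp
  qed
qed

lemma is_bowtie_K5_iff: "simple_graph B \<Longrightarrow> is_bowtie K5 B \<longleftrightarrow> copy 6 K5b_es B"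
proof (rule is_bowtie_iff_copy[where w = 4 and e = "{0, 1}" and f = "{2, 3}" and y = 5 and z = 6])
  fix w e f y z
  assume *: "w \<in> verts K5" "e \<in> edges K5" "f \<in> edges K5" "e \<inter> f = {}" "e \<union> f \<subseteq> nbrs K5 w"
    "y \<notin> verts K5" "z \<notin> verts K5" "y \<noteq> z"
  then obtain p q r s where e: "e = {p, q}" "p \<noteq> q" "p < 5" "q < 5" and f: "f = {r, s}" "r \<noteq> s" "r < 5" "s < 5"
    unfolding complete_graph_def by auto
  have d: "distinct [p, q, r, s, w]"
    using * e f by (auto simp: complete_graph_edge_iff)
  have yz: "5 \<le> y" "5 \<le> z" using * by (auto simp: complete_graph_def)
  \<comment> \<open>Two disjoint edges that avoid \<open>w\<close> use up the four other
    vertices.\<close>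
  have "set [p, q, r, s, w] = {..<5}"
  proof (rule card_subset_eq)
    show "set [p, q, r, s, w] \<subseteq> {..<5}" using * e f by (auto simp: complete_graph_def)
    show "card (set [p, q, r, s, w]) = card {..<5::nat}" using distinct_card[OF d] by simp
  qed simp
  with d have "split_vertex K5 w e f y z = lgraph K5b_es [y, z, p, q, r, s]"
    unfolding e(1) f(1) by (rule split_vertex_K5)
  moreover have "distinct [y, z, p, q, r, s]" using d yz e f * by auto
  ultimately show "\<exists>xs. distinct xs \<and> length xs = 6 \<and> split_vertex K5 w e f y z = lgraph K5b_es xs"
    by (intro exI[of _ "[y, z, p, q, r, s]"]) simp
qed (auto simp: complete_graph_edge_iff, auto simp: complete_graph_def)

lemma is_bowtie_K222_iff: "simple_graph B \<Longrightarrow> is_bowtie K222 B \<longleftrightarrow> copy 7 K222b_es B"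
proof (rule is_bowtie_iff_copy[where w = 2 and e = "{0, 1}" and f = "{3, 4}" and y = 6 and z = 7])
  fix w e f y z
  assume *: "w \<in> verts K222" "e \<in> edges K222" "f \<in> edges K222" "e \<inter> f = {}" "e \<union> f \<subseteq> nbrs K222 w"
    "y \<notin> verts K222" "z \<notin> verts K222" "y \<noteq> z"
  then obtain p q where e: "e = {p, q}" "p < 6" "q < 6" "p mod 3 \<noteq> q mod 3"
    by (auto simp: K222_def)
  have w: "w < 6" "q mod 3 \<noteq> w mod 3" "p mod 3 \<noteq> w mod 3" "6 \<le> y" "6 \<le> z"
    using * e by (auto simp: K222_edge_iff) (auto simp: K222_def)
  define p' q' w' where anti: "p' = (p + 3) mod 6" "q' = (q + 3) mod 6" "w' = (w + 3) mod 6"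
  have d: "distinct [p, q, w, p', q', w']" and Q: "K222 = lgraph K222_es [p, q, w, p', q', w']"
    using K222_eq_lgraph[OF e(2,3) w(1) e(4) w(2,3)] unfolding anti by auto
  have V: "verts K222 = {p, q, w, p', q', w'}" by (subst Q) simp
  \<comment> \<open>The neighbourhood of \<open>w\<close> misses only \<open>w\<close> and its
    antipode \<open>w'\<close>. As \<open>f\<close> lies in it and avoids \<open>p\<close> and
    \<open>q\<close>, only the antipodal edge is left for \<open>f\<close>.\<close>
  have "f \<subseteq> {p', q'}"
  proof
    fix u assume u: "u \<in> f"
    have "{w, w'} \<notin> edges K222" by (simp add: K222_edge_iff anti mod_mod_cancel)
    moreover have "u \<in> verts K222" "u \<noteq> p" "u \<noteq> q" "{w, u} \<in> edges K222"
      using u * e simple_edge[OF simple_K222, of w u] by auto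
    ultimately show "u \<in> {p', q'}"
      using V simple_edge[OF simple_K222, of w u] by auto
  qed
  moreover have "card f = 2" using * simple_K222 by (simp add: simple_graph_def)
  moreover have "card {p', q'} = 2" using d by auto
  ultimately have f: "f = {p', q'}" by (simp add: card_subset_eq)
  have "split_vertex K222 w e f y z = lgraph K222b_es [y, z, p, q, p', q', w']"
    unfolding e(1) f by (rule split_vertex_K222[OF d Q])
  moreover have "distinct [y, z, p, q, p', q', w']" using d w V * by auto
  ultimately show "\<exists>xs. distinct xs \<and> length xs = 7 \<and> split_vertex K222 w e f y z = lgraph K222b_es xs"
    by (intro exI[of _ "[y, z, p, q, p', q', w']"]) simp
qed (auto simp: K222_edge_iff, auto simp: K222_def)

text \<open>The third entry is the number of vertices of attachment. The triangle is kept apart: all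
  its vertices are vertices of attachment, so it has no interior.\<close>

definition shapes :: "(nat \<times> (nat \<times> nat) list \<times> nat) list" where
  "shapes = [(5, K5_es, 1), (6, K222_es, 1), (5, K5m_es, 2), (6, K222m_es, 2), (5, K5t_es, 3),
     (6, K222t_es, 3), (6, K5b_es, 2), (7, K222b_es, 2)]"

lemma wf_shape_shapes: "(n, es, k) \<in> set shapes \<Longrightarrow> wf_shape n es"
  by (auto simp: shapes_def)

lemma simple_copy: "copy n es B \<Longrightarrow> wf_shape n es \<Longrightarrow> simple_graph B"
  by (auto simp: copy_def simple_lgraph)

lemma brick_iff_copy:
  "brick B \<longleftrightarrow> copy 3 K3_es B \<or> (\<exists>(n, es, k)\<in>set shapes. copy n es B)"
proof (cases "simple_graph B")
  case True
  then show ?thesis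
    unfolding brick_def
    by (simp add: iso_K3_iff iso_K5_iff iso_K222_iff is_minus_K5_iff is_minus_K222_iff
        is_triangle_deleted_K5_iff is_triangle_deleted_K222_iff is_bowtie_K5_iff is_bowtie_K222_iff
        shapes_def) blast
next
  case False
  then show ?thesis
    using simple_copy[of 3 K3_es B] simple_copy[of _ _ B] wf_shape_shapes
    unfolding brick_def by fastforce
qed

lemma copy_same_size:
  "copy n es B \<Longrightarrow> copy n' es' B \<Longrightarrow> wf_shape n es \<Longrightarrow> wf_shape n' es' \<Longrightarrow>
    n = n' \<and> length es = length es'"
  by (metis card_copy)

text \<open>No two of the nine shapes agree in both the number of vertices and the number of
  edges.\<close>

lemma copy_shape_unique:
  assumes "copy n es B" "copy n' es' B"
    "(n, es, k) \<in> insert (3, K3_es, 3) (set shapes)" "(n', es', k') \<in> insert (3, K3_es, 3) (set shapes)"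
  shows "n = n' \<and> es = es' \<and> k = k'"
proof -
  have "n = n' \<and> length es = length es'"
    using assms copy_same_size wf_shape_shapes wf_shapes(1) by (metis insertE prod.inject)
  moreover have "\<forall>(n, es, k)\<in>set ((3, K3_es, 3) # shapes). \<forall>(n', es', k')\<in>set ((3, K3_es, 3) # shapes).
      n = n' \<and> length es = length es' \<longrightarrow> es = es' \<and> k = k'"
    by code_simp
  ultimately show ?thesis using assms(3,4) by fastforce
qed

section \<open>Degrees and vertices of attachment inside a brick\<close>

lemma set_take_nth: "k \<le> length ys \<Longrightarrow> set (take k ys) = (!) ys ` {..<k}"
  by (simp add: nth_image[symmetric] lessThan_atLeast0)

text \<open>The executable counterpart of \<open>brick_ok\<close>; \<open>A\<close> lists the
  positions of the vertices of attachment. The last clause, a position within distance two of all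
  others, stands for connectedness.\<close>

definition shape_ok :: "nat \<Rightarrow> (nat \<times> nat) list \<Rightarrow> nat list \<Rightarrow> bool" where
  "shape_ok n es A \<longleftrightarrow>
     (\<forall>i\<in>set [0..<n]. 2 \<le> length (lnbrs n es i) \<and> (i \<in> set A \<or> length (lnbrs n es i) = 4)) \<and>
     (\<forall>(i, j)\<in>set es. (i \<notin> set A \<or> j \<notin> set A) \<and>
       ((\<exists>k\<in>set [0..<n]. k \<notin> set A \<and> ladj es i k \<and> ladj es j k) \<or>
        i \<notin> set A \<and> j \<notin> set A \<and>
        (\<forall>k\<in>set [0..<n]. (k = i \<or> ladj es i k) = (k = j \<or> ladj es j k)))) \<and>
     (\<exists>h\<in>set [0..<n]. \<forall>i\<in>set [0..<n]. i = h \<or> ladj es h i \<or>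
        (\<exists>k\<in>set [0..<n]. ladj es h k \<and> ladj es k i))"

text \<open>What a brick other than a triangle contributes to the criticality of the whole graph.
  Vertices outside \<open>A\<close> keep their neighbourhood there and count as vertices of degree
  four; the final degree of a vertex in \<open>A\<close> is left open.\<close>

definition brick_ok :: "'a ugraph \<Rightarrow> 'a set \<Rightarrow> bool" where
  "brick_ok B A \<longleftrightarrow> A \<subseteq> verts B \<and> connected_graph B \<and>
     (\<forall>v\<in>verts B. 2 \<le> card (nbrs B v) \<and> (v \<in> A \<or> card (nbrs B v) = 4)) \<and>
     (\<forall>x y. {x, y} \<in> edges B \<longrightarrow> (x \<notin> A \<or> y \<notin> A) \<and>
       ((\<exists>w\<in>nbrs B x \<inter> nbrs B y. w \<notin> A) \<or>
        x \<notin> A \<and> y \<notin> A \<and> insert x (nbrs B x) = insert y (nbrs B y)))"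

lemma ladj_commute: "ladj es i j \<longleftrightarrow> ladj es j i"
  by (auto simp: ladj_def)

lemma brick_ok_lgraph:
  assumes ok: "shape_ok n es A" and wf: "wf_shape n es" and ys: "distinct ys" "length ys = n"
    and A: "set A \<subseteq> {..<n}"
  shows "brick_ok (lgraph es ys) ((!) ys ` set A)"
proof -
  let ?B = "lgraph es ys" and ?A = "(!) ys ` set A"
  have idx: "\<exists>i<n. v = ys ! i" if "v \<in> verts ?B" for v
    using that ys by (metis in_set_conv_nth verts_lgraph)
  have inA: "ys ! i \<in> ?A \<longleftrightarrow> i \<in> set A" if "i < n" for i
    using that A ys by (auto simp: nth_eq_iff_index_eq subset_iff)
  note E = lgraph_edge_iff[OF wf ys]
  note simple = simple_lgraph[OF wf ys]
  have deg: "card (nbrs ?B (ys ! i)) = length (lnbrs n es i)" if "i < n" for i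
    using degree_lgraph[OF wf ys that] degree_eq_card_nbrs[OF simple] by metis
  have ok1: "\<And>i. i < n \<Longrightarrow> 2 \<le> length (lnbrs n es i) \<and> (i \<in> set A \<or> length (lnbrs n es i) = 4)"
    using ok by (simp add: shape_ok_def)
  \<comment> \<open>\<open>es\<close> lists each edge in one direction only, while the condition is
    symmetric in \<open>i\<close> and \<open>j\<close>.\<close>
  have ok2: "(i \<notin> set A \<or> j \<notin> set A) \<and>
      ((\<exists>k<n. k \<notin> set A \<and> ladj es i k \<and> ladj es j k) \<or>
       i \<notin> set A \<and> j \<notin> set A \<and> (\<forall>k<n. (k = i \<or> ladj es i k) = (k = j \<or> ladj es j k)))"
    if "ladj es i j" for i j
  proof -
    have *: "(i \<notin> set A \<or> j \<notin> set A) \<and>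
      ((\<exists>k<n. k \<notin> set A \<and> ladj es i k \<and> ladj es j k) \<or>
       i \<notin> set A \<and> j \<notin> set A \<and> (\<forall>k<n. (k = i \<or> ladj es i k) = (k = j \<or> ladj es j k)))"
      if "(i, j) \<in> set es" for i j
      using bspec[OF conjunct1[OF conjunct2[OF ok[unfolded shape_ok_def]]] that]
      by (simp add: Bex_def Ball_def)
    from that consider "(i, j) \<in> set es" | "(j, i) \<in> set es" by (auto simp: ladj_def)
    then show ?thesis
    proof cases
      case 2
      from *[OF this] show ?thesis by metis
    qed (rule *)
  qed
  have "\<exists>h<n. \<forall>i<n. i = h \<or> ladj es h i \<or> (\<exists>k<n. ladj es h k \<and> ladj es k i)"
    using ok by (simp add: shape_ok_def Bex_def Ball_def)
  then obtain h where h: "h < n" "\<And>i. i < n \<Longrightarrow> i = h \<or> ladj es h i \<or> (\<exists>k<n. ladj es h k \<and> ladj es k i)"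
    by blast
  have "(ys ! h, v) \<in> (adj ?B)\<^sup>*" if "v \<in> verts ?B" for v
  proof -
    have a: "(ys ! i, ys ! j) \<in> adj ?B" if "i < n" "j < n" "ladj es i j" for i j
      using E that by (simp add: adj_def)
    from idx[OF that] obtain i where i: "i < n" "v = ys ! i" by blast
    from h(2)[OF i(1)] consider "i = h" | "ladj es h i" | k where "k < n" "ladj es h k" "ladj es k i"
      by blast
    then show ?thesis
    proof cases
      case (3 k)
      then have "(ys ! h, ys ! k) \<in> adj ?B" "(ys ! k, v) \<in> adj ?B" using a h(1) i by auto
      then show ?thesis by (meson converse_rtrancl_into_rtrancl r_into_rtrancl)
    qed (use a h(1) i in auto)
  qed
  then have conn: "connected_graph ?B"
    unfolding connected_graph_def using rtrancl_adj_sym[of "ys ! h" _ ?B] h(1) ys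
    by (metis rtrancl_trans verts_lgraph empty_iff nth_mem)
  have "(x \<notin> ?A \<or> y \<notin> ?A) \<and> ((\<exists>w\<in>nbrs ?B x \<inter> nbrs ?B y. w \<notin> ?A) \<or>
      x \<notin> ?A \<and> y \<notin> ?A \<and> insert x (nbrs ?B x) = insert y (nbrs ?B y))"
    if "{x, y} \<in> edges ?B" for x y
  proof -
    note V = simple_edge[OF simple that]
    obtain i j where ij: "i < n" "j < n" "x = ys ! i" "y = ys ! j"
      using idx[OF V(1)] idx[OF V(2)] by blast
    with that E have l: "ladj es i j" by simp
    from ok2[OF l] have "i \<notin> set A \<or> j \<notin> set A" by blast
    moreover have "(\<exists>w\<in>nbrs ?B x \<inter> nbrs ?B y. w \<notin> ?A) \<or>
      x \<notin> ?A \<and> y \<notin> ?A \<and> insert x (nbrs ?B x) = insert y (nbrs ?B y)"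
    proof (cases "\<exists>k<n. k \<notin> set A \<and> ladj es i k \<and> ladj es j k")
      case True
      then obtain k where "k < n" "k \<notin> set A" "ladj es i k" "ladj es j k" by blast
      then have "ys ! k \<in> nbrs ?B x \<inter> nbrs ?B y" "ys ! k \<notin> ?A" using E ij inA by auto
      then show ?thesis by blast
    next
      case False
      with ok2[OF l] have ni: "i \<notin> set A" "j \<notin> set A"
        and eq: "\<forall>k<n. (k = i \<or> ladj es i k) = (k = j \<or> ladj es j k)" by blast+
      have "u \<in> insert x (nbrs ?B x) \<longleftrightarrow> u \<in> insert y (nbrs ?B y)" for u
      proof (cases "u \<in> verts ?B")
        case True
        then obtain k where k: "k < n" "u = ys ! k" using idx by blast
        then have "u = x \<longleftrightarrow> k = i" "u = y \<longleftrightarrow> k = j"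
          using ij ys by (simp_all add: nth_eq_iff_index_eq)
        moreover have "{x, u} \<in> edges ?B \<longleftrightarrow> ladj es i k" "{y, u} \<in> edges ?B \<longleftrightarrow> ladj es j k"
          using E k ij by simp_all
        ultimately show ?thesis using eq k(1) by simp
      next
        case False
        then have "u \<noteq> x" "u \<noteq> y" "{x, u} \<notin> edges ?B" "{y, u} \<notin> edges ?B"
          using V simple_edge(2)[OF simple] by blast+
        then show ?thesis by simp
      qed
      then have "insert x (nbrs ?B x) = insert y (nbrs ?B y)" by (rule set_eqI)
      then show ?thesis using ni ij inA by simp
    qed
    ultimately show ?thesis using ij inA by simp
  qed
  moreover have "2 \<le> card (nbrs ?B v) \<and> (v \<in> ?A \<or> card (nbrs ?B v) = 4)" if "v \<in> verts ?B" for v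
  proof -
    from idx[OF that] obtain i where "i < n" "v = ys ! i" by blast
    then show ?thesis using deg[of i] ok1[of i] inA[of i] by simp
  qed
  moreover have "?A \<subseteq> verts ?B" using A ys by auto
  ultimately show ?thesis unfolding brick_ok_def using conn by blast
qed

lemma shapes_ok: "(n, es, k) \<in> set shapes \<Longrightarrow> shape_ok n es [0..<k]"
proof -
  have "\<forall>(n, es, k)\<in>set shapes. shape_ok n es [0..<k]" by code_simp
  then show "(n, es, k) \<in> set shapes \<Longrightarrow> shape_ok n es [0..<k]" by blast
qed

text \<open>In \<open>K5\<close> and the octahedron any vertex may be the vertex of attachment, so
  the check runs over all positions.\<close>

lemma shapes_ok_rotated: "(n, es, 1) \<in> set shapes \<Longrightarrow> i < n \<Longrightarrow> shape_ok n es [i]"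
proof -
  have "\<forall>(n, es, k)\<in>set shapes. k = 1 \<longrightarrow> (\<forall>i\<in>set [0..<n]. shape_ok n es [i])" by code_simp
  then show "(n, es, 1) \<in> set shapes \<Longrightarrow> i < n \<Longrightarrow> shape_ok n es [i]" by fastforce
qed

text \<open>Vertices of attachment have degree two precisely in the triangle-deleted and the bowtie
  shapes. Together with the triangle, these are the bricks that (TB) admits next to a
  triangle.\<close>

lemma shapes_degrees:
  assumes "(n, es, k) \<in> set shapes"
  shows "0 < k" "k < n" "k \<le> 3"
    "\<And>i. k \<le> i \<Longrightarrow> i < n \<Longrightarrow> length (lnbrs n es i) = 4"
    "\<And>i. k \<noteq> 1 \<Longrightarrow> i < k \<Longrightarrow> length (lnbrs n es i) < 4"
    "es \<in> {K5t_es, K222t_es, K5b_es, K222b_es} \<longleftrightarrow> length (lnbrs n es 0) = 2"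
    "\<And>i. length (lnbrs n es 0) = 2 \<Longrightarrow> i < k \<Longrightarrow> length (lnbrs n es i) = 2"
    "\<And>i. length (lnbrs n es 0) \<noteq> 2 \<Longrightarrow> i < k \<Longrightarrow> length (lnbrs n es i) \<noteq> 2"
proof -
  have "\<forall>(n, es, k)\<in>set shapes. 0 < k \<and> k < n \<and> k \<le> 3 \<and>
    (\<forall>i\<in>set [k..<n]. length (lnbrs n es i) = 4) \<and>
    (k \<noteq> 1 \<longrightarrow> (\<forall>i\<in>set [0..<k]. length (lnbrs n es i) < 4)) \<and>
    (es \<in> {K5t_es, K222t_es, K5b_es, K222b_es} \<longleftrightarrow> length (lnbrs n es 0) = 2) \<and>
    (\<forall>i\<in>set [0..<k]. length (lnbrs n es 0) = 2 \<longleftrightarrow> length (lnbrs n es i) = 2)" by code_simp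
  from bspec[OF this assms] show "0 < k" "k < n" "k \<le> 3"
    "\<And>i. k \<le> i \<Longrightarrow> i < n \<Longrightarrow> length (lnbrs n es i) = 4"
    "\<And>i. k \<noteq> 1 \<Longrightarrow> i < k \<Longrightarrow> length (lnbrs n es i) < 4"
    "es \<in> {K5t_es, K222t_es, K5b_es, K222b_es} \<longleftrightarrow> length (lnbrs n es 0) = 2"
    "\<And>i. length (lnbrs n es 0) = 2 \<Longrightarrow> i < k \<Longrightarrow> length (lnbrs n es i) = 2"
    "\<And>i. length (lnbrs n es 0) \<noteq> 2 \<Longrightarrow> i < k \<Longrightarrow> length (lnbrs n es i) \<noteq> 2"
    by auto
qed

lemma shapes_k_1:
  "(n, es, k) \<in> set shapes \<Longrightarrow> k = 1 \<longleftrightarrow> (n, es) = (5, K5_es) \<or> (n, es) = (6, K222_es)"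
proof -
  have "\<forall>(n, es, k)\<in>set shapes. k = 1 \<longleftrightarrow> (n, es) = (5, K5_es) \<or> (n, es) = (6, K222_es)" by code_simp
  then show "(n, es, k) \<in> set shapes \<Longrightarrow> ?thesis" by blast
qed

lemma iso_K5_or_K222_iff:
  assumes "(n, es, k) \<in> set shapes" "copy n es B"
  shows "B \<simeq>\<^sub>g K5 \<or> B \<simeq>\<^sub>g K222 \<longleftrightarrow> k = 1"
proof -
  have s: "simple_graph B" using assms simple_copy wf_shape_shapes by blast
  have m: "(5, K5_es, 1) \<in> set shapes" "(6, K222_es, 1) \<in> set shapes" by (simp_all add: shapes_def)
  have "copy 5 K5_es B \<Longrightarrow> k = 1" "copy 6 K222_es B \<Longrightarrow> k = 1"
    using copy_shape_unique[OF assms(2) _ insertI2[OF assms(1)] insertI2[OF m(1)]]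
      copy_shape_unique[OF assms(2) _ insertI2[OF assms(1)] insertI2[OF m(2)]] by blast+
  moreover have "k = 1 \<Longrightarrow> copy 5 K5_es B \<or> copy 6 K222_es B"
    using assms shapes_k_1[OF assms(1)] by auto
  ultimately show ?thesis by (auto simp: iso_K5_iff[OF s] iso_K222_iff[OF s])
qed

lemma low_degree_lgraph:
  assumes "wf_shape n es" "distinct ys" "length ys = n"
  shows "{x \<in> set ys. degree (lgraph es ys) x < 4} = (!) ys ` {i. i < n \<and> length (lnbrs n es i) < 4}"
  using degree_lgraph[OF assms] assms(3) by (auto simp: in_set_conv_nth)

text \<open>Unless the vertex of attachment can be chosen freely, degree below four singles out the
  first \<open>k\<close> positions.\<close>

lemma attachment_iff:
  assumes "(n, es, k) \<in> set shapes" "distinct ys" "length ys = n"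
  shows "attachment (lgraph es ys) A \<longleftrightarrow>
    (if k = 1 then \<exists>x\<in>set ys. A = {x} else A = set (take k ys))"
proof -
  note wf = wf_shape_shapes[OF assms(1)] and d = shapes_degrees[OF assms(1)]
  have "copy n es (lgraph es ys)" using assms by (auto simp: copy_def)
  note iso = iso_K5_or_K222_iff[OF assms(1) this]
  have "{i. i < n \<and> length (lnbrs n es i) < 4} = {..<k}" if "k \<noteq> 1"
    using d(2) d(4) d(5)[OF that] by (force simp: not_less[symmetric])
  then show ?thesis
    unfolding attachment_def using iso low_degree_lgraph[OF wf assms(2,3)] assms(3) d(2)
    by (simp add: set_take_nth)
qed

lemma triangular_iff_copy: "brick B \<Longrightarrow> triangular B \<longleftrightarrow> copy 3 K3_es B"
  by (simp add: triangular_def brick_def iso_K3_iff)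

lemma non_triangular_brickE:
  assumes "brick B" "\<not> triangular B"
  obtains n es k ys where "(n, es, k) \<in> set shapes" "distinct ys" "length ys = n" "B = lgraph es ys"
proof -
  from assms triangular_iff_copy[OF assms(1)] obtain n es k
    where "(n, es, k) \<in> set shapes" "copy n es B"
    by (auto simp: brick_iff_copy)
  then show ?thesis using that unfolding copy_def by blast
qed

lemma shapes_not_triangular:
  assumes "(n, es, k) \<in> set shapes" "distinct ys" "length ys = n"
  shows "brick (lgraph es ys)" "\<not> triangular (lgraph es ys)"
proof -
  have c: "copy n es (lgraph es ys)" using assms by (auto simp: copy_def)
  then show b: "brick (lgraph es ys)" using assms(1) by (auto simp: brick_iff_copy)
  have "n \<noteq> 3" using assms(1) by (auto simp: shapes_def)
  then show "\<not> triangular (lgraph es ys)"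
    using copy_same_size[OF c, of 3 K3_es] wf_shape_shapes[OF assms(1)]
    by (auto simp: triangular_iff_copy[OF b])
qed

lemma non_triangular_brick_ok:
  assumes "brick B" "\<not> triangular B" "attachment B A"
  shows "brick_ok B A"
proof -
  obtain n es k ys where s: "(n, es, k) \<in> set shapes" "distinct ys" "length ys = n" "B = lgraph es ys"
    using non_triangular_brickE[OF assms(1,2)] .
  note wf = wf_shape_shapes[OF s(1)]
  show ?thesis
  proof (cases "k = 1")
    case True
    then obtain i where i: "i < n" "A = {ys ! i}"
      using attachment_iff[OF s(1-3), of A] assms(3) s(3,4) by (auto simp: in_set_conv_nth)
    have "shape_ok n es [i]" using shapes_ok_rotated s(1) i(1) True by blast
    from brick_ok_lgraph[OF this wf s(2,3)] i show ?thesis by (simp add: s(4))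
  next
    case False
    then have "A = (!) ys ` set [0..<k]"
      using attachment_iff[OF s(1-3), of A] assms(3) s(3,4) shapes_degrees(2)[OF s(1)]
      by (simp add: set_take_nth lessThan_atLeast0)
    moreover have "set [0..<k] \<subseteq> {..<n}" using shapes_degrees(2)[OF s(1)] by auto
    ultimately show ?thesis
      using brick_ok_lgraph[OF shapes_ok[OF s(1)] wf s(2,3)] by (simp add: s(4))
  qed
qed

lemma triangular_brick:
  assumes "brick B" "triangular B"
  obtains x y z where "distinct [x, y, z]" "B = lgraph K3_es [x, y, z]"
proof -
  from assms obtain ys where ys: "distinct ys" "length ys = 3" "B = lgraph K3_es ys"
    by (auto simp: triangular_iff_copy copy_def)
  then obtain x y z where "ys = [x, y, z]"
    by (auto simp: length_Suc_conv numeral_3_eq_3)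
  with ys that show ?thesis by blast
qed

lemma lgraph_K3: "lgraph K3_es [x, y, z] = \<lparr>verts = {x, y, z}, edges = {{x, y}, {x, z}, {y, z}}\<rparr>"
  by (simp add: lgraph_def K3_es_def)

lemma copy_K3I: "distinct [x, y, z] \<Longrightarrow> copy 3 K3_es (lgraph K3_es [x, y, z])"
  unfolding copy_def by (intro exI[of _ "[x, y, z]"]) simp

lemma attachment_K3_iff:
  assumes "distinct [x, y, z]"
  shows "attachment (lgraph K3_es [x, y, z]) A \<longleftrightarrow> A = {x, y, z}"
proof -
  let ?B = "lgraph K3_es [x, y, z]"
  have s: "simple_graph ?B" using assms by (intro simple_lgraph[of 3]) auto
  have "\<not> copy 5 K5_es ?B" "\<not> copy 6 K222_es ?B"
    using copy_same_size[OF copy_K3I[OF assms], of 5 K5_es]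
      copy_same_size[OF copy_K3I[OF assms], of 6 K222_es] by auto
  then have "\<not> (?B \<simeq>\<^sub>g K5 \<or> ?B \<simeq>\<^sub>g K222)" by (simp add: iso_K5_iff[OF s] iso_K222_iff[OF s])
  moreover have "degree ?B v < 4" for v
  proof -
    have "degree ?B v \<le> card (edges ?B)"
      unfolding degree_def by (rule card_mono) (auto simp: lgraph_K3)
    also have "\<dots> = 3" using card_copy(2)[OF copy_K3I[OF assms] wf_shapes(1)] by (simp add: K3_es_def)
    finally show ?thesis by simp
  qed
  ultimately have "attachment ?B A \<longleftrightarrow> A = {v. v \<in> verts ?B}"
    by (simp add: attachment_def del: verts_lgraph)
  then show ?thesis by (simp only: Collect_mem_eq verts_lgraph list.set)
qed

text \<open>The four excluded bricks are those whose vertices of attachment have degree three or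
  four. Hence (TB) gives each vertex of a triangular brick exactly \<open>2 + 2\<close>
  neighbours.\<close>

lemma attachment_degree_2:
  assumes "brick B" "attachment B A" "x \<in> A"
    and "\<not> is_minus K5 B" "\<not> is_minus K222 B" "\<not> B \<simeq>\<^sub>g K5" "\<not> B \<simeq>\<^sub>g K222"
  shows "card (nbrs B x) = 2"
proof (cases "triangular B")
  case True
  then obtain a b c where abc: "distinct [a, b, c]" "B = lgraph K3_es [a, b, c]"
    using triangular_brick[OF assms(1)] by metis
  have "x \<in> set [a, b, c]" using attachment_K3_iff[OF abc(1)] assms(2,3) abc(2) by simp
  then obtain i where i: "i < 3" "x = [a, b, c] ! i"
    by (metis in_set_conv_nth length_Cons list.size(3) numeral_3_eq_3)
  have "\<forall>i\<in>set [0..<3]. length (lnbrs 3 K3_es i) = 2" by code_simp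
  then have "length (lnbrs 3 K3_es i) = 2" using i(1) by simp
  then show ?thesis
    using degree_lgraph[of 3 K3_es "[a, b, c]" i] degree_eq_card_nbrs[of B x] assms(1) abc i
    by (simp add: brick_def)
next
  case False
  obtain n es k ys where s: "(n, es, k) \<in> set shapes" "distinct ys" "length ys = n" "B = lgraph es ys"
    using non_triangular_brickE[OF assms(1) False] .
  have simple: "simple_graph B" using assms(1) by (simp add: brick_def)
  have c: "copy n es B" using s by (auto simp: copy_def)
  have "k \<noteq> 1" using iso_K5_or_K222_iff[OF s(1) c] assms(6,7) by blast
  then have "x \<in> set (take k ys)" using attachment_iff[OF s(1-3), of A] assms(2,3) s(4) by simp
  then obtain i where i: "i < k" "x = ys ! i"
    using s(3) shapes_degrees(2)[OF s(1)] by (auto simp: in_set_conv_nth)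
  have "es \<in> {K5t_es, K222t_es, K5b_es, K222b_es}"
    using s(1) c assms(4-7)
    by (auto simp: shapes_def is_minus_K5_iff[OF simple] is_minus_K222_iff[OF simple]
        iso_K5_iff[OF simple] iso_K222_iff[OF simple])
  then have "length (lnbrs n es i) = 2"
    using shapes_degrees(6,7)[OF s(1)] i(1) by blast
  then show ?thesis
    using degree_lgraph[OF wf_shape_shapes[OF s(1)] s(2,3), of i] degree_eq_card_nbrs[OF simple, of x]
      i shapes_degrees(2)[OF s(1)] s(4) by simp
qed

section \<open>Squares of cycles are minimal critical\<close>

lemma graph_dist_1_or_2:
  "graph_dist C u v \<in> {1, 2} \<longleftrightarrow>
    u \<noteq> v \<and> ({u, v} \<in> edges C \<or> (\<exists>w. {u, w} \<in> edges C \<and> {w, v} \<in> edges C))"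
proof -
  define S where "S = {k. (u, v) \<in> adj C ^^ k}"
  have S: "0 \<in> S \<longleftrightarrow> u = v" "1 \<in> S \<longleftrightarrow> {u, v} \<in> edges C"
    "2 \<in> S \<longleftrightarrow> (\<exists>w. {u, w} \<in> edges C \<and> {w, v} \<in> edges C)"
    by (auto simp: S_def adj_def numeral_2_eq_2)
  have dist: "graph_dist C u v = Inf (enat ` S)" by (simp add: graph_dist_def S_def)
  have "graph_dist C u v \<in> {1, 2} \<longleftrightarrow> 0 \<notin> S \<and> (1 \<in> S \<or> 2 \<in> S)"
  proof (cases "S = {}")
    case True
    \<comment> \<open>Without any walk the distance is the infimum of the empty set, which is
      \<infinity>.\<close>
    then show ?thesis by (simp add: dist top_enat_def)
  next
    case False
    define m where "m = (LEAST k. k \<in> S)"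
    have m: "m \<in> S" "\<And>k. k \<in> S \<Longrightarrow> m \<le> k"
      using False by (auto simp: m_def intro: LeastI Least_le)
    have "Inf (enat ` S) = enat m"
      using m by (intro antisym Inf_lower Inf_greatest) auto
    then have "graph_dist C u v \<in> {1, 2} \<longleftrightarrow> m = 1 \<or> m = 2"
      by (simp add: dist one_enat_def numeral_eq_enat)
    also have "\<dots> \<longleftrightarrow> 0 \<notin> S \<and> (1 \<in> S \<or> 2 \<in> S)"
    proof
      assume "m = 1 \<or> m = 2"
      then show "0 \<notin> S \<and> (1 \<in> S \<or> 2 \<in> S)" using m(1) m(2)[of 0] by auto
    next
      assume *: "0 \<notin> S \<and> (1 \<in> S \<or> 2 \<in> S)"
      then have "m \<noteq> 0" using m(1) by (intro notI) simp
      moreover have "m \<le> 2" using * m(2)[of 1] m(2)[of 2] by auto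
      ultimately show "m = 1 \<or> m = 2" by linarith
    qed
    finally show ?thesis .
  qed
  then show ?thesis by (simp only: S not_not)
qed

lemma square_edge_iff:
  assumes "simple_graph C"
  shows "{u, v} \<in> edges (square C) \<longleftrightarrow>
    u \<noteq> v \<and> ({u, v} \<in> edges C \<or> (\<exists>w. {u, w} \<in> edges C \<and> {w, v} \<in> edges C))"
proof -
  define R where "R u v \<longleftrightarrow> u \<in> verts C \<and> v \<in> verts C \<and> graph_dist C u v \<in> {1, 2}" for u v
  have R: "R u v \<longleftrightarrow>
    u \<noteq> v \<and> ({u, v} \<in> edges C \<or> (\<exists>w. {u, w} \<in> edges C \<and> {w, v} \<in> edges C))" for u v
    unfolding R_def graph_dist_1_or_2 using simple_edge(1,2)[OF assms] by blast
  have "R v u" if "R u v" for u v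
    using that unfolding R by (metis insert_commute)
  note * = doubleton_in_Collect_iff[of R, OF this]
  have "edges (square C) = {{u, v} | u v. R u v}" unfolding square_def R_def by simp
  then have "{u, v} \<in> edges (square C) \<longleftrightarrow> R u v" by (simp only: *)
  then show ?thesis by (simp only: R)
qed

lemma simple_square:
  assumes "simple_graph C"
  shows "simple_graph (square C)"
  unfolding simple_graph_def
proof (intro conjI ballI)
  show "finite (verts (square C))" using assms by (simp add: square_def simple_graph_def)
next
  fix e assume e: "e \<in> edges (square C)"
  then obtain u v where uv: "e = {u, v}" "u \<in> verts C" "v \<in> verts C" by (auto simp: square_def)
  moreover have "u \<noteq> v" using e square_edge_iff[OF assms] uv(1) by simp
  ultimately show "e \<subseteq> verts (square C)" "card e = 2" by (auto simp: square_def)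
qed

lemma cycle_graph_edge_iff:
  assumes "i < n" "j < n"
  shows "{i, j} \<in> edges (cycle_graph n) \<longleftrightarrow> j = (i + 1) mod n \<or> i = (j + 1) mod n"
  using assms by (auto simp: cycle_graph_def doubleton_eq_iff)

text \<open>All degrees are four, so it is enough that every edge lies in a triangle, and any three
  consecutive vertices of the cycle form one.\<close>

lemma square_of_cycle_minimal_critical:
  assumes C: "is_cycle C n" and n: "5 \<le> n"
  shows "minimal_critical (square C)"
proof -
  have simple: "simple_graph C" using C by (simp add: is_cycle_def)
  obtain f where f: "bij_betw f (verts C) {..<n}"
    and fE: "\<And>u v. u \<in> verts C \<Longrightarrow> v \<in> verts C \<Longrightarrow> {u, v} \<in> edges C \<longleftrightarrow> {f u, f v} \<in> edges (cycle_graph n)"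
    using C by (auto simp: is_cycle_def graph_iso_def cycle_graph_def)
  \<comment> \<open>The cycle is unrolled to the integers with period \<open>n\<close>, so that the
    neighbours at \<open>i + 1\<close>, \<open>i + 2\<close>, \<open>i - 1\<close>,
    \<open>i - 2\<close> need no case distinction at the seam.\<close>
  define h where "h i = inv_into (verts C) f (nat (i mod int n))" for i
  have lt: "nat (i mod int n) < n" for i using n by (simp add: nat_less_iff)
  have hV: "h i \<in> verts C" for i
    using bij_betw_apply[OF bij_betw_inv_into[OF f]] lt by (simp add: h_def)
  have fh: "f (h i) = nat (i mod int n)" for i
    using bij_betw_inv_into_right[OF f] lt by (simp add: h_def)
  have surj: "\<exists>i. v = h (int i)" if "v \<in> verts C" for v
  proof -
    have "f v < n" using bij_betw_apply[OF f that] by simp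
    then have "h (int (f v)) = v" using bij_betw_inv_into_left[OF f that] by (simp add: h_def)
    then show ?thesis by metis
  qed
  have h_eq: "h i = h j \<longleftrightarrow> int n dvd i - j" for i j
  proof -
    have "h i = h j \<longleftrightarrow> f (h i) = f (h j)"
      using bij_betw_imp_inj_on[OF f] hV by (auto dest: inj_onD)
    also have "\<dots> \<longleftrightarrow> i mod int n = j mod int n" using n by (auto simp: fh nat_eq_iff2)
    finally show ?thesis by (simp add: mod_eq_dvd_iff)
  qed
  have step: "(nat (i mod int n) + 1) mod n = nat ((i + 1) mod int n)" for i
  proof -
    have "int ((nat (i mod int n) + 1) mod n) = (i mod int n + 1) mod int n"
      using n by (simp add: zmod_int add.commute)
    also have "\<dots> = (i + 1) mod int n" by (simp add: mod_add_left_eq)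
    finally show ?thesis by (metis nat_int)
  qed
  have hE: "{h i, h j} \<in> edges C \<longleftrightarrow> h j = h (i + 1) \<or> h j = h (i - 1)" for i j
  proof -
    have "{h i, h j} \<in> edges C \<longleftrightarrow> f (h j) = f (h (i + 1)) \<or> f (h i) = f (h (j + 1))"
      using fE[OF hV hV] cycle_graph_edge_iff[OF lt lt, of i j] unfolding fh step by simp
    also have "\<dots> \<longleftrightarrow> h j = h (i + 1) \<or> h i = h (j + 1)"
      using bij_betw_imp_inj_on[OF f] hV by (auto dest: inj_onD)
    also have "h i = h (j + 1) \<longleftrightarrow> h j = h (i - 1)"
      unfolding h_eq by (subst dvd_minus_iff[symmetric]) (simp add: algebra_simps)
    finally show ?thesis .
  qed
  have nbC: "nbrs C (h i) = {h (i + 1), h (i - 1)}" for i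
  proof -
    have "u \<in> nbrs C (h i) \<longleftrightarrow> u \<in> {h (i + 1), h (i - 1)}" for u
    proof (cases "u \<in> verts C")
      case True
      then show ?thesis using surj hE by (metis in_nbrs insert_iff singletonD)
    next
      case False
      then show ?thesis using hV simple_edge(2)[OF simple] by auto
    qed
    then show ?thesis by blast
  qed
  \<comment> \<open>Here the length enters: positions at most two away from \<open>i\<close> differ
    by at most four, so they stay distinct modulo \<open>n\<close> if \<open>n\<close> is at least
    five.\<close>
  have ne: "h i \<noteq> h j" if "i \<noteq> j" "\<bar>i - j\<bar> < 5" for i j
  proof
    assume "h i = h j"
    then have "int n dvd i - j" by (simp add: h_eq)
    then have "int n \<le> \<bar>i - j\<bar>" using that(1) dvd_imp_le_int[of "i - j" "int n"] by simp
    then show False using that n by linarith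
  qed
  let ?G = "square C"
  have nbG: "nbrs ?G (h i) = {h (i + 1), h (i + 2), h (i - 1), h (i - 2)}" for i
  proof -
    have nb: "nbrs C (h (i + 1)) = {h (i + 2), h i}" "nbrs C (h (i - 1)) = {h i, h (i - 2)}"
      using nbC[of "i + 1"] nbC[of "i - 1"] by (simp_all add: add.assoc)
    have ne': "h (i + 1) \<noteq> h i" "h (i + 2) \<noteq> h i" "h (i - 1) \<noteq> h i" "h (i - 2) \<noteq> h i"
      by (rule ne; simp)+
    have A: "u \<in> nbrs ?G (h i) \<longleftrightarrow> u \<noteq> h i \<and> (u \<in> nbrs C (h i) \<or> (\<exists>w\<in>nbrs C (h i). u \<in> nbrs C w))" for u
      unfolding in_nbrs square_edge_iff[OF simple] Bex_def by (rule conj_cong) auto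
    have "(\<exists>w\<in>nbrs C (h i). u \<in> nbrs C w) \<longleftrightarrow> u \<in> nbrs C (h (i + 1)) \<or> u \<in> nbrs C (h (i - 1))" for u
      unfolding nbC[of i] by blast
    then have "u \<in> nbrs ?G (h i) \<longleftrightarrow> u \<in> {h (i + 1), h (i + 2), h (i - 1), h (i - 2)}" for u
      unfolding A nbC[of i] nb using ne' by (auto simp only: insert_iff empty_iff)
    then show ?thesis by (rule set_eqI)
  qed
  have card4: "card (nbrs ?G (h i)) = 4" for i
  proof -
    have "distinct [h (i + 1), h (i + 2), h (i - 1), h (i - 2)]"
      by (simp; intro conjI; rule ne; simp)
    from distinct_card[OF this] show ?thesis by (simp add: nbG)
  qed
  have V: "verts ?G = verts C" by (simp add: square_def)
  have "connected_graph ?G"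
  proof -
    have path: "(h 0, h (int k)) \<in> (adj ?G)\<^sup>*" for k
    proof (induction k)
      case (Suc k)
      have "h (int k + 1) \<in> nbrs ?G (h (int k))" unfolding nbG by simp
      then have "(h (int k), h (int (Suc k))) \<in> adj ?G" by (simp add: adj_def add.commute)
      with Suc show ?case by (rule rtrancl_into_rtrancl)
    qed simp
    then have "(h 0, v) \<in> (adj ?G)\<^sup>*" if "v \<in> verts C" for v using surj[OF that] by auto
    then show ?thesis
      unfolding connected_graph_def V using rtrancl_adj_sym[of "h 0" _ ?G] hV
      by (metis rtrancl_trans empty_iff)
  qed
  then have "?G \<in> class_C"
    unfolding class_C_iff V using simple_square[OF simple] surj card4 by (metis order_refl)
  moreover have "locally_critical ?G"
    unfolding locally_critical_def
  proof (intro allI impI)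
    fix x y assume xy: "{x, y} \<in> edges ?G"
    then have "x \<in> verts C" using simple_edge[OF simple_square[OF simple] xy] V by simp
    then obtain i where x: "x = h i" using surj by blast
    have "y \<in> nbrs ?G (h i)" using xy x by simp
    then obtain w where "w \<in> nbrs ?G x \<inter> nbrs ?G y" "\<exists>j. w = h j"
    proof -
      assume *: "\<And>w. w \<in> nbrs ?G x \<inter> nbrs ?G y \<Longrightarrow> \<exists>j. w = h j \<Longrightarrow> thesis"
      have t: "thesis" if "h j \<in> nbrs ?G x" "h j \<in> nbrs ?G y" for j using * that by blast
      from \<open>y \<in> nbrs ?G (h i)\<close> consider "y = h (i + 1)" | "y = h (i + 2)" | "y = h (i - 1)" | "y = h (i - 2)"
        unfolding nbG by blast
      then show thesis
      proof cases
        \<comment> \<open>The third vertex of the triangle is the one just beyond \<open>y\<close>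
          for a step of one, and the one in between for a step of two.\<close>
        case 1 show ?thesis by (rule t[of "i + 2"]) (simp_all only: 1 x nbG, simp_all add: add.commute)
      next
        case 2 show ?thesis by (rule t[of "i + 1"]) (simp_all only: 2 x nbG, simp_all add: add.commute)
      next
        case 3 show ?thesis by (rule t[of "i - 2"]) (simp_all only: 3 x nbG, simp_all add: add.commute)
      next
        case 4 show ?thesis by (rule t[of "i - 1"]) (simp_all only: 4 x nbG, simp_all add: add.commute)
      qed
    qed
    then show "(card (nbrs ?G x) = 4 \<or> card (nbrs ?G y) = 4) \<and>
      ((\<exists>w\<in>nbrs ?G x \<inter> nbrs ?G y. card (nbrs ?G w) = 4) \<or>
       card (nbrs ?G x) = 4 \<and> card (nbrs ?G y) = 4 \<and> insert x (nbrs ?G x) = insert y (nbrs ?G y))"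
      using card4 x by blast
  qed
  ultimately show ?thesis by (simp add: minimal_critical_iff)
qed

section \<open>Graphs built from bricks are minimal critical\<close>

lemma nbrs_K3:
  assumes "distinct [x, y, z]"
  shows "nbrs (lgraph K3_es [x, y, z]) x = {y, z}" "nbrs (lgraph K3_es [x, y, z]) y = {x, z}"
    "nbrs (lgraph K3_es [x, y, z]) z = {x, y}"
  using assms by (auto simp: lgraph_K3 doubleton_eq_iff)

lemma triangular_brick_facts:
  assumes "brick B" "triangular B" "attachment B A"
  shows "A = verts B" "connected_graph B" "\<And>v. v \<in> verts B \<Longrightarrow> card (nbrs B v) = 2"
    "\<And>u v. {u, v} \<in> edges B \<Longrightarrow> \<exists>w\<in>nbrs B u \<inter> nbrs B v. w \<in> verts B"
proof -
  obtain x y z where d: "distinct [x, y, z]" and B: "B = lgraph K3_es [x, y, z]"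
    using triangular_brick[OF assms(1,2)] .
  have V: "verts B = {x, y, z}" by (simp add: B)
  note nb = nbrs_K3[OF d, folded B]
  show "A = verts B" using attachment_K3_iff[OF d] assms(3) V B by simp
  show "card (nbrs B v) = 2" if "v \<in> verts B" for v
    using that d nb unfolding V by auto
  show "\<exists>w\<in>nbrs B u \<inter> nbrs B v. w \<in> verts B" if "{u, v} \<in> edges B" for u v
  proof -
    have "(u, v) \<in> {(x, y), (y, x), (x, z), (z, x), (y, z), (z, y)}"
      using that by (auto simp: B lgraph_K3 doubleton_eq_iff)
    then show ?thesis
      by (elim insertE emptyE) (simp_all add: nb V del: in_nbrs, blast+)
  qed
  have "(x, u) \<in> (adj B)\<^sup>*" if "u \<in> verts B" for u
  proof -
    have "(x, y) \<in> adj B" "(x, z) \<in> adj B" by (auto simp: adj_def B lgraph_K3)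
    then show ?thesis using that unfolding V by auto
  qed
  then show "connected_graph B"
    unfolding connected_graph_def using rtrancl_adj_sym[of x _ B] V
    by (metis rtrancl_trans insert_not_empty)
qed

lemma brick_min_degree:
  assumes "brick B" "attachment B A" "v \<in> verts B"
  shows "2 \<le> card (nbrs B v)"
  using triangular_brick_facts(3)[OF assms(1) _ assms(2,3)]
    non_triangular_brick_ok[OF assms(1) _ assms(2)] assms(3)
  unfolding brick_ok_def by (cases "triangular B") auto

text \<open>Criticality is inherited brick by brick. In a triangle (TB) gives all three vertices
  degree four. In any other brick the witnesses demanded by the local condition are found among its
  private vertices, whose neighbourhoods in \<open>G\<close> and in the brick agree.\<close>

lemma bricks_minimal_critical:
  fixes H :: "('a, 'e) mhgraph"
  assumes mh: "multihypergraph H" and ne: "hverts H \<noteq> {}" and conn: "connected_mhgraph H"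
    and deg: "\<And>x. x \<in> hverts H \<Longrightarrow> 2 \<le> hdegree H x"
    and ends_ne: "\<And>e. e \<in> hedges H \<Longrightarrow> ends H e \<noteq> {}"
    and arises: "arises_from G H B" and TB: "TB H B"
  shows "minimal_critical G"
proof -
  have brick: "brick (B e)" and att: "attachment (B e) (ends H e)"
    and shared: "{x \<in> verts (B e). \<exists>f\<in>hedges H. f \<noteq> e \<and> x \<in> verts (B f)} = ends H e"
    and disj: "\<And>f d. f \<in> hedges H \<Longrightarrow> f \<noteq> e \<Longrightarrow> d \<in> edges (B e) \<Longrightarrow> d \<notin> edges (B f)"
    if "e \<in> hedges H" for e
    using arises that unfolding arises_from_def by blast+
  have G: "G = \<lparr>verts = hverts H \<union> (\<Union>e\<in>hedges H. verts (B e)), edges = (\<Union>e\<in>hedges H. edges (B e))\<rparr>"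
    using arises by (simp add: arises_from_def)
  have simpleB: "simple_graph (B e)" if "e \<in> hedges H" for e
    using brick[OF that] by (simp add: brick_def)
  have endsV: "ends H e \<subseteq> verts (B e)" if "e \<in> hedges H" for e
    by (subst shared[OF that, symmetric]) blast
  have sharedI: "x \<in> ends H e"
    if "e \<in> hedges H" "x \<in> verts (B e)" "f \<in> hedges H" "f \<noteq> e" "x \<in> verts (B f)" for e f x
    using that by (subst shared[OF that(1), symmetric]) blast
  have sharedD: "\<exists>f\<in>hedges H. f \<noteq> e \<and> x \<in> verts (B f)" if "e \<in> hedges H" "x \<in> ends H e" for e x
  proof -
    have "x \<in> {x \<in> verts (B e). \<exists>f\<in>hedges H. f \<noteq> e \<and> x \<in> verts (B f)}"
      using that shared by simp
    then show ?thesis by simp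
  qed
  have endsH: "ends H e \<subseteq> hverts H" if "e \<in> hedges H" for e
    using mh that by (simp add: multihypergraph_def)
  \<comment> \<open>Sharing is symmetric: \<open>x\<close> is also a vertex of attachment of the
    second brick.\<close>
  have other: "\<exists>f\<in>hedges H. f \<noteq> e \<and> x \<in> ends H f" if "e \<in> hedges H" "x \<in> ends H e" for e x
  proof -
    from sharedD[OF that] obtain f where f: "f \<in> hedges H" "f \<noteq> e" "x \<in> verts (B f)" by blast
    have "x \<in> verts (B e)" using endsV that by blast
    then have "x \<in> ends H f" using sharedI[OF f(1,3) that(1)] f(2) by blast
    with f show ?thesis by blast
  qed
  have hv: "\<exists>e\<in>hedges H. x \<in> ends H e" if "x \<in> hverts H" for x
  proof (rule ccontr)
    assume "\<not> ?thesis"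
    then have none: "{e \<in> hedges H. x \<in> ends H e} = {}" by blast
    show False using deg[OF that] unfolding hdegree_def none by simp
  qed
  have V: "verts G = (\<Union>e\<in>hedges H. verts (B e))"
  proof -
    have "hverts H \<subseteq> (\<Union>e\<in>hedges H. verts (B e))" using hv endsV by blast
    then show ?thesis unfolding G by (simp add: Un_absorb1)
  qed
  have E: "edges G = (\<Union>e\<in>hedges H. edges (B e))" unfolding G by simp
  have simple: "simple_graph G"
    unfolding simple_graph_def
  proof (intro conjI ballI)
    show "finite (verts G)" unfolding V
      using mh simpleB by (auto simp: multihypergraph_def simple_graph_def)
  next
    fix d assume "d \<in> edges G"
    then obtain e where e: "e \<in> hedges H" "d \<in> edges (B e)" unfolding E by blast
    then show "d \<subseteq> verts G" "card d = 2"
      using simpleB[OF e(1)] unfolding simple_graph_def V by blast+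
  qed
  have nbG: "nbrs G x = (\<Union>e\<in>hedges H. nbrs (B e) x)" for x
    by (auto simp: E)
  have nbV: "x \<in> verts (B e)" if "e \<in> hedges H" "u \<in> nbrs (B e) x" for e u x
    using simple_edge(1)[OF simpleB[OF that(1)]] that(2) by simp
  \<comment> \<open>A vertex of \<open>B e\<close> that is no end of \<open>e\<close> lies in no
    other brick, so all its edges are in \<open>B e\<close>.\<close>
  have inner: "nbrs G x = nbrs (B e) x" if "e \<in> hedges H" "x \<in> verts (B e)" "x \<notin> ends H e" for e x
  proof -
    have "f = e" if "f \<in> hedges H" "u \<in> nbrs (B f) x" for f u
      using nbV[OF that] that(1) sharedI[OF \<open>e \<in> hedges H\<close> \<open>x \<in> verts (B e)\<close>] \<open>x \<notin> ends H e\<close> by blast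
    then show ?thesis unfolding nbG using that(1) by blast
  qed
  have deg2: "2 \<le> card (nbrs (B e) x)" if "e \<in> hedges H" "x \<in> verts (B e)" for e x
    using brick_min_degree[OF brick[OF that(1)] att[OF that(1)] that(2)] .
  have inner4: "card (nbrs G x) = 4" if "e \<in> hedges H" "x \<in> verts (B e)" "x \<notin> ends H e" for e x
  proof -
    have "\<not> triangular (B e)"
      using triangular_brick_facts(1)[OF brick[OF that(1)] _ att[OF that(1)]] that by blast
    then show ?thesis
      using non_triangular_brick_ok[OF brick[OF that(1)] _ att[OF that(1)]] that(2,3) inner[OF that]
      unfolding brick_ok_def by auto
  qed
  have nbdisj: "nbrs (B e) x \<inter> nbrs (B f) x = {}" if "e \<in> hedges H" "f \<in> hedges H" "e \<noteq> f" for e f x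
    using disj[OF that(1,2)] that(3) by auto
  note fin = finite_nbrs[OF simpleB]
  \<comment> \<open>A shared vertex lies in two bricks without a common edge, and each of them gives
    it at least two edges.\<close>
  have deg4: "4 \<le> card (nbrs G x)" if x: "x \<in> verts G" for x
  proof -
    obtain e where e: "e \<in> hedges H" "x \<in> verts (B e)" using x unfolding V by blast
    show ?thesis
    proof (cases "x \<in> ends H e")
      case True
      then obtain f where f: "f \<in> hedges H" "f \<noteq> e" "x \<in> ends H f" using other e by blast
      then have fx: "x \<in> verts (B f)" using endsV by blast
      have "4 \<le> card (nbrs (B e) x) + card (nbrs (B f) x)"
        using deg2[OF e] deg2[OF f(1) fx] by simp
      also have "\<dots> = card (nbrs (B e) x \<union> nbrs (B f) x)"
        using nbdisj[OF e(1) f(1)] f(2) fin[OF e(1)] fin[OF f(1)] by (simp add: card_Un_disjoint)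
      also have "\<dots> \<le> card (nbrs G x)"
        using e(1) f(1) finite_nbrs[OF simple] by (intro card_mono) (auto simp: nbG simp del: in_nbrs)
      finally show ?thesis .
    qed (use inner4[OF e] in simp)
  qed
  have connB: "connected_graph (B e)" if "e \<in> hedges H" for e
    using triangular_brick_facts(2)[OF brick[OF that] _ att[OF that]]
      non_triangular_brick_ok[OF brick[OF that] _ att[OF that]]
    unfolding brick_ok_def by blast
  have pathB: "(u, v) \<in> (adj G)\<^sup>*" if "e \<in> hedges H" "u \<in> verts (B e)" "v \<in> verts (B e)" for e u v
  proof -
    have "adj (B e) \<subseteq> adj G" using that(1) by (auto simp: adj_def E)
    then have "(adj (B e))\<^sup>* \<subseteq> (adj G)\<^sup>*" by (rule rtrancl_mono)
    then show ?thesis using connB[OF that(1)] that(2,3) by (auto simp: connected_graph_def)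
  qed
  have pathH: "(u, v) \<in> (adj G)\<^sup>*" if "(u, v) \<in> (hadj H)\<^sup>*" for u v
    using that
  proof induction
    case (step v w)
    then have "(v, w) \<in> (adj G)\<^sup>*" using pathB endsV by (auto simp: hadj_def) blast
    with step.IH show ?case by (rule rtrancl_trans)
  qed simp
  have toH: "\<exists>a\<in>hverts H. (u, a) \<in> (adj G)\<^sup>*" if "u \<in> verts G" for u
  proof -
    obtain e where e: "e \<in> hedges H" "u \<in> verts (B e)" using \<open>u \<in> verts G\<close> unfolding V by blast
    then obtain a where "a \<in> ends H e" using ends_ne by blast
    then show ?thesis using pathB[OF e] endsV[OF e(1)] endsH[OF e(1)] by blast
  qed
  have "connected_graph G"
    unfolding connected_graph_def
  proof (intro conjI ballI)
    show "verts G \<noteq> {}" unfolding G using ne by simp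
    fix u v assume "u \<in> verts G" "v \<in> verts G"
    then obtain a b where "a \<in> hverts H" "b \<in> hverts H" "(u, a) \<in> (adj G)\<^sup>*" "(b, v) \<in> (adj G)\<^sup>*"
      using toH rtrancl_adj_sym by meson
    moreover from this have "(a, b) \<in> (adj G)\<^sup>*"
      using conn pathH unfolding connected_mhgraph_def by blast
    ultimately show "(u, v) \<in> (adj G)\<^sup>*" by (meson rtrancl_trans)
  qed
  then have "G \<in> class_C" unfolding class_C_iff using simple deg4 by blast
  moreover have "locally_critical G"
    unfolding locally_critical_def
  proof (intro allI impI)
    fix x y assume "{x, y} \<in> edges G"
    then obtain e where e: "e \<in> hedges H" and xy: "{x, y} \<in> edges (B e)" unfolding E by blast
    note xyV = simple_edge[OF simpleB[OF e] xy]
    have sub: "nbrs (B e) u \<subseteq> nbrs G u" for u unfolding nbG using e by blast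
    show "(card (nbrs G x) = 4 \<or> card (nbrs G y) = 4) \<and>
      ((\<exists>w\<in>nbrs G x \<inter> nbrs G y. card (nbrs G w) = 4) \<or>
       card (nbrs G x) = 4 \<and> card (nbrs G y) = 4 \<and> insert x (nbrs G x) = insert y (nbrs G y))"
    proof (cases "triangular (B e)")
      case False
      note ok = non_triangular_brick_ok[OF brick[OF e] False att[OF e]]
      have "x \<notin> ends H e \<or> y \<notin> ends H e" using ok xy unfolding brick_ok_def by blast
      then have "card (nbrs G x) = 4 \<or> card (nbrs G y) = 4" using inner4[OF e] xyV by blast
      moreover have "(\<exists>w\<in>nbrs (B e) x \<inter> nbrs (B e) y. w \<notin> ends H e) \<or>
          x \<notin> ends H e \<and> y \<notin> ends H e \<and> insert x (nbrs (B e) x) = insert y (nbrs (B e) y)"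
        using ok xy unfolding brick_ok_def by blast
      then have "(\<exists>w\<in>nbrs G x \<inter> nbrs G y. card (nbrs G w) = 4) \<or>
        card (nbrs G x) = 4 \<and> card (nbrs G y) = 4 \<and> insert x (nbrs G x) = insert y (nbrs G y)"
      proof
        assume "\<exists>w\<in>nbrs (B e) x \<inter> nbrs (B e) y. w \<notin> ends H e"
        then obtain w where w: "w \<in> nbrs (B e) x" "w \<in> nbrs (B e) y" "w \<notin> ends H e" by blast
        then have "w \<in> verts (B e)" using simple_edge(2)[OF simpleB[OF e], of x w] by simp
        then have "card (nbrs G w) = 4" using inner4[OF e] w(3) by blast
        then show ?thesis using w sub by blast
      next
        assume "x \<notin> ends H e \<and> y \<notin> ends H e \<and> insert x (nbrs (B e) x) = insert y (nbrs (B e) y)"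
        then show ?thesis using inner4[OF e] inner[OF e] xyV by simp
      qed
      ultimately show ?thesis by blast
    next
      case True
      note tri = triangular_brick_facts[OF brick[OF e] True att[OF e]]
      from TB e True obtain f where f: "\<And>v. v \<in> ends H e \<Longrightarrow>
          {g \<in> hedges H. g \<noteq> e \<and> v \<in> ends H g} = {f v} \<and>
          \<not> is_minus K5 (B (f v)) \<and> \<not> is_minus K222 (B (f v)) \<and>
          \<not> B (f v) \<simeq>\<^sub>g K5 \<and> \<not> B (f v) \<simeq>\<^sub>g K222"
        unfolding TB_def by meson
      \<comment> \<open>(TB) allows just one other brick at \<open>v\<close>, and that brick has
        exactly two edges there, so the lower bound four is attained.\<close>
      have four: "card (nbrs G v) = 4" if v: "v \<in> verts (B e)" for v
      proof -
        have ve: "v \<in> ends H e" using v tri(1) by simp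
        note fv = f[OF ve]
        have g: "f v \<in> hedges H" "f v \<noteq> e" "v \<in> ends H (f v)" using fv by blast+
        have "card (nbrs (B (f v)) v) = 2"
          using attachment_degree_2[OF brick[OF g(1)] att[OF g(1)] g(3)] fv by blast
        moreover have "card (nbrs (B e) v) = 2" using tri(3)[OF v] .
        moreover have "nbrs G v \<subseteq> nbrs (B e) v \<union> nbrs (B (f v)) v"
        proof
          fix u assume "u \<in> nbrs G v"
          then obtain g where g: "g \<in> hedges H" "u \<in> nbrs (B g) v" unfolding nbG by blast
          have "g = e \<or> g = f v"
          proof (rule ccontr)
            assume "\<not> ?thesis"
            moreover have "v \<in> ends H g" if "g \<noteq> e"
              using sharedI[OF g(1) nbV[OF g] e _ v] that by blast
            ultimately show False using fv g(1) by blast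
          qed
          then show "u \<in> nbrs (B e) v \<union> nbrs (B (f v)) v" using g(2) by blast
        qed
        then have "card (nbrs G v) \<le> card (nbrs (B e) v \<union> nbrs (B (f v)) v)"
          using fin[OF e] fin[OF g(1)] by (intro card_mono) auto
        moreover have "card (nbrs (B e) v \<union> nbrs (B (f v)) v) \<le> card (nbrs (B e) v) + card (nbrs (B (f v)) v)"
          by (rule card_Un_le)
        moreover have "v \<in> verts G" using v e unfolding V by blast
        ultimately show ?thesis using deg4[of v] by linarith
      qed
      obtain w where "w \<in> nbrs (B e) x \<inter> nbrs (B e) y" "w \<in> verts (B e)"
        using tri(4)[OF xy] by blast
      then have "w \<in> nbrs G x \<inter> nbrs G y" "card (nbrs G w) = 4" using sub four by blast+
      then show ?thesis using four[OF xyV(1)] by blast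
    qed
  qed
  ultimately show ?thesis by (simp add: minimal_critical_iff)
qed

section \<open>Neighbourhoods of vertices of degree four\<close>

text \<open>Puts the interior vertices into \<open>T\<close>. Both edges of the path have an
  interior end because only edges at interior vertices are known when a shape is recognised in
  \<open>G\<close>.\<close>

lemma shapes_interior_path:
  assumes "(n, es, k) \<in> set shapes" "k \<le> j" "j < n"
  obtains a b c where "a < n" "b < n" "c < n" "ladj es j a" "ladj es j b" "ladj es j c" "a \<noteq> c"
    "ladj es a b" "ladj es b c" "k \<le> a \<or> k \<le> b" "k \<le> c \<or> k \<le> b"
proof -
  have *: "\<forall>(n, es, k)\<in>set shapes. \<forall>j\<in>set [k..<n]. \<exists>a\<in>set [0..<n]. \<exists>b\<in>set [0..<n]. \<exists>c\<in>set [0..<n].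
      ladj es j a \<and> ladj es j b \<and> ladj es j c \<and>
      a \<noteq> c \<and> ladj es a b \<and> ladj es b c \<and> (k \<le> a \<or> k \<le> b) \<and> (k \<le> c \<or> k \<le> b)"
    by code_simp
  have j: "j \<in> set [k..<n]" using assms(2,3) by simp
  from bspec[OF * assms(1), unfolded prod.case, THEN bspec, OF j] obtain a b c where
    "a \<in> set [0..<n]" "b \<in> set [0..<n]" "c \<in> set [0..<n]" "ladj es j a \<and> ladj es j b \<and> ladj es j c \<and>
      a \<noteq> c \<and> ladj es a b \<and> ladj es b c \<and> (k \<le> a \<or> k \<le> b) \<and> (k \<le> c \<or> k \<le> b)"
    by (elim bexE)
  then show thesis by (intro that[of a b c]) simp_all
qed

lemma shapes_hub:
  assumes "(n, es, k) \<in> set shapes"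
  obtains h where "k \<le> h" "h < n" "\<And>j. k \<le> j \<Longrightarrow> j < n \<Longrightarrow> j = h \<or> ladj es h j"
proof -
  have *: "\<forall>(n, es, k)\<in>set shapes. \<exists>h\<in>set [k..<n]. \<forall>j\<in>set [k..<n]. j = h \<or> ladj es h j"
    by code_simp
  from bspec[OF * assms, unfolded prod.case] obtain h where
    "h \<in> set [k..<n]" "\<forall>j\<in>set [k..<n]. j = h \<or> ladj es h j" by (elim bexE)
  then show thesis by (intro that[of h]) simp_all
qed

text \<open>Ensures that the edges at the interior vertices are all the edges of the brick.\<close>

lemma shapes_attachment_independent:
  assumes "(n, es, k) \<in> set shapes" "i < k" "j < k"
  shows "\<not> ladj es i j"
proof -
  have "\<forall>(n, es, k)\<in>set shapes. \<forall>i\<in>set [0..<k]. \<forall>j\<in>set [0..<k]. \<not> ladj es i j" by code_simp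
  from bspec[OF this assms(1)] assms(2,3) show ?thesis by simp
qed

lemma shapes_attachment_nbr:
  assumes "(n, es, k) \<in> set shapes" "i < k"
  obtains j where "k \<le> j" "j < n" "ladj es j i"
proof -
  have *: "\<forall>(n, es, k)\<in>set shapes. \<forall>i\<in>set [0..<k]. \<exists>j\<in>set [k..<n]. ladj es j i" by code_simp
  have i: "i \<in> set [0..<k]" using assms(2) by simp
  from bspec[OF * assms(1), unfolded prod.case, THEN bspec, OF i] obtain j where
    "j \<in> set [k..<n]" "ladj es j i" by (elim bexE)
  then show thesis by (intro that[of j]) simp_all
qed

section \<open>Consequences of the local condition\<close>

locale crit_graph =
  fixes G :: "'a ugraph"
  assumes in_C: "G \<in> class_C" and crit: "locally_critical G"
begin

abbreviation E :: "'a \<Rightarrow> 'a \<Rightarrow> bool" where "E u v \<equiv> {u, v} \<in> edges G"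
abbreviation N :: "'a \<Rightarrow> 'a set" where "N v \<equiv> nbrs G v"
abbreviation deg4 :: "'a \<Rightarrow> bool" where "deg4 v \<equiv> card (N v) = 4"

lemma simple: "simple_graph G" and conn: "connected_graph G"
  using in_C by (auto simp: class_C_iff)

lemma E_sym: "E u v \<Longrightarrow> E v u"
  by (simp add: insert_commute)

lemma E_commute: "E u v \<longleftrightarrow> E v u"
  by (simp add: insert_commute)

lemma E_irrefl: "E u v \<Longrightarrow> u \<noteq> v"
  using simple_edge[OF simple] by blast

lemma min_degree: "E u v \<Longrightarrow> 4 \<le> card (N u)"
  using in_C simple_edge[OF simple] unfolding class_C_iff by blast

lemma finite_N: "finite (N u)"
  by (rule finite_nbrs[OF simple])

lemma deg4_end: "E u v \<Longrightarrow> deg4 u \<or> deg4 v"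
  using crit by (auto simp: locally_critical_def)

lemma common_nbr_or_twins:
  assumes "E u v"
  obtains w where "E u w" "E v w" "deg4 w"
  | "deg4 u" "deg4 v" "insert u (N u) = insert v (N v)"
proof -
  have "(\<exists>w\<in>N u \<inter> N v. deg4 w) \<or> deg4 u \<and> deg4 v \<and> insert u (N u) = insert v (N v)"
    using crit assms unfolding locally_critical_def by simp
  then show thesis using that by (elim disjE bexE conjE) auto
qed

lemma common_nbr:
  assumes "E u v"
  obtains w where "E u w" "E v w"
proof (cases rule: common_nbr_or_twins[OF assms])
  case 2
  \<comment> \<open>Twins share all their other neighbours, and degree four provides one.\<close>
  have "2 \<le> card (N u - {v})" using 2(1) finite_N by (simp add: card_Diff_singleton_if)
  then have "N u - {v} \<noteq> {}" by (metis card.empty not_numeral_le_zero)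
  then obtain w where "w \<in> N u" "w \<noteq> v" by blast
  moreover from this have "w \<in> N v" using 2(3) E_irrefl[of u w] by auto
  ultimately show ?thesis using that by simp
qed (rule that)

text \<open>The vertex \<open>x\<close> shows that the closed neighbourhoods of \<open>u\<close> and \<open>v\<close> differ.\<close>

lemma common_deg4_nbr:
  assumes "E u v" "E u x" "x \<noteq> v" "\<not> E v x"
  obtains w where "E u w" "E v w" "deg4 w"
proof (cases rule: common_nbr_or_twins[OF assms(1)])
  case 2
  then have "x \<in> insert v (N v)" using assms(2) by auto
  then show ?thesis using assms(3,4) by simp
qed (rule that)

lemma N_eqI:
  assumes "deg4 x" "distinct [a, b, c, d]" "E x a" "E x b" "E x c" "E x d"
  shows "N x = {a, b, c, d}"
proof -
  have "{a, b, c, d} \<subseteq> N x" using assms by simp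
  moreover have "card {a, b, c, d} = 4" using distinct_card[OF assms(2)] by simp
  ultimately show ?thesis using assms(1) finite_N card_subset_eq by metis
qed

lemma fourth_nbr:
  assumes "deg4 x" "distinct [a, b, c]" "E x a" "E x b" "E x c"
  obtains d where "N x = {a, b, c, d}" "d \<notin> {a, b, c}" "E x d"
proof -
  have sub: "{a, b, c} \<subseteq> N x" using assms by simp
  moreover have "card {a, b, c} = 3" using distinct_card[OF assms(2)] by simp
  ultimately have "card (N x - {a, b, c}) = 1" using assms(1) by (simp add: card_Diff_subset)
  then obtain d where "N x - {a, b, c} = {d}" by (auto simp: card_1_singleton_iff)
  then have "N x = {a, b, c, d}" "d \<notin> {a, b, c}" using sub by blast+
  moreover from this have "E x d" by (metis in_nbrs insertCI)
  ultimately show ?thesis using that by blast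
qed

text \<open>Since no neighbourhood has an isolated vertex, containing a path on three vertices is
  the same, for four vertices, as not being two disjoint edges.\<close>

definition T :: "'a set" where
  "T = {v. deg4 v \<and> (\<exists>a b c. a \<noteq> c \<and> E v a \<and> E v b \<and> E v c \<and> E a b \<and> E b c)}"

text \<open>Edges between two boundary vertices are left out: they belong to other bricks.\<close>

definition sub :: "'a set \<Rightarrow> 'a ugraph" where
  "sub I = \<lparr>verts = I \<union> (\<Union>v\<in>I. N v), edges = {e \<in> edges G. e \<inter> I \<noteq> {}}\<rparr>"

text \<open>The interior vertices of a brick other than a triangle. They form a component of the subgraph
  induced by \<open>T\<close>: the hub makes them connected, and no vertex of attachment is in \<open>T\<close>.\<close>

definition interior :: "'a set \<Rightarrow> bool" where
  "interior I \<longleftrightarrow> I \<subseteq> T \<and> (\<forall>x\<in>I. \<forall>y\<in>N x. y \<in> T \<longrightarrow> y \<in> I) \<and> (\<exists>h\<in>I. I \<subseteq> insert h (N h)) \<and>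
     brick (sub I) \<and> \<not> triangular (sub I) \<and> attachment (sub I) (verts (sub I) - I) \<and>
     card (verts (sub I) - I) \<in> {1, 2, 3} \<and>
     (\<forall>x\<in>verts (sub I) - I. (\<exists>y. E x y \<and> y \<notin> I) \<and>
        (deg4 x \<longrightarrow>
          (\<exists>(n, es)\<in>{(5, K5t_es), (6, K222t_es), (6, K5b_es), (7, K222b_es)}. copy n es (sub I))))"

lemma T_deg4: "v \<in> T \<Longrightarrow> deg4 v"
  by (simp add: T_def)

text \<open>The neighbourhoods of the interior vertices fix the brick; the work is at the boundary.
  By \<open>att\<close>, no edge joins the neighbours of a boundary vertex \<open>x\<close> inside
  the interior to those outside, and each nonempty side has at least two members because every edge
  lies in a triangle. So if \<open>x\<close> has degree four, its neighbourhood is two disjoint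
  edges and \<open>x\<close> has degree two in the brick. The premise \<open>big\<close> prevents
  the brick from being the whole graph.\<close>

lemma interiorI:
  assumes shape: "(n, es, k) \<in> set shapes" and ys: "distinct ys" "length ys = n"
    and nb: "\<And>j. k \<le> j \<Longrightarrow> j < n \<Longrightarrow> N (ys ! j) = set (map ((!) ys) (lnbrs n es j))"
    and att: "\<And>x r p. x \<in> set (take k ys) \<Longrightarrow> r \<in> set (take k ys) \<Longrightarrow> p \<in> set (drop k ys) \<Longrightarrow>
      E x r \<Longrightarrow> E x p \<Longrightarrow> E p r \<Longrightarrow> False"
    and big: "k = 1 \<Longrightarrow> \<not> deg4 (ys ! 0)"
  shows "interior (set (drop k ys))"
proof -
  let ?I = "set (drop k ys)" and ?A = "set (take k ys)"
  note wf = wf_shape_shapes[OF shape] and d = shapes_degrees[OF shape]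
  have k: "k < n" "0 < k" using d(1,2) by simp_all
  have "drop k ys = map ((!) ys) [k..<n]"
    by (metis ys(2) map_nth drop_map drop_upt add_0)
  then have I: "?I = (!) ys ` {k..<n}" by simp
  have A: "?A = (!) ys ` {..<k}" using set_take_nth[of k ys] ys(2) k by simp
  have Y: "set ys = ?A \<union> ?I" by (metis append_take_drop_id set_append)
  have disj: "?A \<inter> ?I = {}" using ys(1) by (metis append_take_drop_id distinct_append)
  have Ei: "E (ys ! j) u \<longleftrightarrow> (\<exists>i<n. ladj es j i \<and> u = ys ! i)" if "k \<le> j" "j < n" for j u
  proof -
    have "E (ys ! j) u \<longleftrightarrow> u \<in> N (ys ! j)" by simp
    also have "\<dots> \<longleftrightarrow> (\<exists>i<n. ladj es j i \<and> u = ys ! i)"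
      unfolding nb[OF that] by (auto simp: lnbrs_def)
    finally show ?thesis .
  qed
  have Eij: "E (ys ! j) (ys ! i) \<longleftrightarrow> ladj es j i" if "k \<le> j" "j < n" "i < n" for i j
    unfolding Ei[OF that(1,2)] using ys that(3) by (auto simp: nth_eq_iff_index_eq)
  note indep = shapes_attachment_independent[OF shape]
  have inj: "inj_on ((!) ys) {..<n}" using ys by (auto simp: inj_on_def nth_eq_iff_index_eq)
  have lsub: "set (lnbrs n es j) \<subseteq> {..<n}" for j by (auto simp: lnbrs_def)
  have clen: "card (set (lnbrs n es j)) = length (lnbrs n es j)" for j
    by (rule distinct_card) (simp add: lnbrs_def)
  have I4: "deg4 x" if "x \<in> ?I" for x
  proof -
    from that obtain j where j: "k \<le> j" "j < n" "x = ys ! j" unfolding I by auto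
    have "card (N x) = card (set (lnbrs n es j))"
      unfolding j(3) nb[OF j(1,2)] set_map by (rule card_image[OF inj_on_subset[OF inj lsub]])
    then show ?thesis using d(4)[OF j(1,2)] clen by simp
  qed
  have IT: "x \<in> T" if "x \<in> ?I" for x
  proof -
    from that obtain j where j: "k \<le> j" "j < n" "x = ys ! j" unfolding I by auto
    obtain a b c where abc: "a < n" "b < n" "c < n" "ladj es j a" "ladj es j b"
      "ladj es j c" "a \<noteq> c" "ladj es a b" "ladj es b c" "k \<le> a \<or> k \<le> b" "k \<le> c \<or> k \<le> b"
      using shapes_interior_path[OF shape j(1,2)] .
    have e: "E (ys ! p) (ys ! q)" if "ladj es p q" "k \<le> p \<or> k \<le> q" "p < n" "q < n" for p q
      using that Eij[of p q] Eij[of q p] ladj_commute[of es p q] E_sym by blast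
    have "ys ! a \<noteq> ys ! c" using abc ys by (simp add: nth_eq_iff_index_eq)
    moreover have "E x (ys ! a)" "E x (ys ! b)" "E x (ys ! c)" "E (ys ! a) (ys ! b)" "E (ys ! b) (ys ! c)"
      using e abc j by auto
    ultimately show ?thesis unfolding T_def using I4[OF that] by blast
  qed
  have NI: "N x \<subseteq> set ys" if "x \<in> ?I" for x
  proof -
    from that obtain j where j: "k \<le> j" "j < n" "x = ys ! j" unfolding I by auto
    show ?thesis unfolding j(3) nb[OF j(1,2)] using ys(2) lsub[of j] by (auto simp del: in_nbrs)
  qed
  have attN: "\<exists>p\<in>?I. E p x" if "x \<in> ?A" for x
  proof -
    from that obtain i where i: "i < k" "x = ys ! i" unfolding A by auto
    obtain j where "k \<le> j" "j < n" "ladj es j i"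
      using shapes_attachment_nbr[OF shape i(1)] .
    then have "E (ys ! j) x" "ys ! j \<in> ?I" using Eij[of j i] i k unfolding I by auto
    then show ?thesis by blast
  qed
  have VS: "verts (sub ?I) = set ys"
  proof -
    have "?A \<subseteq> (\<Union>v\<in>?I. N v)" using attN by auto
    then show ?thesis unfolding sub_def Y using NI Y by auto
  qed
  have Adef: "verts (sub ?I) - ?I = ?A" unfolding VS Y using disj by blast
  have sub: "sub ?I = lgraph es ys"
  proof (rule lgraph_eqI[OF _ wf ys VS])
    show "simple_graph (sub ?I)"
      using simple VS unfolding simple_graph_def
    proof (intro conjI ballI)
      fix e assume e: "e \<in> edges (sub ?I)"
      then have eG: "e \<in> edges G" "e \<inter> ?I \<noteq> {}" by (auto simp: sub_def)
      then obtain u v where uv: "e = {u, v}" using simple_edgeE[OF simple] by metis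
      show "card e = 2" using eG(1) simple by (simp add: simple_graph_def)
      have "u \<in> ?I \<or> v \<in> ?I" using eG(2) uv by auto
      then have "u \<in> set ys \<and> v \<in> set ys"
        using NI Y eG(1) uv E_commute by (metis UnCI in_nbrs subsetD)
      then show "e \<subseteq> verts (sub ?I)" using VS uv by simp
    qed simp
  next
    fix i j assume ij: "i < n" "j < n"
    have mem: "ys ! q \<in> ?I \<longleftrightarrow> k \<le> q" if "q < n" for q
      using that ys unfolding I by (auto simp: nth_eq_iff_index_eq)
    have "{ys ! i, ys ! j} \<in> edges (sub ?I) \<longleftrightarrow> E (ys ! i) (ys ! j) \<and> (k \<le> i \<or> k \<le> j)"
      using mem[OF ij(1)] mem[OF ij(2)] by (auto simp: sub_def)
    also have "\<dots> \<longleftrightarrow> ladj es i j"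
      using Eij[of i j] Eij[of j i] ladj_commute[of es i j] indep[of i j] E_commute[of "ys ! i" "ys ! j"] ij
      by (meson not_le)
    finally show "{ys ! i, ys ! j} \<in> edges (sub ?I) \<longleftrightarrow> ladj es i j" .
  qed
  have bd: "(\<exists>y. E x y \<and> y \<notin> ?I) \<and> (deg4 x \<longrightarrow> x \<notin> T \<and> length (lnbrs n es 0) = 2)" if x: "x \<in> ?A" for x
  proof -
    from x obtain i where i: "i < k" "x = ys ! i" unfolding A by auto
    define P where "P = N x \<inter> ?I"
    define R where "R = N x - ?I"
    have NPR: "N x = P \<union> R" "P \<inter> R = {}" by (auto simp: P_def R_def)
    have PorR: "u \<in> P \<or> u \<in> R" if "E x u" for u using that by (auto simp: P_def R_def)
    have finPR: "finite P" "finite R" using finite_N by (auto simp: P_def R_def)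
    \<comment> \<open>A neighbour of an interior vertex that is not itself interior is a vertex of
      attachment, which \<open>att\<close> forbids here.\<close>
    have PR: "\<not> E p r" if "p \<in> P" "r \<in> R" for p r
    proof
      assume pr: "E p r"
      have "p \<in> ?I" "E x p" "E x r" "r \<notin> ?I" using that by (auto simp: P_def R_def)
      moreover from this pr have "r \<in> ?A" using NI[of p] Y by auto
      ultimately show False using att[OF x] pr by blast
    qed
    obtain p0 where p0: "p0 \<in> ?I" "E p0 x" using attN[OF x] by blast
    then have p0P: "p0 \<in> P" using E_sym by (simp add: P_def)
    have Eu: "\<exists>w. E x w \<and> E u w" if "E x u" for u
      using common_nbr[OF that] by blast
    have P2: "2 \<le> card P"
    proof -
      from p0P have "E x p0" by (simp add: P_def)
      from Eu[OF this] obtain w where w: "E x w" "E p0 w" by blast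
      then have "w \<in> P" using PR[OF p0P] PorR by blast
      moreover have "w \<noteq> p0" using w E_irrefl by blast
      ultimately have "{p0, w} \<subseteq> P" "card {p0, w} = 2" using p0P by auto
      then show ?thesis using finPR card_mono by metis
    qed
    have R2: "2 \<le> card R" if "R \<noteq> {}"
    proof -
      from that obtain r where r: "r \<in> R" by blast
      then have "E x r" by (simp add: R_def)
      from Eu[OF this] obtain w where w: "E x w" "E r w" by blast
      then have "w \<in> R" using PR[of w r] r PorR E_sym[of r w] by blast
      moreover have "w \<noteq> r" using w E_irrefl by blast
      ultimately have "{r, w} \<subseteq> R" "card {r, w} = 2" using r by auto
      then show ?thesis using finPR card_mono by metis
    qed
    have cN: "card (N x) = card P + card R" using NPR finPR by (simp add: card_Un_disjoint)
    have cP: "card P = length (lnbrs n es i)"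
    proof -
      have "P = (!) ys ` set (lnbrs n es i)"
      proof (intro subset_antisym subsetI)
        fix p assume p: "p \<in> P"
        then obtain j where j: "k \<le> j" "j < n" "p = ys ! j" unfolding P_def I by auto
        have "E p x" using p E_sym by (simp add: P_def)
        then have "ladj es j i" using Eij[OF j(1,2), of i] i k j(3) by simp
        then show "p \<in> (!) ys ` set (lnbrs n es i)"
          using j ladj_commute by (auto simp: lnbrs_def)
      next
        fix p assume "p \<in> (!) ys ` set (lnbrs n es i)"
        then obtain j where j: "j < n" "ladj es i j" "p = ys ! j" by (auto simp: lnbrs_def)
        then have kj: "k \<le> j" using indep[OF i(1), of j] by (meson not_le)
        then have "E p x" using Eij[OF kj j(1), of i] j ladj_commute[of es i j] i k by simp
        then show "p \<in> P" using j kj E_sym unfolding P_def I by auto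
      qed
      then have "card P = card (set (lnbrs n es i))"
        using card_image[OF inj_on_subset[OF inj lsub]] by metis
      then show ?thesis using clen by simp
    qed
    \<comment> \<open>Some neighbour of \<open>x\<close> is outside the interior: the brick gives
      \<open>x\<close> fewer than four edges, except for \<open>K5\<close> and the octahedron, where
      \<open>big\<close> supplies a fifth neighbour.\<close>
    have lt: "card P < card (N x)"
    proof (cases "k = 1")
      case True
      have "length (lnbrs n es i) \<le> 4"
      proof -
        have "\<forall>(n, es, k)\<in>set shapes. \<forall>i\<in>set [0..<k]. length (lnbrs n es i) \<le> 4" by code_simp
        from bspec[OF this shape] i show ?thesis by simp
      qed
      moreover have "x = ys ! 0" using i True by simp
      then have "card (N x) \<noteq> 4" using big[OF True] by simp
      moreover have "4 \<le> card (N x)" using min_degree E_sym[OF p0(2)] by blast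
      ultimately show ?thesis using cP by linarith
    next
      case False
      have "4 \<le> card (N x)" using min_degree E_sym[OF p0(2)] by blast
      then show ?thesis using d(5)[OF False i(1)] cP by simp
    qed
    then have "R \<noteq> {}" using cN by auto
    then have "\<exists>y. E x y \<and> y \<notin> ?I" by (auto simp: R_def)
    moreover have "x \<notin> T \<and> length (lnbrs n es 0) = 2" if four: "deg4 x"
    proof
      have c2: "card P = 2" "card R = 2" using P2 R2[OF \<open>R \<noteq> {}\<close>] cN four by auto
      then show "length (lnbrs n es 0) = 2" using d(8)[OF _ i(1)] cP by metis
      show "x \<notin> T"
      proof
        assume "x \<in> T"
        then obtain a b c where abc: "a \<noteq> c" "E x a" "E x b" "E x c" "E a b" "E b c"
          by (auto simp: T_def)
        have ne: "a \<noteq> b" "b \<noteq> c" using abc E_irrefl by blast+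
        have three: "card {a, b, c} = 3" using abc(1) ne by simp
        \<comment> \<open>A path cannot change sides, so its three vertices would lie in a side of
          size two.\<close>
        have "{a, b, c} \<subseteq> P \<or> {a, b, c} \<subseteq> R"
        proof (cases "b \<in> P")
          case True
          then have "a \<in> P" "c \<in> P"
            using PR[of b a] PR[of b c] abc E_sym[of a b] PorR by blast+
          then show ?thesis using True by simp
        next
          case False
          then have "b \<in> R" using abc PorR by blast
          then have "a \<in> R" "c \<in> R"
            using PR[of a b] PR[of c b] abc E_sym[of b c] PorR by blast+
          then show ?thesis using \<open>b \<in> R\<close> by simp
        qed
        then have "3 \<le> card P \<or> 3 \<le> card R" using three finPR card_mono by metis
        then show False using c2 by simp
      qed
    qed
    ultimately show ?thesis by blast
  qed
  have shape2: "(n, es) \<in> {(5, K5t_es), (6, K222t_es), (6, K5b_es), (7, K222b_es)}"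
    if "length (lnbrs n es 0) = 2"
  proof -
    have "\<forall>(n, es, k)\<in>set shapes. length (lnbrs n es 0) = 2 \<longrightarrow>
      (n, es) \<in> set [(5, K5t_es), (6, K222t_es), (6, K5b_es), (7, K222b_es)]" by code_simp
    from bspec[OF this shape] that show ?thesis by simp
  qed
  have copy: "copy n es (sub ?I)" using ys sub by (auto simp: copy_def)
  have "\<exists>h\<in>?I. ?I \<subseteq> insert h (N h)"
  proof -
    obtain h where h: "k \<le> h" "h < n" "\<And>j. k \<le> j \<Longrightarrow> j < n \<Longrightarrow> j = h \<or> ladj es h j"
      using shapes_hub[OF shape] by blast
    have "?I \<subseteq> insert (ys ! h) (N (ys ! h))"
    proof
      fix u assume "u \<in> ?I"
      then obtain j where j: "k \<le> j" "j < n" "u = ys ! j" unfolding I by auto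
      then show "u \<in> insert (ys ! h) (N (ys ! h))" using h(3)[OF j(1,2)] Eij[OF h(1,2) j(2)] by auto
    qed
    moreover have "ys ! h \<in> ?I" using h unfolding I by auto
    ultimately show ?thesis by blast
  qed
  moreover have "\<forall>x\<in>?I. \<forall>y\<in>N x. y \<in> T \<longrightarrow> y \<in> ?I"
    using NI Y bd T_deg4 by blast
  moreover have "brick (sub ?I)" "\<not> triangular (sub ?I)"
    using shapes_not_triangular[OF shape ys] sub by auto
  moreover have "attachment (sub ?I) ?A"
    unfolding sub attachment_iff[OF shape ys]
    using k ys by (cases "k = 1") (auto simp: take_Suc_conv_app_nth)
  moreover have "card ?A \<in> {1, 2, 3}"
    using distinct_card[of "take k ys"] ys k d(3) by auto
  moreover have "\<forall>x\<in>?A. (\<exists>y. E x y \<and> y \<notin> ?I) \<and>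
        (deg4 x \<longrightarrow>
          (\<exists>(n, es)\<in>{(5, K5t_es), (6, K222t_es), (6, K5b_es), (7, K222b_es)}. copy n es (sub ?I)))"
    using bd shape2 copy by blast
  ultimately show ?thesis unfolding interior_def Adef using IT by blast
qed

end

section \<open>Recognising squares of cycles\<close>

text \<open>The closing edge is written as \<open>(0, n - 1)\<close> to respect the orientation in
  \<open>wf_shape\<close>.\<close>

definition cyc_es :: "nat \<Rightarrow> (nat \<times> nat) list" where
  "cyc_es n = (0, n - 1) # map (\<lambda>i. (i, Suc i)) [0..<n - 1]"

lemma wf_cyc_es: "3 \<le> n \<Longrightarrow> wf_shape n (cyc_es n)"
  by (auto simp: wf_shape_def cyc_es_def distinct_map inj_on_def)

lemma ladj_cyc_es:
  "3 \<le> n \<Longrightarrow> i < n \<Longrightarrow> j < n \<Longrightarrow> ladj (cyc_es n) i j \<longleftrightarrow>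
    j = Suc i \<or> i = Suc j \<or> (i = 0 \<and> j = n - 1) \<or> (j = 0 \<and> i = n - 1)"
  by (auto simp: ladj_def cyc_es_def)

text \<open>The positions at distance one or two on the cycle, as a list so that small cases can be
  evaluated.\<close>

definition cyc2 :: "nat \<Rightarrow> nat \<Rightarrow> nat list" where
  "cyc2 n i = filter (\<lambda>j. j \<noteq> i \<and> (ladj (cyc_es n) i j \<or>
     (\<exists>k\<in>set [0..<n]. ladj (cyc_es n) i k \<and> ladj (cyc_es n) k j))) [0..<n]"

lemma cycle_graph_eq_lgraph:
  assumes "3 \<le> n"
  shows "cycle_graph n = lgraph (cyc_es n) [0..<n]"
proof (rule lgraph_eqI[OF _ wf_cyc_es[OF assms]])
  have "i \<noteq> (i + 1) mod n" if "i < n" for i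
    using that assms by (cases "i + 1 = n") auto
  then show "simple_graph (cycle_graph n)"
    using assms by (auto simp: simple_graph_def cycle_graph_def card_insert_if)
next
  fix i j assume ij: "i < n" "j < n"
  have "(k + 1) mod n = (if k = n - 1 then 0 else Suc k)" if "k < n" for k
    using that assms by auto
  then show "{[0..<n] ! i, [0..<n] ! j} \<in> edges (cycle_graph n) \<longleftrightarrow> ladj (cyc_es n) i j"
    using ij assms by (auto simp: cycle_graph_edge_iff ladj_cyc_es)
qed (auto simp: cycle_graph_def)

lemma is_cycle_lgraph:
  assumes "distinct xs" "length xs = n" "3 \<le> n"
  shows "is_cycle (lgraph (cyc_es n) xs) n"
proof -
  have "copy n (cyc_es n) (lgraph (cyc_es n) xs)" using assms by (auto simp: copy_def)
  from copy_imp_iso[OF this wf_cyc_es[OF assms(3)], of "[0..<n]"] show ?thesis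
    using assms simple_lgraph[OF wf_cyc_es[OF assms(3)] assms(1,2)]
    by (simp add: is_cycle_def cycle_graph_eq_lgraph)
qed

lemma square_eqI:
  assumes "simple_graph G" "simple_graph C" "verts G = verts C"
    and "\<And>x. x \<in> verts C \<Longrightarrow> nbrs G x = (nbrs C x \<union> (\<Union>w\<in>nbrs C x. nbrs C w)) - {x}"
  shows "G = square C"
proof -
  have *: "{u, v} \<in> edges G \<longleftrightarrow> {u, v} \<in> edges (square C)" for u v
  proof (cases "u \<in> verts C")
    case True
    have "{u, v} \<in> edges G \<longleftrightarrow> v \<in> nbrs G u" by simp
    also have "\<dots> \<longleftrightarrow> u \<noteq> v \<and> ({u, v} \<in> edges C \<or> (\<exists>w. {u, w} \<in> edges C \<and> {w, v} \<in> edges C))"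
      unfolding assms(4)[OF True] by auto
    also have "\<dots> \<longleftrightarrow> {u, v} \<in> edges (square C)" by (simp only: square_edge_iff[OF assms(2)])
    finally show ?thesis .
  next
    case False
    moreover have "u \<notin> verts G" "u \<notin> verts (square C)" using False assms(3) by (auto simp: square_def)
    ultimately show ?thesis
      using simple_edge(1)[OF assms(1)] simple_edge(1)[OF simple_square[OF assms(2)]] by blast
  qed
  have "e \<in> edges G \<longleftrightarrow> e \<in> edges (square C)" for e
    using * simple_edgeE[OF assms(1)] simple_edgeE[OF simple_square[OF assms(2)]] by metis
  then have "edges G = edges (square C)" by (rule set_eqI)
  moreover have "verts G = verts (square C)" using assms(3) by (simp add: square_def)
  ultimately show ?thesis by simp
qed

text \<open>A longest path closes up: by maximality the second neighbour of its last vertex lies on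
  it, and it can only be the first vertex since the inner ones have no neighbour to spare. By
  connectedness nothing else remains.\<close>

lemma two_regular_is_cycle:
  assumes simple: "simple_graph C" and conn: "connected_graph C"
    and reg: "\<And>v. v \<in> verts C \<Longrightarrow> card (nbrs C v) = 2"
  shows "\<exists>n. is_cycle C n \<and> n = card (verts C)"
proof -
  define path where "path xs \<longleftrightarrow> distinct xs \<and> set xs \<subseteq> verts C \<and>
    (\<forall>i. Suc i < length xs \<longrightarrow> {xs ! i, xs ! Suc i} \<in> edges C)" for xs
  obtain v where v: "v \<in> verts C" using conn by (auto simp: connected_graph_def)
  obtain b c where bc: "nbrs C v = {b, c}" "b \<noteq> c" using reg[OF v] by (auto simp: card_2_iff)
  have vb: "{v, b} \<in> edges C" "{v, c} \<in> edges C" using bc(1) by (metis in_nbrs insertCI)+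
  have bv: "{b, v} \<in> edges C" using vb(1) by (simp only: insert_commute)
  \<comment> \<open>Guarantees that the longest path has the three vertices needed for a
    cycle.\<close>
  have "path [b, v, c]"
    unfolding path_def
  proof (intro conjI allI impI)
    show "distinct [b, v, c]" "set [b, v, c] \<subseteq> verts C"
      using bc(2) simple_edge[OF simple vb(1)] simple_edge[OF simple vb(2)] by auto
    fix i assume "Suc i < length [b, v, c]"
    then have "i = 0 \<or> i = 1" by auto
    then show "{[b, v, c] ! i, [b, v, c] ! Suc i} \<in> edges C" using bv vb(2) by auto
  qed
  have "length xs \<le> card (verts C)" if "path xs" for xs
  proof -
    have "length xs = card (set xs)" using that distinct_card[of xs] by (simp add: path_def)
    also have "\<dots> \<le> card (verts C)"
      using that simple by (intro card_mono) (simp_all add: path_def simple_graph_def)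
    finally show ?thesis .
  qed
  then have "\<exists>xs. path xs \<and> (\<forall>ys. path ys \<longrightarrow> length ys \<le> length xs)"
    using \<open>path [b, v, c]\<close> by (intro ex_has_greatest_nat[where b = "Suc (card (verts C))"]) (auto simp: less_Suc_eq_le)
  then obtain xs where xs: "path xs" "\<And>ys. path ys \<Longrightarrow> length ys \<le> length xs" by blast
  define m where "m = length xs"
  have m: "3 \<le> m" using xs(2)[OF \<open>path [b, v, c]\<close>] by (simp add: m_def)
  have d: "distinct xs" and sV: "set xs \<subseteq> verts C"
    and st: "\<And>i. Suc i < m \<Longrightarrow> {xs ! i, xs ! Suc i} \<in> edges C"
    using xs(1) by (auto simp: path_def m_def)
  have inV: "xs ! i \<in> verts C" if "i < m" for i using sV that by (auto simp: m_def)
  have neq: "xs ! i = xs ! j \<longleftrightarrow> i = j" if "i < m" "j < m" for i j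
    using d that by (simp add: nth_eq_iff_index_eq m_def)
  have fin: "finite (nbrs C u)" for u by (rule finite_nbrs[OF simple])
  have two: "nbrs C u = {p, q}" if "u \<in> verts C" "{u, p} \<in> edges C" "{u, q} \<in> edges C" "p \<noteq> q" for u p q
    using card_subset_eq[OF fin, of "{p, q}" u] reg[OF that(1)] that by simp
  have st': "{xs ! Suc i, xs ! i} \<in> edges C" if "Suc i < m" for i
    using st[OF that] by (simp add: insert_commute)
  have inner: "nbrs C (xs ! i) = {xs ! (i - 1), xs ! Suc i}" if "0 < i" "Suc i < m" for i
  proof (rule two)
    show "xs ! i \<in> verts C" using inV that by simp
    show "{xs ! i, xs ! (i - 1)} \<in> edges C" using st'[of "i - 1"] that by simp
    show "{xs ! i, xs ! Suc i} \<in> edges C" using st that by simp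
    show "xs ! (i - 1) \<noteq> xs ! Suc i" using neq[of "i - 1" "Suc i"] that by simp
  qed
  let ?l = "xs ! (m - 1)"
  have lV: "?l \<in> verts C" using inV m by simp
  have le: "{?l, xs ! (m - 2)} \<in> edges C"
    using st'[of "m - 2"] m by (simp add: Suc_diff_Suc numeral_2_eq_2)
  have "card (nbrs C ?l - {xs ! (m - 2)}) = 1" using reg[OF lV] le fin by simp
  then obtain q where q0: "nbrs C ?l - {xs ! (m - 2)} = {q}" by (auto simp: card_1_singleton_iff)
  then have "q \<in> nbrs C ?l" and q2: "q \<noteq> xs ! (m - 2)" by blast+
  then have q: "{?l, q} \<in> edges C" by simp
  have "q \<in> set xs"
  proof (rule ccontr)
    assume "q \<notin> set xs"
    then have "path (xs @ [q])"
      unfolding path_def using d sV simple_edge(2)[OF simple q] st q m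
      by (auto simp: m_def nth_append less_Suc_eq)
        (metis diff_Suc_1 One_nat_def)
    then show False using xs(2) by force
  qed
  then obtain i where i: "i < m" "q = xs ! i" by (auto simp: in_set_conv_nth m_def)
  have "i \<noteq> m - 1" using simple_edge(3)[OF simple q] i by auto
  moreover have "i \<noteq> m - 2" using q2 i by auto
  ultimately have i': "Suc i < m - 1" using i(1) by linarith
  \<comment> \<open>An inner vertex has only its two neighbours on the path, and the last vertex is
    neither of them.\<close>
  have "i = 0"
  proof (rule ccontr)
    assume "i \<noteq> 0"
    then have "nbrs C (xs ! i) = {xs ! (i - 1), xs ! Suc i}" using inner i' by simp
    moreover have "?l \<in> nbrs C (xs ! i)" using q i by (simp add: insert_commute)
    ultimately have "?l = xs ! (i - 1) \<or> ?l = xs ! Suc i" by blast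
    then show False using neq[of "m - 1" "i - 1"] neq[of "m - 1" "Suc i"] i' m by auto
  qed
  then have close: "{?l, xs ! 0} \<in> edges C" using q i by simp
  have nb: "nbrs C (xs ! i) = (!) xs ` {j. j < m \<and> ladj (cyc_es m) i j}" if "i < m" for i
  proof -
    consider "i = 0" | "i = m - 1" | "0 < i" "Suc i < m" using \<open>i < m\<close> by linarith
    then show ?thesis
    proof cases
      case 1
      have "{j. j < m \<and> ladj (cyc_es m) i j} = {1, m - 1}" using 1 m by (auto simp: ladj_cyc_es)
      moreover have "nbrs C (xs ! 0) = {xs ! 1, xs ! (m - 1)}"
      proof (rule two)
        show "{xs ! 0, xs ! 1} \<in> edges C" using st[of 0] m by simp
        show "{xs ! 0, ?l} \<in> edges C" using close by (simp add: insert_commute)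
      qed (use inV neq m in auto)
      ultimately show ?thesis using 1 by simp
    next
      case 2
      have "{j. j < m \<and> ladj (cyc_es m) i j} = {0, m - 2}" using 2 m by (auto simp: ladj_cyc_es)
      moreover have "nbrs C ?l = {xs ! 0, xs ! (m - 2)}"
        by (rule two[OF lV close le]) (use neq m in auto)
      ultimately show ?thesis using 2 by simp
    next
      case 3
      have "{j. j < m \<and> ladj (cyc_es m) i j} = {i - 1, Suc i}" using 3 m by (auto simp: ladj_cyc_es)
      then show ?thesis using inner[OF 3] by simp
    qed
  qed
  have V: "verts C = set xs"
  proof
    show "verts C \<subseteq> set xs"
    proof (rule connected_graph_closed[OF conn])
      show "xs ! 0 \<in> set xs" using m nth_mem[of 0 xs] by (fastforce simp: m_def)
      show "xs ! 0 \<in> verts C" using inV[of 0] m by simp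
      fix x y assume "x \<in> set xs" "{x, y} \<in> edges C"
      then obtain i where "i < m" "y \<in> nbrs C (xs ! i)" by (auto simp: in_set_conv_nth m_def)
      then show "y \<in> set xs" unfolding nb[OF \<open>i < m\<close>] by (auto simp: m_def)
    qed
  qed (rule sV)
  have "C = lgraph (cyc_es m) xs"
  proof (rule lgraph_eqI[OF simple wf_cyc_es[OF m] d _ V])
    fix i j assume ij: "i < m" "j < m"
    have "{xs ! i, xs ! j} \<in> edges C \<longleftrightarrow> xs ! j \<in> nbrs C (xs ! i)" by simp
    also have "\<dots> \<longleftrightarrow> ladj (cyc_es m) i j" unfolding nb[OF ij(1)] using ij neq by auto
    finally show "{xs ! i, xs ! j} \<in> edges C \<longleftrightarrow> ladj (cyc_es m) i j" .
  qed (simp add: m_def)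
  then have "is_cycle C m" using is_cycle_lgraph[OF d _ m] by (simp add: m_def)
  moreover have "m = card (verts C)" using distinct_card[OF d] V by (simp add: m_def)
  ultimately show ?thesis by blast
qed

section \<open>The interiors of the eight bricks other than the triangle\<close>

context crit_graph
begin

text \<open>The premise on \<open>a\<close> separates the brick from the case that \<open>G\<close>
  is \<open>K5\<close> itself, hence the square of a cycle.\<close>

lemma interior_K5:
  assumes d: "distinct [a, b, c, d, e]"
    and nb: "N b = {a, c, d, e}" "N c = {a, b, d, e}" "N d = {a, b, c, e}" "N e = {a, b, c, d}"
    and x: "\<not> deg4 a"
  shows "interior {b, c, d, e}"
proof -
  have l: "lnbrs 5 K5_es (Suc 0) = [0, 2, 3, 4]" "lnbrs 5 K5_es 2 = [0, 1, 3, 4]" "lnbrs 5 K5_es 3 = [0, 1, 2, 4]" "lnbrs 5 K5_es 4 = [0, 1, 2, 3]"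
    by code_simp+
  have "interior (set (drop 1 [a, b, c, d, e]))"
  proof (rule interiorI[where n = 5 and es = K5_es and k = 1, OF _ d])
    fix j :: nat assume "1 \<le> j" "j < 5"
    then have "j \<in> {1, 2, 3, 4}" by auto
    then show "N ([a, b, c, d, e] ! j) = set (map ((!) [a, b, c, d, e]) (lnbrs 5 K5_es j))"
      by (elim insertE emptyE) (simp_all add: l nb)
  next
    fix t r p assume "t \<in> set (take 1 [a, b, c, d, e])" "r \<in> set (take 1 [a, b, c, d, e])" "E t r"
    then show False using E_irrefl[of a a] by simp
  qed (use x in \<open>simp_all add: shapes_def\<close>)
  then show ?thesis by simp
qed

lemma interior_K222:
  assumes d: "distinct [a, b, c, a', b', c']"
    and nb: "N b = {a, c, a', c'}" "N c = {a, b, a', b'}" "N a' = {b, c, b', c'}" "N b' = {a, c, a', c'}" "N c' = {a, b, a', b'}"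
    and x: "\<not> deg4 a"
  shows "interior {b, c, a', b', c'}"
proof -
  have l: "lnbrs 6 K222_es (Suc 0) = [0, 2, 3, 5]" "lnbrs 6 K222_es 2 = [0, 1, 3, 4]" "lnbrs 6 K222_es 3 = [1, 2, 4, 5]" "lnbrs 6 K222_es 4 = [0, 2, 3, 5]" "lnbrs 6 K222_es 5 = [0, 1, 3, 4]"
    by code_simp+
  have "interior (set (drop 1 [a, b, c, a', b', c']))"
  proof (rule interiorI[where n = 6 and es = K222_es and k = 1, OF _ d])
    fix j :: nat assume "1 \<le> j" "j < 6"
    then have "j \<in> {1, 2, 3, 4, 5}" by auto
    then show "N ([a, b, c, a', b', c'] ! j) = set (map ((!) [a, b, c, a', b', c']) (lnbrs 6 K222_es j))"
      by (elim insertE emptyE) (simp_all add: l nb)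
  next
    fix t r p assume "t \<in> set (take 1 [a, b, c, a', b', c'])" "r \<in> set (take 1 [a, b, c, a', b', c'])" "E t r"
    then show False using E_irrefl[of a a] by simp
  qed (use x in \<open>simp_all add: shapes_def\<close>)
  then show ?thesis by simp
qed

text \<open>The vertices of attachment must be nonadjacent in \<open>G\<close> itself: an edge
  between them would form triangles with interior vertices, against \<open>att\<close> in
  \<open>interiorI\<close>. The same holds for the next three shapes.\<close>

lemma interior_K5m:
  assumes d: "distinct [a, b, c, d, e]"
    and nb: "N c = {a, b, d, e}" "N d = {a, b, c, e}" "N e = {a, b, c, d}"
    and x: "\<not> E a b"
  shows "interior {c, d, e}"
proof -
  have l: "lnbrs 5 K5m_es 2 = [0, 1, 3, 4]" "lnbrs 5 K5m_es 3 = [0, 1, 2, 4]" "lnbrs 5 K5m_es 4 = [0, 1, 2, 3]"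
    by code_simp+
  have "interior (set (drop 2 [a, b, c, d, e]))"
  proof (rule interiorI[where n = 5 and es = K5m_es and k = 2, OF _ d])
    fix j :: nat assume "2 \<le> j" "j < 5"
    then have "j \<in> {2, 3, 4}" by auto
    then show "N ([a, b, c, d, e] ! j) = set (map ((!) [a, b, c, d, e]) (lnbrs 5 K5m_es j))"
      by (elim insertE emptyE) (simp_all add: l nb)
  next
    fix t r p assume "t \<in> set (take 2 [a, b, c, d, e])" "r \<in> set (take 2 [a, b, c, d, e])" "E t r"
    then show False using x E_irrefl[of t r] by (auto simp: numeral_eq_Suc E_commute)
  qed (simp_all add: shapes_def)
  then show ?thesis by simp
qed

lemma interior_K222m:
  assumes d: "distinct [a, b, c, a', b', c']"
    and nb: "N c = {a, b, a', b'}" "N a' = {b, c, b', c'}" "N b' = {a, c, a', c'}" "N c' = {a, b, a', b'}"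
    and x: "\<not> E a b"
  shows "interior {c, a', b', c'}"
proof -
  have l: "lnbrs 6 K222m_es 2 = [0, 1, 3, 4]" "lnbrs 6 K222m_es 3 = [1, 2, 4, 5]" "lnbrs 6 K222m_es 4 = [0, 2, 3, 5]" "lnbrs 6 K222m_es 5 = [0, 1, 3, 4]"
    by code_simp+
  have "interior (set (drop 2 [a, b, c, a', b', c']))"
  proof (rule interiorI[where n = 6 and es = K222m_es and k = 2, OF _ d])
    fix j :: nat assume "2 \<le> j" "j < 6"
    then have "j \<in> {2, 3, 4, 5}" by auto
    then show "N ([a, b, c, a', b', c'] ! j) = set (map ((!) [a, b, c, a', b', c']) (lnbrs 6 K222m_es j))"
      by (elim insertE emptyE) (simp_all add: l nb)
  next
    fix t r p assume "t \<in> set (take 2 [a, b, c, a', b', c'])" "r \<in> set (take 2 [a, b, c, a', b', c'])" "E t r"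
    then show False using x E_irrefl[of t r] by (auto simp: numeral_eq_Suc E_commute)
  qed (simp_all add: shapes_def)
  then show ?thesis by simp
qed

lemma interior_K5t:
  assumes d: "distinct [a, b, c, u, v]"
    and nb: "N u = {a, b, c, v}" "N v = {a, b, c, u}"
    and x: "\<not> E a b" "\<not> E a c" "\<not> E b c"
  shows "interior {u, v}"
proof -
  have l: "lnbrs 5 K5t_es 3 = [0, 1, 2, 4]" "lnbrs 5 K5t_es 4 = [0, 1, 2, 3]"
    by code_simp+
  have "interior (set (drop 3 [a, b, c, u, v]))"
  proof (rule interiorI[where n = 5 and es = K5t_es and k = 3, OF _ d])
    fix j :: nat assume "3 \<le> j" "j < 5"
    then have "j \<in> {3, 4}" by auto
    then show "N ([a, b, c, u, v] ! j) = set (map ((!) [a, b, c, u, v]) (lnbrs 5 K5t_es j))"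
      by (elim insertE emptyE) (simp_all add: l nb)
  next
    fix t r p assume "t \<in> set (take 3 [a, b, c, u, v])" "r \<in> set (take 3 [a, b, c, u, v])" "E t r"
    then show False using x E_irrefl[of t r] by (auto simp: numeral_eq_Suc E_commute)
  qed (simp_all add: shapes_def)
  then show ?thesis by simp
qed

lemma interior_K222t:
  assumes d: "distinct [a, b, c, a', b', c']"
    and nb: "N a' = {b, c, b', c'}" "N b' = {a, c, a', c'}" "N c' = {a, b, a', b'}"
    and x: "\<not> E a b" "\<not> E a c" "\<not> E b c"
  shows "interior {a', b', c'}"
proof -
  have l: "lnbrs 6 K222t_es 3 = [1, 2, 4, 5]" "lnbrs 6 K222t_es 4 = [0, 2, 3, 5]" "lnbrs 6 K222t_es 5 = [0, 1, 3, 4]"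
    by code_simp+
  have "interior (set (drop 3 [a, b, c, a', b', c']))"
  proof (rule interiorI[where n = 6 and es = K222t_es and k = 3, OF _ d])
    fix j :: nat assume "3 \<le> j" "j < 6"
    then have "j \<in> {3, 4, 5}" by auto
    then show "N ([a, b, c, a', b', c'] ! j) = set (map ((!) [a, b, c, a', b', c']) (lnbrs 6 K222t_es j))"
      by (elim insertE emptyE) (simp_all add: l nb)
  next
    fix t r p assume "t \<in> set (take 3 [a, b, c, a', b', c'])" "r \<in> set (take 3 [a, b, c, a', b', c'])" "E t r"
    then show False using x E_irrefl[of t r] by (auto simp: numeral_eq_Suc E_commute)
  qed (simp_all add: shapes_def)
  then show ?thesis by simp
qed

text \<open>No interior vertex sees both \<open>y\<close> and \<open>z\<close>, so these two may be
  adjacent in \<open>G\<close>. In this way a triangle can meet a bowtie brick in two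
  vertices.\<close>

lemma interior_K5b:
  assumes d: "distinct [y, z, p, q, r, s]"
    and nb: "N p = {y, q, r, s}" "N q = {y, p, r, s}" "N r = {z, p, q, s}" "N s = {z, p, q, r}"
  shows "interior {p, q, r, s}"
proof -
  have l: "lnbrs 6 K5b_es 2 = [0, 3, 4, 5]" "lnbrs 6 K5b_es 3 = [0, 2, 4, 5]" "lnbrs 6 K5b_es 4 = [1, 2, 3, 5]" "lnbrs 6 K5b_es 5 = [1, 2, 3, 4]"
    by code_simp+
  have "interior (set (drop 2 [y, z, p, q, r, s]))"
  proof (rule interiorI[where n = 6 and es = K5b_es and k = 2, OF _ d])
    fix j :: nat assume "2 \<le> j" "j < 6"
    then have "j \<in> {2, 3, 4, 5}" by auto
    then show "N ([y, z, p, q, r, s] ! j) = set (map ((!) [y, z, p, q, r, s]) (lnbrs 6 K5b_es j))"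
      by (elim insertE emptyE) (simp_all add: l nb)
  next
    fix t t' x' assume *: "t \<in> set (take 2 [y, z, p, q, r, s])" "t' \<in> set (take 2 [y, z, p, q, r, s])"
      "x' \<in> set (drop 2 [y, z, p, q, r, s])" "E t t'" "E t x'" "E x' t'"
    have t: "t \<in> N x'" "t' \<in> N x'" using E_sym[OF *(5)] *(6) by simp_all
    have "t \<noteq> t'" using E_irrefl[OF *(4)] .
    moreover have "t = y \<or> t = z" "t' = y \<or> t' = z" using *(1,2) by auto
    ultimately have yz: "y \<in> N x'" "z \<in> N x'" using t by blast+
    have "x' \<in> {p, q, r, s}" using *(3) by simp
    then show False using yz d by (elim insertE emptyE) (simp_all add: nb del: in_nbrs)
  qed (simp_all add: shapes_def)
  then show ?thesis by simp
qed

lemma interior_K222b: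
  assumes d: "distinct [y, z, p, q, p', q', w]"
    and nb: "N p = {y, q, q', w}" "N q = {y, p, p', w}" "N p' = {z, q, q', w}" "N q' = {z, p, p', w}" "N w = {p, q, p', q'}"
  shows "interior {p, q, p', q', w}"
proof -
  have l: "lnbrs 7 K222b_es 2 = [0, 3, 5, 6]" "lnbrs 7 K222b_es 3 = [0, 2, 4, 6]" "lnbrs 7 K222b_es 4 = [1, 3, 5, 6]" "lnbrs 7 K222b_es 5 = [1, 2, 4, 6]" "lnbrs 7 K222b_es 6 = [2, 3, 4, 5]"
    by code_simp+
  have "interior (set (drop 2 [y, z, p, q, p', q', w]))"
  proof (rule interiorI[where n = 7 and es = K222b_es and k = 2, OF _ d])
    fix j :: nat assume "2 \<le> j" "j < 7"
    then have "j \<in> {2, 3, 4, 5, 6}" by auto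
    then show "N ([y, z, p, q, p', q', w] ! j) = set (map ((!) [y, z, p, q, p', q', w]) (lnbrs 7 K222b_es j))"
      by (elim insertE emptyE) (simp_all add: l nb)
  next
    fix t t' x' assume *: "t \<in> set (take 2 [y, z, p, q, p', q', w])" "t' \<in> set (take 2 [y, z, p, q, p', q', w])"
      "x' \<in> set (drop 2 [y, z, p, q, p', q', w])" "E t t'" "E t x'" "E x' t'"
    have t: "t \<in> N x'" "t' \<in> N x'" using E_sym[OF *(5)] *(6) by simp_all
    have "t \<noteq> t'" using E_irrefl[OF *(4)] .
    moreover have "t = y \<or> t = z" "t' = y \<or> t' = z" using *(1,2) by auto
    ultimately have yz: "y \<in> N x'" "z \<in> N x'" using t by blast+
    have "x' \<in> {p, q, p', q', w}" using *(3) by simp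
    then show False using yz d by (elim insertE emptyE) (simp_all add: nb del: in_nbrs)
  qed (simp_all add: shapes_def)
  then show ?thesis by simp
qed

section \<open>The seven neighbourhoods without isolated vertices\<close>

definition cycle_square :: bool where
  "cycle_square \<longleftrightarrow> (\<exists>C n. is_cycle C n \<and> 5 \<le> n \<and> G = square C)"

text \<open>The first alternative concerns the whole graph; carrying it along lets every local case
  end in the same conclusion.\<close>

definition resolved :: "'a \<Rightarrow> bool" where
  "resolved v \<longleftrightarrow> cycle_square \<or> (\<exists>I. interior I \<and> v \<in> I)"

lemma resolvedI: "interior I \<Longrightarrow> v \<in> I \<Longrightarrow> resolved v"
  by (auto simp: resolved_def)

lemma NE: "N v = S \<Longrightarrow> E v u \<longleftrightarrow> u \<in> S"
  by auto

text \<open>The listed vertices have all their neighbours in the list, so by connectedness they are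
  all of \<open>G\<close>.\<close>

lemma cycle_squareI:
  assumes xs: "distinct xs" "length xs = n" "5 \<le> n"
    and nb': "\<And>i. i < n \<Longrightarrow> N (xs ! i) = set (map ((!) xs) (cyc2 n i))"
  shows cycle_square
proof -
  let ?C = "lgraph (cyc_es n) xs"
  have nb: "N (xs ! i) = (!) xs ` {j. j < n \<and> j \<noteq> i \<and>
      (ladj (cyc_es n) i j \<or> (\<exists>k<n. ladj (cyc_es n) i k \<and> ladj (cyc_es n) k j))}" if "i < n" for i
    unfolding nb'[OF that] cyc2_def set_map set_filter set_upt atLeast0LessThan
    by (simp add: Bex_def)
  have n3: "3 \<le> n" using xs(3) by simp
  note wf = wf_cyc_es[OF n3]
  have "xs ! 1 \<in> N (xs ! 0)"
  proof -
    have "0 < n" "1 < n" "ladj (cyc_es n) 0 1" using n3 by (auto simp: ladj_cyc_es)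
    then show ?thesis unfolding nb[OF \<open>0 < n\<close>] by blast
  qed
  then have "E (xs ! 0) (xs ! 1)" by simp
  then have 0: "xs ! 0 \<in> verts G" by (rule simple_edge(1)[OF simple])
  have "verts G \<subseteq> set xs"
  proof (rule connected_graph_closed[OF conn _ 0])
    show "xs ! 0 \<in> set xs" using xs by simp
    fix x y assume "x \<in> set xs" "E x y"
    then obtain i where "i < n" "y \<in> N (xs ! i)" using xs by (auto simp: in_set_conv_nth)
    then show "y \<in> set xs" using nb[OF \<open>i < n\<close>] xs(2) by (auto simp del: in_nbrs)
  qed
  moreover have "set xs \<subseteq> verts G"
  proof
    fix x assume "x \<in> set xs"
    then obtain i where i: "i < n" "x = xs ! i" using xs by (auto simp: in_set_conv_nth)
    define j where "j = (if i = 0 then 1 else i - 1)"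
    have "j < n" "j \<noteq> i" "ladj (cyc_es n) i j"
      using i(1) n3 by (auto simp: j_def ladj_cyc_es split: if_splits)
    then have "xs ! j \<in> N (xs ! i)" unfolding nb[OF i(1)] by blast
    then have "E x (xs ! j)" using i(2) by simp
    then show "x \<in> verts G" by (rule simple_edge(1)[OF simple])
  qed
  ultimately have V: "verts G = set xs" by blast
  have "G = square ?C"
  proof (rule square_eqI[OF simple simple_lgraph[OF wf xs(1,2)]])
    fix x assume "x \<in> verts ?C"
    then obtain i where i: "i < n" "x = xs ! i" using xs by (auto simp: in_set_conv_nth)
    have nbC: "nbrs ?C (xs ! i) = (!) xs ` {j. j < n \<and> ladj (cyc_es n) i j}" if "i < n" for i
      using nbrs_lgraph[OF wf xs(1,2) that] by (simp add: lnbrs_def)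
    have "(nbrs ?C x \<union> (\<Union>w\<in>nbrs ?C x. nbrs ?C w)) - {x} =
        (!) xs ` ({j. j < n \<and> (ladj (cyc_es n) i j \<or> (\<exists>k<n. ladj (cyc_es n) i k \<and> ladj (cyc_es n) k j))} - {i})"
    proof -
      have U: "(\<Union>w\<in>nbrs ?C x. nbrs ?C w) =
        (!) xs ` {j. j < n \<and> (\<exists>k<n. ladj (cyc_es n) i k \<and> ladj (cyc_es n) k j)}"
        unfolding i(2) nbC[OF i(1)] using nbC by (auto simp del: in_nbrs)
      have "nbrs ?C x \<union> (\<Union>w\<in>nbrs ?C x. nbrs ?C w) =
        (!) xs ` {j. j < n \<and> (ladj (cyc_es n) i j \<or> (\<exists>k<n. ladj (cyc_es n) i k \<and> ladj (cyc_es n) k j))}"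
        unfolding U unfolding i(2) nbC[OF i(1)] by blast
      then show ?thesis
        using i xs by (auto simp: nth_eq_iff_index_eq)
    qed
    also have "\<dots> = N x" unfolding i(2) nb[OF i(1)] by (rule arg_cong[where f = "image _"]) auto
    finally show "N x = (nbrs ?C x \<union> (\<Union>w\<in>nbrs ?C x. nbrs ?C w)) - {x}" by simp
  qed (simp add: V)
  then show ?thesis
    unfolding cycle_square_def using is_cycle_lgraph[OF xs(1,2) n3] xs(3) by blast
qed

text \<open>On a cycle of length five any two vertices have distance at most two.\<close>

lemma K5_cycle_square:
  assumes d: "distinct [a, b, c, d, e]"
    and nb: "N a = {b, c, d, e}" "N b = {a, c, d, e}" "N c = {a, b, d, e}" "N d = {a, b, c, e}" "N e = {a, b, c, d}"
  shows cycle_square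
proof (rule cycle_squareI[OF d, of 5])
  have l: "cyc2 5 0 = [1, 2, 3, 4]" "cyc2 5 (Suc 0) = [0, 2, 3, 4]" "cyc2 5 2 = [0, 1, 3, 4]" "cyc2 5 3 = [0, 1, 2, 4]" "cyc2 5 4 = [0, 1, 2, 3]"
    by code_simp+
  fix i :: nat assume "i < 5"
  then have "i \<in> {0, 1, 2, 3, 4}" by auto
  then show "N ([a, b, c, d, e] ! i) = set (map ((!) [a, b, c, d, e]) (cyc2 5 i))"
    by (elim insertE emptyE) (simp_all add: l nb)
qed simp_all

text \<open>On a cycle of length six each vertex has one vertex at distance three, its antipode in
  the octahedron.\<close>

lemma K222_cycle_square:
  assumes d: "distinct [a, b, c, a', b', c']"
    and nb: "N a = {b, c, b', c'}" "N b = {a, c, a', c'}" "N c = {a, b, a', b'}" "N a' = {b, c, b', c'}" "N b' = {a, c, a', c'}" "N c' = {a, b, a', b'}"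
  shows cycle_square
proof (rule cycle_squareI[OF d, of 6])
  have l: "cyc2 6 0 = [1, 2, 4, 5]" "cyc2 6 (Suc 0) = [0, 2, 3, 5]" "cyc2 6 2 = [0, 1, 3, 4]" "cyc2 6 3 = [1, 2, 4, 5]" "cyc2 6 4 = [0, 2, 3, 5]" "cyc2 6 5 = [0, 1, 3, 4]"
    by code_simp+
  fix i :: nat assume "i < 6"
  then have "i \<in> {0, 1, 2, 3, 4, 5}" by auto
  then show "N ([a, b, c, a', b', c'] ! i) = set (map ((!) [a, b, c, a', b', c']) (cyc2 6 i))"
    by (elim insertE emptyE) (simp_all add: l nb)
qed simp_all

text \<open>An interior absorbs every neighbour in \<open>T\<close>. This allows a vertex with a
  path neighbourhood to be settled through an adjacent vertex with a \<open>C4\<close>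
  neighbourhood.\<close>

lemma resolved_adjacent:
  assumes "resolved b" "E b v" "v \<in> T"
  shows "resolved v"
  using assms unfolding resolved_def interior_def by (metis in_nbrs)

lemma deg4_distinct:
  assumes "deg4 v" "N v = {a, b, c, d}"
  shows "distinct [v, a, b, c, d]"
proof -
  have "card (set [a, b, c, d]) = length [a, b, c, d]" using assms by simp
  then have "distinct [a, b, c, d]" by (rule card_distinct)
  moreover have "v \<notin> N v" using E_irrefl[of v v] by auto
  ultimately show ?thesis using assms(2) by auto
qed

lemma K4_with_big_nbr:
  assumes d: "distinct [v, a, b, c, d]" and nv: "N v = {a, b, c, d}"
    and e: "E a b" "E a c" "E a d" "E b c" "E b d" "E c d" and big: "\<not> deg4 a"
  shows "resolved v"
proof -
  note nE = NE[OF nv]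
  have ve: "E v a" "E v b" "E v c" "E v d" by (simp_all add: nE)
  note ve = ve ve[THEN E_sym] and e = e e[THEN E_sym]
  have "deg4 b" "deg4 c" "deg4 d" using deg4_end e big by blast+
  then have "N b = {a, v, c, d}" "N c = {a, v, b, d}" "N d = {a, v, b, c}"
    using d by - (rule N_eqI; auto intro: ve e)+
  then show ?thesis
    using interior_K5[of a v b c d] d nv big by (intro resolvedI[of "{v, b, c, d}"]) auto
qed

text \<open>Of five mutually adjacent vertices at most one has larger degree, as every edge has an
  end of degree four. Such a vertex becomes the vertex of attachment; without it the five vertices
  are all of \<open>G\<close>.\<close>

lemma resolved_K4:
  assumes v: "deg4 v" and nv: "N v = {a, b, c, d}"
    and e: "E a b" "E a c" "E a d" "E b c" "E b d" "E c d"
  shows "resolved v"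
proof -
  have d: "distinct [v, a, b, c, d]" using deg4_distinct[OF v nv] .
  note nE = NE[OF nv]
  have ve: "E v a" "E v b" "E v c" "E v d" by (simp_all add: nE)
  note ve = ve ve[THEN E_sym] and e = e e[THEN E_sym]
  consider "\<not> deg4 a" | "\<not> deg4 b" | "\<not> deg4 c" | "\<not> deg4 d" | "deg4 a" "deg4 b" "deg4 c" "deg4 d"
    by blast
  then show ?thesis
  proof cases
    case 1 show ?thesis by (rule K4_with_big_nbr[OF d nv _ _ _ _ _ _ 1]) (rule e)+
  next
    case 2 show ?thesis
      by (rule K4_with_big_nbr[of v b a c d, OF _ _ _ _ _ _ _ _ 2]) (use d nv e in auto)
  next
    case 3 show ?thesis
      by (rule K4_with_big_nbr[of v c a b d, OF _ _ _ _ _ _ _ _ 3]) (use d nv e in auto)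
  next
    case 4 show ?thesis
      by (rule K4_with_big_nbr[of v d a b c, OF _ _ _ _ _ _ _ _ 4]) (use d nv e in auto)
  next
    case 5
    then have "N a = {v, b, c, d}" "N b = {v, a, c, d}" "N c = {v, a, b, d}" "N d = {v, a, b, c}"
      using d by - (rule N_eqI; auto intro: ve e)+
    then have cycle_square using K5_cycle_square[OF d nv] by blast
    then show ?thesis by (simp add: resolved_def)
  qed
qed

text \<open>Once both middle vertices \<open>c\<close> and \<open>d\<close> have degree four,
  \<open>v\<close>, \<open>c\<close>, \<open>d\<close> see only each other and \<open>a\<close>,
  \<open>b\<close>: the interior of \<open>K5\<close> minus the edge \<open>a b\<close>.\<close>

lemma diamond_deg4:
  assumes v: "deg4 v" and nv: "N v = {a, b, c, d}"
    and e: "E a c" "E a d" "E b c" "E b d" "E c d" and ne: "\<not> E a b" and d4: "deg4 d"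
  shows "resolved v"
proof -
  have dd: "distinct [v, a, b, c, d]" using deg4_distinct[OF v nv] .
  note nE = NE[OF nv]
  have ve: "E v a" "E v b" "E v c" "E v d" by (simp_all add: nE)
  note ve = ve ve[THEN E_sym] and e = e e[THEN E_sym]
  have nd: "N d = {a, b, c, v}" using dd by - (rule N_eqI; auto intro: d4 ve e)+
  have "deg4 c"
  proof (rule ccontr)
    assume big: "\<not> deg4 c"
    then have "deg4 a" using deg4_end e by blast
    then obtain a' where a': "N a = {v, c, d, a'}" "a' \<notin> {v, c, d}" "E a a'"
      using fourth_nbr[of a v c d] dd ve e by auto
    have "a' \<noteq> a" "a' \<noteq> b" using E_irrefl[OF a'(3)] ne a'(3) by auto
    then have nv': "\<not> E a' v" "\<not> E a' d"
      using nE[of a'] NE[OF nd, of a'] a'(2) E_commute[of a'] by auto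
    \<comment> \<open>The edge \<open>a a'\<close> needs a common neighbour of degree four. The
      neighbourhoods of \<open>v\<close> and \<open>d\<close> are already full, so only
      \<open>c\<close> is left, against the assumption.\<close>
    obtain w where w: "E a w" "E a' w" "deg4 w"
      using common_deg4_nbr[OF a'(3), of v] ve a'(2) nv' by auto
    then have "w = c" using NE[OF a'(1), of w] nv' E_irrefl[of a' w] by auto
    then show False using w big by simp
  qed
  then have "N c = {a, b, d, v}" using dd by - (rule N_eqI; auto intro: ve e)+
  then show ?thesis
    using interior_K5m[of a b c d v] dd nv nd ne by (intro resolvedI[of "{c, d, v}"]) auto
qed

lemma resolved_diamond:
  assumes v: "deg4 v" and nv: "N v = {a, b, c, d}"
    and e: "E a c" "E a d" "E b c" "E b d" "E c d" and ne: "\<not> E a b"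
  shows "resolved v"
proof (cases "deg4 d")
  case True
  show ?thesis by (rule diamond_deg4[OF v nv e ne True])
next
  case False
  then have "deg4 c" using deg4_end e by blast
  show ?thesis
    by (rule diamond_deg4[OF v _ e(2,1,4,3) E_sym[OF e(5)] ne \<open>deg4 c\<close>]) (use nv in auto)
qed

text \<open>The edge from \<open>v\<close> to the pendant vertex \<open>d\<close> forces degree four
  at \<open>a\<close>. The fourth neighbour \<open>c'\<close> of \<open>c\<close> then has to share
  \<open>b\<close> with \<open>c\<close>. So \<open>b\<close>, \<open>c\<close> hang on
  \<open>c'\<close> and \<open>v\<close>, \<open>a\<close> hang on \<open>d\<close>, a bowtie of
  \<open>K5\<close>.\<close>

lemma paw_deg4:
  assumes v: "deg4 v" and nv: "N v = {a, b, c, d}"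
    and e: "E a b" "E a c" "E b c" "E a d" and ne: "\<not> E b d" "\<not> E c d" and c4: "deg4 c"
  shows "resolved v"
proof -
  have dd: "distinct [v, a, b, c, d]" using deg4_distinct[OF v nv] .
  note nE = NE[OF nv]
  have ve: "E v a" "E v b" "E v c" "E v d" by (simp_all add: nE)
  note ve = ve ve[THEN E_sym] and e = e e[THEN E_sym]
  have ne': "\<not> E d b" "\<not> E d c" using ne E_sym by blast+
  obtain w where w: "E v w" "E d w" "deg4 w"
    using common_deg4_nbr[OF ve(4) ve(2)] dd ne' by auto
  then have "w = a" using nE[of w] ne' E_irrefl[of d w] by auto
  then have na: "N a = {d, b, c, v}" using dd w by - (rule N_eqI; auto intro: ve e)+
  obtain c' where c': "N c = {v, a, b, c'}" "c' \<notin> {v, a, b}" "E c c'"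
    using fourth_nbr[of c v a b] dd ve e c4 by auto
  have c'ne: "c' \<noteq> c" "c' \<noteq> d" using E_irrefl[OF c'(3)] ne c'(3) by auto
  then have nc': "\<not> E c' v" "\<not> E c' a"
    using nE[of c'] NE[OF na, of c'] c'(2) E_commute[of c'] by auto
  obtain w where w: "E c w" "E c' w" "deg4 w"
    using common_deg4_nbr[OF c'(3), of v] ve c'(2) nc' by auto
  then have "w = b" using NE[OF c'(1), of w] nc' E_irrefl[of c' w] by auto
  then have b: "deg4 b" "E b c'" using w E_sym by auto
  have "N b = {c', c, v, a}" using dd c'(2) c'ne by - (rule N_eqI; auto intro: b ve e)+
  moreover have "N c = {c', b, v, a}" "N v = {d, b, c, a}" using c'(1) nv by auto
  ultimately show ?thesis
    using interior_K5b[of c' d b c v a] dd na c'(2) c'ne by (intro resolvedI[of "{b, c, v, a}"]) auto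
qed

lemma resolved_paw:
  assumes v: "deg4 v" and nv: "N v = {a, b, c, d}"
    and e: "E a b" "E a c" "E b c" "E a d" and ne: "\<not> E b d" "\<not> E c d"
  shows "resolved v"
proof (cases "deg4 c")
  case True
  show ?thesis by (rule paw_deg4[OF v nv e ne True])
next
  case False
  then have "deg4 b" using deg4_end e by blast
  show ?thesis
    by (rule paw_deg4[OF v _ e(2,1) E_sym[OF e(3)] e(4) ne(2,1) \<open>deg4 b\<close>]) (use nv in auto)
qed

text \<open>The leaf \<open>a\<close> sees only the centre \<open>b\<close> among the neighbours of
  \<open>v\<close>, so \<open>b\<close> has degree four. The leaves are the vertices of
  attachment.\<close>

lemma resolved_star:
  assumes v: "deg4 v" and nv: "N v = {a, b, c, d}"
    and e: "E b a" "E b c" "E b d" and ne: "\<not> E a c" "\<not> E a d" "\<not> E c d"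
  shows "resolved v"
proof -
  have dd: "distinct [v, a, b, c, d]" using deg4_distinct[OF v nv] .
  note nE = NE[OF nv]
  have ve: "E v a" "E v b" "E v c" "E v d" by (simp_all add: nE)
  note ve = ve ve[THEN E_sym]
  obtain w where w: "E v w" "E a w" "deg4 w"
    using common_deg4_nbr[OF ve(1) ve(3)] dd ne by auto
  then have "w = b" using nE[of w] ne E_irrefl[of a w] by auto
  then have "N b = {a, c, d, v}" using dd w by - (rule N_eqI; auto intro: ve e)+
  moreover have "N v = {a, c, d, b}" using nv by auto
  ultimately show ?thesis
    using interior_K5t[of a c d v b] dd ne by (intro resolvedI[of "{v, b}"]) auto
qed

text \<open>The wheel around \<open>v\<close> is continued by the fourth neighbours
  \<open>b'\<close>, \<open>c'\<close>, \<open>d'\<close> of three rim vertices, each of which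
  shares a further rim vertex of degree four with its own. Either all three coincide, which rebuilds
  the octahedron up to one edge or one vertex of larger degree, or two adjacent pairs of rim
  vertices have separate outer neighbours, which gives a bowtie.\<close>

lemma C4_deg4:
  assumes v: "deg4 v" and nv: "N v = {a, b, c, d}"
    and e: "E a b" "E b c" "E c d" "E d a" and ne: "\<not> E a c" "\<not> E b d"
    and d4: "deg4 b" "deg4 c" "deg4 d"
  shows "resolved v"
proof -
  have dd: "distinct [v, a, b, c, d]" using deg4_distinct[OF v nv] .
  note nE = NE[OF nv]
  have ve: "E v a" "E v b" "E v c" "E v d" by (simp_all add: nE)
  note ve = ve ve[THEN E_sym] and e = e e[THEN E_sym]
  have ne': "\<not> E c a" "\<not> E d b" using ne E_sym by blast+
  obtain b' where b': "N b = {v, a, c, b'}" "b' \<notin> {v, a, c}" "E b b'"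
    using fourth_nbr[of b v a c] dd ve e d4 by auto
  obtain c' where c': "N c = {v, b, d, c'}" "c' \<notin> {v, b, d}" "E c c'"
    using fourth_nbr[of c v b d] dd ve e d4 by auto
  obtain d' where d': "N d = {v, a, c, d'}" "d' \<notin> {v, a, c}" "E d d'"
    using fourth_nbr[of d v a c] dd ve e d4 by auto
  have ne2: "b' \<noteq> b" "b' \<noteq> d" "c' \<noteq> c" "c' \<noteq> a" "d' \<noteq> d" "d' \<noteq> b"
    using E_irrefl b'(3) c'(3) d'(3) ne ne' by blast+
  have nv': "\<not> E b' v" "\<not> E c' v" "\<not> E d' v"
    using nE[of b'] nE[of c'] nE[of d'] E_commute[of _ v] ne2 b'(2) c'(2) d'(2) by auto
  obtain wb where wb: "E b wb" "E b' wb" "deg4 wb"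
    using common_deg4_nbr[OF b'(3) ve(6)] b'(2) nv' by auto
  obtain wc where wc: "E c wc" "E c' wc" "deg4 wc"
    using common_deg4_nbr[OF c'(3) ve(7)] c'(2) nv' by auto
  obtain wd where wd: "E d wd" "E d' wd" "deg4 wd"
    using common_deg4_nbr[OF d'(3) ve(8)] d'(2) nv' by auto
  have wb': "wb = a \<or> wb = c" using NE[OF b'(1), of wb] wb nv' E_irrefl[of b' wb] by auto
  have wc': "wc = b \<or> wc = d" using NE[OF c'(1), of wc] wc nv' E_irrefl[of c' wc] by auto
  have wd': "wd = a \<or> wd = c" using NE[OF d'(1), of wd] wd nv' E_irrefl[of d' wd] by auto
  show ?thesis
  proof (cases "b' = c'")
    case bc: True
    show ?thesis
    proof (cases "d' = b'")
      case True
      define u where "u = b'"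
      have nb: "N b = {a, v, c, u}" and nc: "N c = {v, b, u, d}" and nd: "N d = {a, v, c, u}"
        using b'(1) c'(1) d'(1) bc True by (auto simp: u_def)
      have ue: "E u b" "E u c" "E u d" using b'(3) c'(3) d'(3) bc True E_sym by (auto simp: u_def)
      note ue = ue ue[THEN E_sym]
      have du: "distinct [u, v, a, b, c, d]" using dd b'(2) ne2 by (auto simp: u_def)
      show ?thesis
      \<comment> \<open>Only the edge \<open>a u\<close> of the octahedron is in doubt. If it is
        present, at most one of its ends has larger degree, and that end is the vertex of
        attachment.\<close>
      proof (cases "E a u")
        case au: True
        note au' = au E_sym[OF au]
        have Na: "deg4 a \<Longrightarrow> N a = {v, b, u, d}" and Nu: "deg4 u \<Longrightarrow> N u = {a, b, c, d}"
          using du by - (rule N_eqI; auto intro: ve e ue au')+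
        consider "deg4 a" "deg4 u" | "\<not> deg4 a" "deg4 u" | "deg4 a" "\<not> deg4 u"
          using deg4_end[OF au] by blast
        then show ?thesis
        proof cases
          case 1
          have cycle_square
            by (rule K222_cycle_square[OF _ Na[OF 1(1)] nv nb nc Nu[OF 1(2)] nd]) (use du in auto)
          then show ?thesis by (simp add: resolved_def)
        next
          case 2
          have "interior {v, b, c, u, d}"
            by (rule interior_K222[OF _ nv nb nc Nu[OF 2(2)] nd 2(1)]) (use du in auto)
          then show ?thesis by (rule resolvedI) simp
        next
          case 3
          have n: "N a = {u, b, v, d}" "N b = {u, a, v, c}" "N c = {u, b, v, d}" "N d = {u, a, v, c}"
            unfolding Na[OF 3(1)] nb nc nd by auto
          have "interior {a, b, v, c, d}"
            by (rule interior_K222[OF _ n(1,2) nv n(3,4) 3(2)]) (use du in auto)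
          then show ?thesis by (rule resolvedI) simp
        qed
      next
        case au: False
        have n: "N b = {a, u, c, v}" "N c = {u, b, v, d}" "N d = {a, u, c, v}"
          unfolding nb nc nd by auto
        have "interior {b, c, v, d}"
          by (rule interior_K222m[OF _ n(1,2) nv n(3) au]) (use du in auto)
        then show ?thesis by (rule resolvedI) simp
      qed
    next
      case False
      \<comment> \<open>\<open>c\<close> already has its four neighbours, so \<open>d'\<close> can
        only be joined to \<open>a\<close>: the pairs are \<open>b\<close>, \<open>c\<close> at
        \<open>b'\<close> and \<open>d\<close>, \<open>a\<close> at \<open>d'\<close>.\<close>
      have "wd \<noteq> c" using NE[OF c'(1), of d'] wd(2) d'(2) ne2 False bc E_commute[of c d'] by auto
      then have a: "deg4 a" "E a d'" using wd wd' E_sym by auto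
      have da: "distinct [b', d', b, c, d, a, v]" using dd b'(2) d'(2) ne2 False by auto
      have n: "N a = {d', b, d, v}" using da by - (rule N_eqI; auto intro: a ve e)+
      have n': "N b = {b', c, a, v}" "N c = {b', b, d, v}" "N d = {d', c, a, v}" "N v = {b, c, d, a}"
        unfolding b'(1) c'(1) d'(1) bc nv by auto
      have "interior {b, c, d, a, v}" by (rule interior_K222b[OF da n'(1-3) n n'(4)])
      then show ?thesis by (rule resolvedI) simp
    qed
  next
    case False
    \<comment> \<open>By the same argument the pairs are now \<open>c\<close>, \<open>d\<close> at
      \<open>c'\<close> and \<open>a\<close>, \<open>b\<close> at \<open>b'\<close>.\<close>
    have "wc \<noteq> b" using NE[OF b'(1), of c'] wc(2) c'(2) ne2 False E_commute[of b c'] by auto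
    then have "E d c'" using wc wc' E_sym by auto
    then have dc: "d' = c'" using NE[OF d'(1), of c'] c'(2) ne2 c'(3) E_irrefl[of c c'] by auto
    have "wb \<noteq> c" using NE[OF c'(1), of b'] wb(2) b'(2) ne2 False E_commute[of c b'] by auto
    then have a: "deg4 a" "E a b'" using wb wb' E_sym by auto
    have da: "distinct [b', c', a, b, c, d, v]" using dd b'(2) c'(2) ne2 False by auto
    have n: "N a = {b', b, d, v}" using da by - (rule N_eqI; auto intro: a ve e)+
    have n': "N b = {b', a, c, v}" "N c = {c', b, d, v}" "N d = {c', a, c, v}"
      unfolding b'(1) c'(1) d'(1) dc by auto
    have "interior {a, b, c, d, v}" by (rule interior_K222b[OF da n n' nv])
    then show ?thesis by (rule resolvedI) simp
  qed
qed

text \<open>At most one rim vertex has larger degree: two adjacent ones contradict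
  \<open>deg4_end\<close>, and two opposite ones would leave the edge from \<open>v\<close> to a
  third rim vertex without a common neighbour of degree four. A rotation moves the exception to
  \<open>a\<close>.\<close>

lemma resolved_C4:
  assumes v: "deg4 v" and nv: "N v = {a, b, c, d}"
    and e: "E a b" "E b c" "E c d" "E d a" and ne: "\<not> E a c" "\<not> E b d"
  shows "resolved v"
proof -
  have dd: "distinct [v, a, b, c, d]" using deg4_distinct[OF v nv] .
  note nE = NE[OF nv]
  have ve: "E v a" "E v b" "E v c" "E v d" by (simp_all add: nE)
  have ne': "\<not> E c a" "\<not> E d b" using ne E_sym by blast+
  obtain w where w: "E v w" "E b w" "deg4 w" using common_deg4_nbr[OF ve(2) ve(4)] dd ne by auto
  then have ac: "deg4 a \<or> deg4 c" using nE[of w] ne E_irrefl[of b w] by auto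
  obtain w where w: "E v w" "E a w" "deg4 w" using common_deg4_nbr[OF ve(1) ve(3)] dd ne by auto
  then have bd: "deg4 b \<or> deg4 d" using nE[of w] ne E_irrefl[of a w] by auto
  note ends = deg4_end[OF e(1)] deg4_end[OF e(2)] deg4_end[OF e(3)] deg4_end[OF e(4)]
  consider "deg4 b" "deg4 c" "deg4 d" | "deg4 c" "deg4 d" "deg4 a" | "deg4 d" "deg4 a" "deg4 b"
    | "deg4 a" "deg4 b" "deg4 c"
    using ac bd ends by blast
  then show ?thesis
  proof cases
    case 1 show ?thesis by (rule C4_deg4[OF v nv e ne 1])
  next
    case 2 show ?thesis by (rule C4_deg4[OF v _ e(2-4) e(1) ne(2) ne'(1) 2]) (use nv in auto)
  next
    case 3 show ?thesis by (rule C4_deg4[OF v _ e(3,4) e(1,2) ne' 3]) (use nv in auto)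
  next
    case 4 show ?thesis by (rule C4_deg4[OF v _ e(4) e(1-3) ne'(2) ne(1) 4]) (use nv in auto)
  qed
qed

text \<open>\<open>PB v a b c d\<close> says that \<open>v\<close> sits in a square of a path \<open>d, c, v, b, a\<close>
  that neither closes up to an octahedron nor ends: \<open>PB_step\<close> continues it at \<open>b\<close>.\<close>

definition PB :: "'a \<Rightarrow> 'a \<Rightarrow> 'a \<Rightarrow> 'a \<Rightarrow> 'a \<Rightarrow> bool" where
  "PB v a b c d \<longleftrightarrow> distinct [v, a, b, c, d] \<and> N v = {a, b, c, d} \<and> E a b \<and> E b c \<and> E c d \<and>
     \<not> E a c \<and> \<not> E b d \<and> \<not> E a d \<and> (\<forall>u. E b u \<and> E c u \<longrightarrow> u = v)"

lemma PB_sym: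
  assumes "PB v a b c d"
  shows "PB v d c b a"
proof -
  have "N v = {d, c, b, a}" using assms by (auto simp: PB_def)
  moreover have "distinct [v, d, c, b, a]" using assms by (auto simp: PB_def)
  ultimately show ?thesis using assms E_commute unfolding PB_def by metis
qed

text \<open>The end \<open>a\<close> of the path sees only \<open>b\<close> among the neighbours of
  \<open>v\<close>, so \<open>b\<close> has to be their common neighbour of degree four.\<close>

lemma path_middle_deg4:
  assumes nv: "N v = {a, b, c, d}" and dd: "distinct [v, a, b, c, d]" and ne: "\<not> E a c" "\<not> E a d"
  shows "deg4 b"
proof -
  note nE = NE[OF nv]
  have ve: "E v a" "E v c" by (simp_all add: nE)
  obtain w where w: "E v w" "E a w" "deg4 w" using common_deg4_nbr[OF ve] dd ne by auto
  then have "w = b" using nE[of w] ne E_irrefl[of a w] by auto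
  then show ?thesis using w by simp
qed

text \<open>The fourth neighbour \<open>b'\<close> of \<open>b\<close> shares with it a neighbour of
  degree four. This is not \<open>v\<close>, whose neighbourhood is full, nor \<open>c\<close>, by
  the last clause of \<open>PB\<close>; so it is \<open>a\<close>, and the window moves on by one
  vertex.\<close>

lemma PB_step:
  assumes "PB v a b c d"
  obtains b' where "PB b b' a v c"
proof -
  have dd: "distinct [v, a, b, c, d]" and nv: "N v = {a, b, c, d}" and e: "E a b" "E b c" "E c d"
    and ne: "\<not> E a c" "\<not> E b d" "\<not> E a d" and uniq: "\<And>u. E b u \<Longrightarrow> E c u \<Longrightarrow> u = v"
    using assms by (auto simp: PB_def)
  note nE = NE[OF nv]
  have ve: "E v a" "E v b" "E v c" "E v d" by (simp_all add: nE)
  note ve = ve ve[THEN E_sym] and e = e e[THEN E_sym]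
  have "deg4 b" using path_middle_deg4[OF nv dd ne(1,3)] .
  then obtain b' where b': "N b = {v, a, c, b'}" "b' \<notin> {v, a, c}" "E b b'"
    using fourth_nbr[of b v a c] dd ve e by auto
  have ne2: "b' \<noteq> b" "b' \<noteq> d" using E_irrefl[OF b'(3)] b'(3) ne by auto
  then have nv': "\<not> E b' v" using nE[of b'] b'(2) E_commute[of b' v] by auto
  have nc': "\<not> E b' c" using uniq[OF b'(3)] b'(2) E_commute[of b' c] by auto
  obtain w where w: "E b w" "E b' w" "deg4 w"
    using common_deg4_nbr[OF b'(3) ve(6)] b'(2) nv' by auto
  then have "w = a" using NE[OF b'(1), of w] nv' nc' E_irrefl[of b' w] by auto
  then have "E b' a" using w by simp
  moreover have "u = b" if "E a u" "E v u" for u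
    using that nE[of u] ne E_irrefl[of a u] by auto
  moreover have "N b = {b', a, v, c}" using b'(1) by auto
  moreover have "distinct [b, b', a, v, c]" using dd b'(2) ne2 by auto
  ultimately have "PB b b' a v c" using ve e ne nv' nc' unfolding PB_def by blast
  then show thesis by (rule that)
qed

text \<open>One step leads to \<open>b\<close>, a second one to \<open>a\<close>; the mirror image
  leads to \<open>c\<close> and \<open>d\<close>.\<close>

lemma PB_nbr:
  assumes "PB v a b c d" "E v u"
  shows "\<exists>a b c d. PB u a b c d"
proof -
  have nb: "\<exists>a' b' c' d'. PB a a' b' c' d'" "\<exists>a' b' c' d'. PB b a' b' c' d'"
    if PB: "PB v a b c d" for a b c d
  proof -
    obtain b' where "PB b b' a v c" using PB_step[OF PB] .
    moreover from this obtain a' where "PB a a' b' b v" using PB_step by blast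
    ultimately show "\<exists>a' b' c' d'. PB a a' b' c' d'" "\<exists>a' b' c' d'. PB b a' b' c' d'" by blast+
  qed
  have "u \<in> {a, b, c, d}" using assms NE[of v "{a, b, c, d}" u] by (simp add: PB_def)
  then show ?thesis using nb[OF assms(1)] nb[OF PB_sym[OF assms(1)]] by blast
qed

lemma PB_cycle_square:
  assumes "PB v0 a0 b0 c0 d0"
  shows cycle_square
proof -
  have "v0 \<in> verts G"
  proof -
    have "E v0 a0" using assms NE[of v0 "{a0, b0, c0, d0}" a0] by (simp add: PB_def)
    then show ?thesis by (rule simple_edge(1)[OF simple])
  qed
  have "verts G \<subseteq> {v. \<exists>a b c d. PB v a b c d}"
    by (rule connected_graph_closed[OF conn _ \<open>v0 \<in> verts G\<close>]) (use assms PB_nbr in blast)+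
  then have all: "\<exists>a b c d. PB v a b c d" if "v \<in> verts G" for v using that by blast
  \<comment> \<open>\<open>M\<close> recovers the cycle from its square: edges between consecutive
    vertices lie in two triangles, those between vertices at distance two in only one.\<close>
  define M where "M u w \<longleftrightarrow> E u w \<and> (\<exists>p q. p \<noteq> q \<and> E u p \<and> E w p \<and> E u q \<and> E w q)" for u w
  have M_sym: "M w u" if "M u w" for u w
    using that E_sym unfolding M_def by blast
  define C where "C = \<lparr>verts = verts G, edges = {{u, w} | u w. M u w}\<rparr>"
  have VC: "verts C = verts G" by (simp add: C_def)
  have EC: "{u, w} \<in> edges C \<longleftrightarrow> M u w" for u w
    using doubleton_in_Collect_iff[of M, OF M_sym] unfolding C_def by simp
  have nbC: "nbrs C v = {b, c}" if PB: "PB v a b c d" for v a b c d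
  proof -
    have dd: "distinct [v, a, b, c, d]" and nv: "N v = {a, b, c, d}" and e: "E a b" "E b c" "E c d"
      and ne: "\<not> E a c" "\<not> E b d" "\<not> E a d"
      using PB by (auto simp: PB_def)
    note nE = NE[OF nv]
    have ve: "E v a" "E v b" "E v c" "E v d" by (simp_all add: nE)
    have "M v b" unfolding M_def using ve e dd E_sym[OF e(1)]
      by (intro conjI exI[of _ a] exI[of _ c]) auto
    moreover have "M v c" unfolding M_def using ve e dd E_sym[OF e(2)]
      by (intro conjI exI[of _ b] exI[of _ d]) auto
    moreover have "\<not> M v a"
    proof
      assume "M v a"
      then obtain p q where "p \<noteq> q" "E v p" "E a p" "E v q" "E a q" by (auto simp: M_def)
      then show False using nE[of p] nE[of q] ne E_irrefl[of a p] E_irrefl[of a q] by auto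
    qed
    moreover have "\<not> M v d"
    proof
      assume "M v d"
      then obtain p q where "p \<noteq> q" "E v p" "E d p" "E v q" "E d q" by (auto simp: M_def)
      then show False
        using nE[of p] nE[of q] ne E_irrefl[of d p] E_irrefl[of d q] E_commute[of d] by auto
    qed
    moreover have "M v u \<Longrightarrow> u \<in> {a, b, c, d}" for u using nE[of u] by (simp add: M_def)
    ultimately have "M v u \<longleftrightarrow> u \<in> {b, c}" for u by blast
    then have "u \<in> nbrs C v \<longleftrightarrow> u \<in> {b, c}" for u unfolding in_nbrs EC .
    then show ?thesis by (rule set_eqI)
  qed
  have nb2: "nbrs C v = {b, c}" "nbrs C b = {a, v}" "nbrs C c = {d, v}" if PB: "PB v a b c d" for v a b c d
  proof -
    show "nbrs C v = {b, c}" using nbC[OF PB] .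
    obtain b' where "PB b b' a v c" using PB_step[OF PB] .
    then show "nbrs C b = {a, v}" by (rule nbC)
    obtain c' where "PB c c' d v b" using PB_step[OF PB_sym[OF PB]] .
    then show "nbrs C c = {d, v}" by (rule nbC)
  qed
  have simpleC: "simple_graph C"
    unfolding simple_graph_def
  proof (intro conjI ballI)
    show "finite (verts C)" using simple by (simp add: VC simple_graph_def)
    fix e assume e: "e \<in> edges C"
    then obtain u w where uw: "e = {u, w}" by (auto simp: C_def)
    with e EC have "E u w" by (simp add: M_def)
    from simple_edge[OF simple this] show "e \<subseteq> verts C" "card e = 2" using uw VC by auto
  qed
  have "adj G \<subseteq> (adj C)\<^sup>*"
  proof (rule subrelI)
    fix x y assume "(x, y) \<in> adj G"
    then have xy: "E x y" by (simp add: adj_def)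
    obtain a b c d where PB: "PB x a b c d" using all simple_edge(1)[OF simple xy] by blast
    have st: "(u, w) \<in> adj C" if "w \<in> nbrs C u" for u w using that by (simp add: adj_def)
    have "(x, b) \<in> adj C" "(x, c) \<in> adj C" "(b, a) \<in> adj C" "(c, d) \<in> adj C"
      by (rule st, simp add: nb2[OF PB] del: in_nbrs)+
    then have "(x, a) \<in> (adj C)\<^sup>*" "(x, b) \<in> (adj C)\<^sup>*" "(x, c) \<in> (adj C)\<^sup>*" "(x, d) \<in> (adj C)\<^sup>*"
      by (meson converse_rtrancl_into_rtrancl r_into_rtrancl)+
    moreover have "y \<in> {a, b, c, d}" using PB xy NE[of x "{a, b, c, d}" y] by (simp add: PB_def)
    ultimately show "(x, y) \<in> (adj C)\<^sup>*" by blast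
  qed
  then have "(adj G)\<^sup>* \<subseteq> (adj C)\<^sup>*" by (rule rtrancl_subset_rtrancl)
  then have connC: "connected_graph C" using conn unfolding connected_graph_def VC by blast
  have "card (nbrs C v) = 2" if v: "v \<in> verts C" for v
  proof -
    obtain a b c d where PB: "PB v a b c d" using all[of v] v VC by blast
    show ?thesis unfolding nb2(1)[OF PB] using PB by (simp add: PB_def)
  qed
  then obtain n where n: "is_cycle C n" "n = card (verts C)"
    using two_regular_is_cycle[OF simpleC connC] by blast
  have "5 \<le> n"
  proof -
    have dd: "distinct [v0, a0, b0, c0, d0]" and nv: "N v0 = {a0, b0, c0, d0}"
      using assms by (auto simp: PB_def)
    have "set [v0, a0, b0, c0, d0] \<subseteq> verts G"
      using \<open>v0 \<in> verts G\<close> simple_edge(2)[OF simple, of v0] NE[OF nv] by auto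
    then have "card (set [v0, a0, b0, c0, d0]) \<le> card (verts G)"
      using simple by (intro card_mono) (auto simp: simple_graph_def)
    then show ?thesis using distinct_card[OF dd] n(2) VC by simp
  qed
  moreover have "G = square C"
  proof (rule square_eqI[OF simple simpleC])
    fix x assume "x \<in> verts C"
    then obtain a b c d where PB: "PB x a b c d" using all[of x] VC by blast
    have "N x = {a, b, c, d}" "distinct [x, a, b, c, d]" using PB by (auto simp: PB_def)
    then show "N x = nbrs C x \<union> (\<Union>w\<in>nbrs C x. nbrs C w) - {x}"
      unfolding nb2(1)[OF PB] using nb2(2,3)[OF PB] by (simp del: in_nbrs) blast
  qed (simp add: VC)
  ultimately show ?thesis unfolding cycle_square_def using n(1) by blast
qed

text \<open>The fourth neighbours \<open>b'\<close>, \<open>c'\<close> of the middle vertices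
  decide. If they coincide, an octahedron begins to form: either a triangle is missing, or a middle
  vertex has a \<open>C4\<close> as its neighbourhood. If they differ, the path continues on both
  sides.\<close>

lemma resolved_P4:
  assumes v: "deg4 v" and nv: "N v = {a, b, c, d}"
    and e: "E a b" "E b c" "E c d" and ne: "\<not> E a c" "\<not> E b d" "\<not> E a d"
  shows "resolved v"
proof -
  have dd: "distinct [v, a, b, c, d]" using deg4_distinct[OF v nv] .
  note nE = NE[OF nv]
  have ve: "E v a" "E v b" "E v c" "E v d" by (simp_all add: nE)
  note ve = ve ve[THEN E_sym] and e' = e e[THEN E_sym]
  have ne': "\<not> E c a" "\<not> E d b" "\<not> E d a" using ne E_sym by blast+
  have b4: "deg4 b" using path_middle_deg4[OF nv dd ne(1,3)] .
  have "N v = {d, c, b, a}" "distinct [v, d, c, b, a]" using nv dd by auto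
  then have c4: "deg4 c" using path_middle_deg4[of v d c b a] ne' by blast
  have vT: "v \<in> T" unfolding T_def using v ve e dd by auto
  obtain b' where b': "N b = {v, a, c, b'}" "b' \<notin> {v, a, c}" "E b b'"
    using fourth_nbr[of b v a c] dd ve e' b4 by auto
  obtain c' where c': "N c = {v, b, d, c'}" "c' \<notin> {v, b, d}" "E c c'"
    using fourth_nbr[of c v b d] dd ve e' c4 by auto
  have ne2: "b' \<noteq> b" "b' \<noteq> d" "c' \<noteq> c" "c' \<noteq> a"
    using E_irrefl b'(3) c'(3) ne ne' by blast+
  show ?thesis
  proof (cases "b' = c'")
    case True
    define u where "u = b'"
    have u: "N b = {v, a, c, u}" "N c = {v, b, d, u}" "E b u" "E c u"
      using b' c' True by (auto simp: u_def)
    have du: "distinct [u, d, a, v, b, c]" using dd b'(2) ne2 by (auto simp: u_def)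
    have vu: "\<not> E v u" using nE[of u] du by auto
    consider "E a u" | "E d u" | "\<not> E a u" "\<not> E d u" by blast
    then show ?thesis
    proof cases
      \<comment> \<open>The neighbourhood of \<open>b\<close> is now the cycle \<open>a\<close>,
        \<open>v\<close>, \<open>c\<close>, \<open>u\<close>.\<close>
      case 1
      have "N b = {a, v, c, u}" using u(1) by auto
      from resolved_C4[OF b4 this ve(5) ve(3) u(4) E_sym[OF 1] ne(1) vu] show ?thesis
        using resolved_adjacent ve(6) vT by blast
    next
      case 2
      have "N c = {d, v, b, u}" using u(2) by auto
      from resolved_C4[OF c4 this ve(8) ve(2) u(3) E_sym[OF 2] ne'(2) vu] show ?thesis
        using resolved_adjacent ve(7) vT by blast
    next
      case 3
      then have x: "\<not> E u d" "\<not> E u a" using E_sym by blast+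
      have n: "N v = {d, a, b, c}" "N b = {u, a, v, c}" "N c = {u, d, v, b}" using nv u by auto
      have "interior {v, b, c}" by (rule interior_K222t[OF du n x ne'(3)])
      then show ?thesis by (rule resolvedI) simp
    qed
  next
    case False
    have "w = v" if w: "E b w" "E c w" for w
      using w NE[OF b'(1), of w] NE[OF c'(1), of w] dd b'(2) c'(2) ne2 False by auto
    then have "PB v a b c d" using dd nv e ne unfolding PB_def by blast
    then show ?thesis using PB_cycle_square by (simp add: resolved_def)
  qed
qed

text \<open>Given a Hamiltonian path in the neighbourhood, only the pairs \<open>a c\<close>,
  \<open>b d\<close> and \<open>a d\<close> are undecided.\<close>

lemma resolved_path:
  assumes v: "deg4 v" and nv: "N v = {a, b, c, d}" and e: "E a b" "E b c" "E c d"
  shows "resolved v"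
proof -
  have n1: "N v = {c, a, b, d}" and n2: "N v = {b, c, d, a}" and n3: "N v = {a, d, b, c}"
    and n4: "N v = {b, d, a, c}" and n5: "N v = {a, c, b, d}" using nv by auto
  note s = e[THEN E_sym]
  show ?thesis
  proof (cases "E a c"; cases "E b d"; cases "E a d")
    assume "E a c" "E b d" "E a d"
    then show ?thesis using resolved_K4[OF v nv] e by blast
  next
    assume "E a c" "E b d" "\<not> E a d"
    then show ?thesis using resolved_diamond[OF v n3] e s E_sym by blast
  next
    assume "E a c" "\<not> E b d" "E a d"
    then show ?thesis using resolved_diamond[OF v n4] e s E_sym by blast
  next
    assume "E a c" "\<not> E b d" "\<not> E a d"
    then show ?thesis using resolved_paw[OF v n1] e s E_sym by blast
  next
    assume "\<not> E a c" "E b d" "E a d"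
    then show ?thesis using resolved_diamond[OF v n5] e s E_sym by blast
  next
    assume "\<not> E a c" "E b d" "\<not> E a d"
    then show ?thesis using resolved_paw[OF v n2] e s E_sym by blast
  next
    assume "\<not> E a c" "\<not> E b d" "E a d"
    then show ?thesis using resolved_C4[OF v nv] e E_sym by blast
  next
    assume "\<not> E a c" "\<not> E b d" "\<not> E a d"
    then show ?thesis using resolved_P4[OF v nv] e by blast
  qed
qed

text \<open>The fourth neighbour \<open>s\<close> is not isolated in the neighbourhood. Joined to an
  end of the path \<open>p\<close>, \<open>q\<close>, \<open>r\<close> it gives a Hamiltonian path;
  joined to \<open>q\<close> alone it leaves the paw and the star.\<close>

lemma T_resolved:
  assumes "v \<in> T"
  shows "resolved v"
proof -
  from assms obtain p q r where v: "deg4 v" and pqr: "p \<noteq> r" "E v p" "E v q" "E v r" "E p q" "E q r"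
    by (auto simp: T_def)
  then have "distinct [p, q, r]" using E_irrefl by auto
  then obtain s where s: "N v = {p, q, r, s}" "E v s" using fourth_nbr[OF v] pqr by blast
  obtain w where w: "E v w" "E s w" using common_nbr[OF s(2)] .
  have "w \<in> {p, q, r}" using NE[OF s(1), of w] w E_irrefl[OF w(2)] by auto
  then consider "E s p" | "E r s" | "E q s" "\<not> E p s" "\<not> E r s" using w E_sym by blast
  then show ?thesis
  proof cases
    case 1
    have "N v = {s, p, q, r}" using s by auto
    then show ?thesis using resolved_path[OF v _ 1 pqr(5,6)] by blast
  next
    case 2
    show ?thesis using resolved_path[OF v s(1) pqr(5,6) 2] .
  next
    case 3
    show ?thesis
    proof (cases "E p r")
      case True
      have "N v = {q, p, r, s}" using s by auto
      then show ?thesis using resolved_paw[OF v _ E_sym[OF pqr(5)] pqr(6) True 3] by blast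
    next
      case False
      show ?thesis using resolved_star[OF v s(1) E_sym[OF pqr(5)] pqr(6) 3(1) False 3(2,3)] .
    qed
  qed
qed

end

section \<open>Decomposition into bricks\<close>

text \<open>An interior common neighbour is the reason why a leftover triangle cannot meet a
  triangle-deleted brick in two vertices.\<close>

lemma triangle_deleted_common_nbr:
  assumes "copy n es B" "(n, es) \<in> {(5, K5t_es), (6, K222t_es)}" "attachment B A" "x \<in> A" "y \<in> A"
  obtains p where "p \<notin> A" "{x, p} \<in> edges B" "{y, p} \<in> edges B"
proof -
  obtain ys where ys: "distinct ys" "length ys = n" "B = lgraph es ys"
    using assms(1) by (auto simp: copy_def)
  have shape: "(n, es, 3) \<in> set shapes" using assms(2) by (auto simp: shapes_def)
  note wf = wf_shape_shapes[OF shape] and n3 = shapes_degrees(2)[OF shape]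
  have A: "A = (!) ys ` {..<3}"
    using attachment_iff[OF shape ys(1,2), of A] assms(3) ys(2,3) n3 by (simp add: set_take_nth)
  obtain i j where ij: "i < 3" "x = ys ! i" "j < 3" "y = ys ! j" using assms(4,5) A by auto
  have "\<forall>(n, es)\<in>set [(5, K5t_es), (6, K222t_es)]. \<forall>i\<in>set [0..<3]. \<forall>j\<in>set [0..<3].
      \<exists>p\<in>set [3..<n]. ladj es i p \<and> ladj es j p" by code_simp
  from bspec[OF this, of "(n, es)"] assms(2) have
    "\<forall>i\<in>set [0..<3]. \<forall>j\<in>set [0..<3]. \<exists>p\<in>set [3..<n]. ladj es i p \<and> ladj es j p" by simp
  then have "\<exists>p\<in>set [3..<n]. ladj es i p \<and> ladj es j p" using ij by simp
  then obtain p where p: "3 \<le> p" "p < n" "ladj es i p" "ladj es j p" by auto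
  have "ys ! p \<notin> A" unfolding A using p ys n3 by (auto simp: nth_eq_iff_index_eq)
  moreover have "{x, ys ! p} \<in> edges B" "{y, ys ! p} \<in> edges B"
    using lgraph_edge_iff[OF wf ys(1,2)] p ij n3 ys(3) by simp_all
  ultimately show thesis by (rule that)
qed

context crit_graph
begin

lemma interior_T: "interior I \<Longrightarrow> x \<in> I \<Longrightarrow> x \<in> T"
  by (auto simp: interior_def)

lemma interior_closed: "interior I \<Longrightarrow> x \<in> I \<Longrightarrow> E x y \<Longrightarrow> y \<in> T \<Longrightarrow> y \<in> I"
  unfolding interior_def by (meson in_nbrs)

text \<open>The hub of \<open>I\<close> is at most one step from \<open>x\<close>, and all of
  \<open>I\<close> at most one step from the hub; \<open>I'\<close> is closed under such steps
  inside \<open>T\<close>.\<close>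

lemma interior_subset:
  assumes I: "interior I" and I': "interior I'" and x: "x \<in> I" "x \<in> I'"
  shows "I \<subseteq> I'"
proof -
  obtain h where h: "h \<in> I" "I \<subseteq> insert h (N h)" using I unfolding interior_def by blast
  have "h \<in> I'"
  proof (cases "x = h")
    case False
    then have "E x h" using h x E_sym by auto
    then show ?thesis using interior_closed[OF I' x(2)] interior_T[OF I h(1)] by blast
  qed (use x in simp)
  show ?thesis
  proof
    fix u assume u: "u \<in> I"
    show "u \<in> I'"
    proof (cases "u = h")
      case False
      then have "E h u" using h u by auto
      then show ?thesis using interior_closed[OF I' \<open>h \<in> I'\<close>] interior_T[OF I u] by blast
    qed (use \<open>h \<in> I'\<close> in simp)
  qed
qed

lemma interior_unique:
  "interior I \<Longrightarrow> interior I' \<Longrightarrow> x \<in> I \<Longrightarrow> x \<in> I' \<Longrightarrow> I = I'"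
  using interior_subset[of I I' x] interior_subset[of I' I x] by blast

lemma boundary_not_T:
  assumes "interior I" "x \<in> verts (sub I) - I"
  shows "x \<notin> T"
proof -
  obtain y where "y \<in> I" "E y x" using assms(2) by (auto simp: sub_def)
  then show ?thesis using interior_closed[OF assms(1)] assms(2) by blast
qed

lemma sub_edge: "{x, y} \<in> edges (sub I) \<longleftrightarrow> E x y \<and> (x \<in> I \<or> y \<in> I)"
  by (auto simp: sub_def)

section \<open>Triangles outside the interiors\<close>

definition tri :: "'a set \<Rightarrow> bool" where
  "tri t \<longleftrightarrow> (\<exists>x y z. t = {x, y, z} \<and> E x y \<and> E x z \<and> E y z \<and>
     deg4 x \<and> deg4 y \<and> deg4 z \<and> x \<notin> T \<and> y \<notin> T \<and> z \<notin> T)"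

text \<open>In a neighbourhood of two disjoint edges \<open>b\<close> has a single partner, so the
  edge \<open>a b\<close> lies in just one triangle.\<close>

lemma not_T_unique:
  assumes "deg4 a" "a \<notin> T" "E a b" "E a c" "E a c'" "E b c" "E b c'"
  shows "c = c'"
proof (rule ccontr)
  assume "c \<noteq> c'"
  then have "a \<in> T" unfolding T_def using assms E_sym[of b c] by blast
  then show False using assms(2) by blast
qed

lemma tri_mem: "tri t \<Longrightarrow> x \<in> t \<Longrightarrow> deg4 x \<and> x \<notin> T"
  by (auto simp: tri_def)

lemma tri_adj:
  assumes "tri t" "x \<in> t" "y \<in> t" "x \<noteq> y"
  shows "E x y"
proof -
  obtain a b c where "t = {a, b, c}" "E a b" "E a c" "E b c" using assms(1) by (auto simp: tri_def)
  then show ?thesis using assms(2-4) E_sym by blast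
qed

lemma triE:
  assumes "tri t" "x \<in> t"
  obtains y z where "t = {x, y, z}" "distinct [x, y, z]" "E x y" "E x z" "E y z"
proof -
  obtain a b c where t: "t = {a, b, c}" and e: "E a b" "E a c" "E b c" using assms(1) by (auto simp: tri_def)
  note s = e[THEN E_sym]
  have d: "a \<noteq> b" "a \<noteq> c" "b \<noteq> c" using E_irrefl e by blast+
  consider "x = a" | "x = b" | "x = c" using assms(2) t by blast
  then show thesis
  proof cases
    case 1 then show ?thesis using that[of b c] t e d by auto
  next
    case 2 then show ?thesis using that[of a c] t e s d by auto
  next
    case 3 then show ?thesis using that[of a b] t e s d by auto
  qed
qed

text \<open>The twin alternative in \<open>brick_ok\<close> requires both ends to be interior, so a
  boundary edge must have an interior common neighbour.\<close>

lemma interior_boundary_triangle: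
  assumes I: "interior I" and w: "w \<in> I" "E u w" "u \<notin> I"
  obtains p where "p \<in> I" "E u p" "E w p"
proof -
  have ok: "brick_ok (sub I) (verts (sub I) - I)"
    using I non_triangular_brick_ok unfolding interior_def by blast
  have e: "{u, w} \<in> edges (sub I)" using w by (simp add: sub_edge)
  have "u \<in> verts (sub I)" using w E_sym[OF w(2)] by (auto simp: sub_def)
  then have "u \<in> verts (sub I) - I" using w by blast
  then obtain p where "p \<in> nbrs (sub I) u \<inter> nbrs (sub I) w" "p \<notin> verts (sub I) - I"
    using ok e unfolding brick_ok_def by blast
  moreover from this have "{u, p} \<in> edges (sub I)" by simp
  then have "p \<in> I" using \<open>u \<notin> I\<close> by (simp add: sub_edge)
  ultimately show thesis using that[of p] by (simp add: sub_edge)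
qed

text \<open>Such an \<open>x\<close> lies on the other of the two disjoint edges around
  \<open>u\<close>. It shows that neither \<open>v\<close> nor \<open>w\<close> is a twin of
  \<open>u\<close>.\<close>

lemma distinct_nbr:
  assumes "deg4 u" "u \<notin> T" "E u v" "E u w" "E v w"
  obtains x where "E u x" "x \<noteq> v" "x \<noteq> w" "\<not> E v x" "\<not> E w x"
proof -
  have "card (N u - {v, w}) \<ge> card (N u) - card {v, w}" using finite_N by (intro diff_card_le_card_Diff) simp
  moreover have "card {v, w} \<le> 2" by (simp add: card_insert_if)
  ultimately have "0 < card (N u - {v, w})" using assms(1) by linarith
  then obtain x where "x \<in> N u - {v, w}" by (metis card_gt_0_iff ex_in_conv)
  then have x: "E u x" "x \<noteq> v" "x \<noteq> w" by auto
  moreover have "\<not> E v x" using not_T_unique[OF assms(1,2,3,4) x(1) assms(5)] x(3) by blast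
  moreover have "\<not> E w x" using not_T_unique[OF assms(1,2,4,3) x(1) E_sym[OF assms(5)]] x(2) by blast
  ultimately show thesis by (rule that)
qed

lemma resolved_interior:
  assumes "\<not> cycle_square" "w \<in> T"
  obtains I where "interior I" "w \<in> I"
  using T_resolved[OF assms(2)] assms(1) unfolding resolved_def by blast

text \<open>As \<open>u\<close> is a twin of neither \<open>v\<close> nor \<open>w\<close>, the
  edges \<open>u v\<close> and \<open>u w\<close> have common neighbours of degree four, and
  uniqueness identifies these as \<open>w\<close> and \<open>v\<close>.\<close>

lemma leftover_triangle_deg4:
  assumes nc: "\<not> cycle_square" and uv: "E u v" "u \<notin> T" "v \<notin> T" and u: "deg4 u"
  obtains w where "tri {u, v, w}"
proof -
  obtain w where w: "E u w" "E v w" using common_nbr[OF uv(1)] .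
  obtain x where x: "E u x" "x \<noteq> v" "x \<noteq> w" "\<not> E v x" "\<not> E w x"
    using distinct_nbr[OF u uv(2,1) w(1,2)] .
  obtain w' where w': "E u w'" "E v w'" "deg4 w'"
    using common_deg4_nbr[OF uv(1) x(1,2,4)] .
  have "w' = w" using not_T_unique[OF u uv(2,1) w'(1) w(1) w'(2) w(2)] .
  then have w4: "deg4 w" using w' by simp
  obtain v' where v': "E u v'" "E w v'" "deg4 v'"
    using common_deg4_nbr[OF w(1) x(1,3,5)] .
  have "v' = v" using not_T_unique[OF u uv(2) w(1) v'(1) uv(1) v'(2) E_sym[OF w(2)]] .
  then have v4: "deg4 v" using v' by simp
  \<comment> \<open>Otherwise the brick around \<open>w\<close> would provide a triangle on
    \<open>u w\<close> with third vertex in \<open>T\<close>; uniqueness makes that vertex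
    \<open>v\<close>, which is not in \<open>T\<close>.\<close>
  have "w \<notin> T"
  proof
    assume "w \<in> T"
    then obtain I where I: "interior I" "w \<in> I" using resolved_interior[OF nc] by blast
    have "u \<notin> I" using interior_T[OF I(1)] uv by blast
    from interior_boundary_triangle[OF I w(1) this] obtain p where p: "p \<in> I" "E u p" "E w p" .
    have "p = v" using not_T_unique[OF u uv(2) w(1) p(2) uv(1) p(3) E_sym[OF w(2)]] .
    then show False using p interior_T[OF I(1)] uv by blast
  qed
  then have "tri {u, v, w}" unfolding tri_def using uv w u v4 w4 by blast
  then show thesis by (rule that)
qed

lemma leftover_triangle:
  assumes nc: "\<not> cycle_square" and uv: "E u v" "u \<notin> T" "v \<notin> T"
  obtains t where "tri t" "u \<in> t" "v \<in> t"
proof (cases "deg4 u")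
  case True
  from leftover_triangle_deg4[OF nc uv True] obtain w where "tri {u, v, w}" .
  then show thesis by (rule that) simp_all
next
  case False
  then have "deg4 v" using deg4_end uv by blast
  from leftover_triangle_deg4[OF nc E_sym[OF uv(1)] uv(3,2) this] obtain w where "tri {v, u, w}" .
  then show thesis by (rule that) simp_all
qed

text \<open>A brick is named by its interior, a triangle by its vertex set. No set is both, since
  interiors lie in \<open>T\<close> and leftover triangles avoid it.\<close>

definition names :: "'a set set" where
  "names = {s. interior s \<or> tri s}"

definition br :: "'a set \<Rightarrow> 'a ugraph" where
  "br s = (if interior s then sub s else \<lparr>verts = s, edges = {e \<in> edges G. e \<subseteq> s}\<rparr>)"

definition en :: "'a set \<Rightarrow> 'a set" where
  "en s = (if interior s then verts (sub s) - s else s)"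

lemma tri_not_interior:
  assumes "tri t"
  shows "\<not> interior t"
proof -
  obtain x where "x \<in> t" using assms by (auto simp: tri_def)
  then show ?thesis using tri_mem[OF assms, of x] interior_T[of t x] by blast
qed

lemma br_interior: "interior I \<Longrightarrow> br I = sub I" "interior I \<Longrightarrow> en I = verts (sub I) - I"
  by (simp_all add: br_def en_def)

lemma br_tri:
  assumes "tri t"
  shows "verts (br t) = t" "edges (br t) = {e \<in> edges G. e \<subseteq> t}" "en t = t"
  using tri_not_interior[OF assms] by (simp_all add: br_def en_def)

lemma br_tri_eq:
  assumes t: "t = {x, y, z}" and e: "E x y" "E x z" "E y z" and tri: "tri t"
  shows "br t = lgraph K3_es [x, y, z]"
proof -
  have "{d \<in> edges G. d \<subseteq> t} = {{x, y}, {x, z}, {y, z}}"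
  proof (intro subset_antisym subsetI)
    fix d assume "d \<in> {d \<in> edges G. d \<subseteq> t}"
    then have d: "d \<in> edges G" "d \<subseteq> {x, y, z}" using t by auto
    then obtain u v where uv: "d = {u, v}" "u \<noteq> v" using simple_edgeE[OF simple] by metis
    then have "u \<in> {x, y, z}" "v \<in> {x, y, z}" using d by auto
    then show "d \<in> {{x, y}, {x, z}, {y, z}}" using uv by (auto simp: insert_commute)
  next
    fix d assume "d \<in> {{x, y}, {x, z}, {y, z}}"
    then show "d \<in> {d \<in> edges G. d \<subseteq> t}" using e t by auto
  qed
  then show ?thesis using br_tri[OF tri] t by (simp add: lgraph_K3)
qed

lemma names_brick:
  assumes "s \<in> names"
  shows "brick (br s)" "attachment (br s) (en s)" "card (en s) \<in> {1, 2, 3}"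
    "triangular (br s) \<longleftrightarrow> tri s"
proof -
  have "brick (br s) \<and> attachment (br s) (en s) \<and> card (en s) \<in> {1, 2, 3} \<and>
    (triangular (br s) \<longleftrightarrow> tri s)"
  proof (cases "interior s")
    case True
    then have "\<not> tri s" using tri_not_interior by blast
    then show ?thesis using True br_interior[OF True] unfolding interior_def by auto
  next
    case False
    then have tri: "tri s" using assms by (simp add: names_def)
    then obtain x where "x \<in> s" by (auto simp: tri_def)
    from triE[OF tri this] obtain y z where t: "s = {x, y, z}" and d: "distinct [x, y, z]"
      and e: "E x y" "E x z" "E y z" .
    note eq = br_tri_eq[OF t e tri]
    have c: "copy 3 K3_es (br s)" unfolding eq by (rule copy_K3I[OF d])
    then have b: "brick (br s)" by (simp add: brick_iff_copy)
    moreover have "attachment (br s) (en s)"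
      unfolding eq attachment_K3_iff[OF d] using br_tri(3)[OF tri] t by simp
    moreover have "card (en s) = 3" using br_tri(3)[OF tri] t d by simp
    ultimately show ?thesis using triangular_iff_copy[OF b] c tri by blast
  qed
  then show "brick (br s)" "attachment (br s) (en s)" "card (en s) \<in> {1, 2, 3}"
    "triangular (br s) \<longleftrightarrow> tri s" by blast+
qed

lemma br_edge:
  assumes "s \<in> names" "{x, y} \<in> edges (br s)"
  shows "E x y" "x \<in> verts (br s)" "y \<in> verts (br s)"
proof -
  show "E x y" using assms(2) by (auto simp: br_def sub_def split: if_splits)
  have "simple_graph (br s)" using names_brick(1)[OF assms(1)] by (simp add: brick_def)
  from simple_edge[OF this assms(2)] show "x \<in> verts (br s)" "y \<in> verts (br s)" by blast+
qed

lemma cover: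
  assumes "\<not> cycle_square" "E x y"
  obtains s where "s \<in> names" "{x, y} \<in> edges (br s)"
proof (cases "x \<in> T \<or> y \<in> T")
  case True
  then obtain I where I: "interior I" "x \<in> I \<or> y \<in> I" using resolved_interior[OF assms(1)] by metis
  then have "{x, y} \<in> edges (br I)" using assms(2) by (simp add: br_interior sub_edge)
  then show thesis using that[of I] I by (simp add: names_def)
next
  case False
  then obtain t where "tri t" "x \<in> t" "y \<in> t" using leftover_triangle[OF assms] by blast
  then show thesis using that[of t] assms(2) by (simp add: names_def br_tri)
qed

lemma interior_private:
  assumes I: "interior I" "x \<in> I" and s: "s \<in> names" "x \<in> verts (br s)"
  shows "s = I"
proof (cases "interior s")
  case True
  then have "x \<in> s" using boundary_not_T[OF True] interior_T[OF I] s(2) by (auto simp: br_interior)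
  then show ?thesis using interior_unique[OF True I(1)] I(2) by blast
next
  case False
  then have "tri s" using s by (simp add: names_def)
  then show ?thesis using tri_mem[of s x] interior_T[OF I] s(2) by (simp add: br_tri)
qed

text \<open>Every edge of a brick with an interior has an interior end, which lies in no other
  brick. Two leftover triangles on one edge agree because the third vertex is unique.\<close>

lemma edge_disjoint:
  assumes s: "s \<in> names" "s' \<in> names" and e: "{x, y} \<in> edges (br s)" "{x, y} \<in> edges (br s')"
  shows "s = s'"
proof -
  note b = br_edge[OF s(1) e(1)] and b' = br_edge[OF s(2) e(2)]
  show ?thesis
  proof (cases "interior s")
    case True
    then have "x \<in> s \<or> y \<in> s" using e(1) by (simp add: br_interior sub_edge)
    then show ?thesis using interior_private[OF True _ s(2)] b' by blast
  next
    case nI: False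
    show ?thesis
    proof (cases "interior s'")
      case True
      then have "x \<in> s' \<or> y \<in> s'" using e(2) by (simp add: br_interior sub_edge)
      then show ?thesis using interior_private[OF True _ s(1)] b by blast
    next
      case False
      then have t: "tri s" "tri s'" using nI s by (auto simp: names_def)
      then have m: "x \<in> s" "y \<in> s" "x \<in> s'" "y \<in> s'" using b b' by (auto simp: br_tri)
      have xy: "x \<noteq> y" using E_irrefl[OF b(1)] .
      have third: "\<exists>w. t = {x, y, w} \<and> E x w \<and> E y w" if tt: "tri t" "x \<in> t" "y \<in> t" for t
      proof -
        from triE[OF tt(1,2)] obtain p q where pq: "t = {x, p, q}" "E x p" "E x q" "E p q" .
        then have "y = p \<or> y = q" using tt(3) xy by auto
        then show ?thesis using pq E_sym[OF pq(4)] by (auto simp: insert_commute)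
      qed
      from third[OF t(1) m(1,2)] obtain w where w: "s = {x, y, w}" "E x w" "E y w" by blast
      from third[OF t(2) m(3,4)] obtain w' where w': "s' = {x, y, w'}" "E x w'" "E y w'" by blast
      have "w = w'" using not_T_unique[OF _ _ b(1) w(2) w'(2) w(3) w'(3)] tri_mem[OF t(1) m(1)] by blast
      then show ?thesis using w w' by simp
    qed
  qed
qed

lemma br_vertex:
  assumes "s \<in> names" "x \<in> verts (br s)"
  shows "x \<in> verts G"
proof -
  have "2 \<le> card (nbrs (br s) x)" using brick_min_degree[OF names_brick(1,2)[OF assms(1)] assms(2)] .
  then have "nbrs (br s) x \<noteq> {}" by (metis card.empty not_numeral_le_zero)
  then obtain b where "{x, b} \<in> edges (br s)" by auto
  then have "E x b" using br_edge(1)[OF assms(1)] by blast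
  then show ?thesis by (rule simple_edge(1)[OF simple])
qed

lemma en_subset: "s \<in> names \<Longrightarrow> en s \<subseteq> verts (br s)"
  by (auto simp: names_def br_interior br_tri)

text \<open>Some edge at \<open>x\<close> is not in the brick of \<open>s\<close>, and it is covered
  by another one. For an interior this edge is part of the definition; for a triangle it leads to
  the other of the two disjoint edges around \<open>x\<close>.\<close>

lemma en_other:
  assumes nc: "\<not> cycle_square" and s: "s \<in> names" "x \<in> en s"
  obtains s' where "s' \<in> names" "s' \<noteq> s" "x \<in> verts (br s')"
proof -
  have "\<exists>y. E x y \<and> {x, y} \<notin> edges (br s)"
  proof (cases "interior s")
    case True
    then have x: "x \<in> verts (sub s) - s" using s by (simp add: br_interior)
    then obtain y where "E x y" "y \<notin> s" using True unfolding interior_def by blast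
    then show ?thesis using x True by (auto simp: br_interior sub_edge)
  next
    case False
    then have t: "tri s" using s by (simp add: names_def)
    then have x: "x \<in> s" using s by (simp add: br_tri)
    from triE[OF t x] obtain y z where yz: "s = {x, y, z}" "E x y" "E x z" "E y z" .
    obtain p where "E x p" "p \<noteq> y" "p \<noteq> z" "\<not> E y p"
      using distinct_nbr[OF _ _ yz(2,3,4)] tri_mem[OF t x] by blast
    moreover from this have "p \<notin> s" using yz(1) E_irrefl by auto
    ultimately show ?thesis using br_tri(2)[OF t] by auto
  qed
  then obtain y where y: "E x y" "{x, y} \<notin> edges (br s)" by blast
  from cover[OF nc y(1)] obtain s' where s': "s' \<in> names" "{x, y} \<in> edges (br s')" .
  then have "s' \<noteq> s" "x \<in> verts (br s')" using y br_edge by blast+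
  then show thesis using that s' by blast
qed

lemma shared_iff_en:
  assumes nc: "\<not> cycle_square" and s: "s \<in> names" and x: "x \<in> verts (br s)"
  shows "(\<exists>s'\<in>names. s' \<noteq> s \<and> x \<in> verts (br s')) \<longleftrightarrow> x \<in> en s"
proof
  assume "\<exists>s'\<in>names. s' \<noteq> s \<and> x \<in> verts (br s')"
  then obtain s' where s': "s' \<in> names" "s' \<noteq> s" "x \<in> verts (br s')" by blast
  show "x \<in> en s"
  proof (cases "interior s")
    case True
    then have "x \<notin> s" using interior_private[OF True _ s'(1,3)] s'(2) by blast
    then show ?thesis using x True by (simp add: br_interior)
  next
    case False
    then have "tri s" using s by (simp add: names_def)
    then show ?thesis using x by (simp add: br_tri)
  qed
next
  assume "x \<in> en s"
  from en_other[OF nc s this] obtain s' where "s' \<in> names" "s' \<noteq> s" "x \<in> verts (br s')" .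
  then show "\<exists>s'\<in>names. s' \<noteq> s \<and> x \<in> verts (br s')" by blast
qed

lemma finite_names: "finite names"
proof -
  have "x \<in> verts G" if "deg4 x" for x
  proof -
    have "N x \<noteq> {}" using that by auto
    then obtain y where "E x y" by auto
    then show ?thesis by (rule simple_edge(1)[OF simple])
  qed
  then have "s \<subseteq> verts G" if "s \<in> names" for s
    using that interior_T T_deg4 tri_mem by (auto simp: names_def)
  then have "names \<subseteq> Pow (verts G)" by blast
  moreover have "finite (Pow (verts G))" using simple by (simp add: simple_graph_def)
  ultimately show ?thesis by (rule finite_subset)
qed

text \<open>A vertex of a leftover triangle has exactly two further edges; as every brick contributes at
  least two edges at each of its vertices, they belong to a single brick.\<close>

lemma tri_other_unique:
  assumes t: "tri t" "x \<in> t" and s: "s \<in> names" "s \<noteq> t" "x \<in> verts (br s)"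
    and s': "s' \<in> names" "s' \<noteq> t" "x \<in> verts (br s')"
  shows "s = s'"
proof -
  have tn: "t \<in> names" using t by (simp add: names_def)
  from triE[OF t] obtain y z where yz: "t = {x, y, z}" "distinct [x, y, z]" "E x y" "E x z" "E y z" .
  have x4: "deg4 x" using tri_mem[OF t] by blast
  have rest: "nbrs (br s) x = N x - {y, z}" if s: "s \<in> names" "s \<noteq> t" "x \<in> verts (br s)" for s
  proof (rule card_subset_eq)
    show "finite (N x - {y, z})" using finite_N by simp
    have "u \<noteq> y \<and> u \<noteq> z" if "{x, u} \<in> edges (br s)" for u
    proof -
      have "{x, y} \<in> edges (br t)" "{x, z} \<in> edges (br t)" using yz br_tri(2)[OF t(1)] by auto
      then show ?thesis using edge_disjoint[OF s(1) tn] s(2) that by blast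
    qed
    then show sub: "nbrs (br s) x \<subseteq> N x - {y, z}" using br_edge(1)[OF s(1)] by fastforce
    have "card (N x - {y, z}) = 2" using x4 yz(2-4) finite_N by (simp add: card_Diff_subset)
    moreover have "2 \<le> card (nbrs (br s) x)"
      using brick_min_degree[OF names_brick(1,2)[OF s(1)] s(3)] .
    moreover have "card (nbrs (br s) x) \<le> card (N x - {y, z})"
      using sub finite_N by (intro card_mono) auto
    ultimately show "card (nbrs (br s) x) = card (N x - {y, z})" by linarith
  qed
  have "N x - {y, z} \<noteq> {}"
  proof -
    have "card (N x - {y, z}) = 2" using x4 yz(2-4) finite_N by (simp add: card_Diff_subset)
    then show ?thesis by (metis card.empty zero_neq_numeral)
  qed
  then obtain u where "u \<in> nbrs (br s) x" "u \<in> nbrs (br s') x"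
    using rest[OF s] rest[OF s'] by blast
  then show ?thesis using edge_disjoint[OF s(1) s'(1)] by simp
qed

section \<open>Bricks that meet a leftover triangle\<close>

lemma interior_boundary_shape:
  assumes "interior I" "x \<in> verts (sub I) - I" "deg4 x"
  shows "copy 5 K5t_es (sub I) \<or> copy 6 K222t_es (sub I) \<or> copy 6 K5b_es (sub I) \<or> copy 7 K222b_es (sub I)"
  using assms(1) unfolding interior_def
proof (elim conjE)
  assume *: "\<forall>x\<in>verts (sub I) - I. (\<exists>y. E x y \<and> y \<notin> I) \<and>
        (deg4 x \<longrightarrow>
          (\<exists>(n, es)\<in>{(5, K5t_es), (6, K222t_es), (6, K5b_es), (7, K222b_es)}. copy n es (sub I)))"
  from bspec[OF * assms(2)] assms(3) show ?thesis by simp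
qed

lemma tri_other_shape:
  assumes t: "tri t" "x \<in> t" and s: "s \<in> names" "s \<noteq> t" "x \<in> en s"
  shows "copy 5 K5t_es (br s) \<or> copy 6 K222t_es (br s) \<or> copy 6 K5b_es (br s) \<or>
    copy 7 K222b_es (br s) \<or> copy 3 K3_es (br s)"
proof (cases "interior s")
  case True
  then have "x \<in> verts (sub s) - s" using s by (simp add: br_interior)
  from interior_boundary_shape[OF True this] tri_mem[OF t] show ?thesis
    unfolding br_interior[OF True] by argo
next
  case False
  then have "tri s" using s by (simp add: names_def)
  then have "triangular (br s)" using names_brick(4)[OF s(1)] by simp
  then show ?thesis using triangular_iff_copy[OF names_brick(1)[OF s(1)]] by simp
qed

text \<open>The numbers of vertices and edges separate the four excluded bricks from the five
  possible ones.\<close>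

lemma tri_other_not_minus:
  assumes t: "tri t" "x \<in> t" and s: "s \<in> names" "s \<noteq> t" "x \<in> en s"
  shows "\<not> is_minus K5 (br s)" "\<not> is_minus K222 (br s)" "\<not> br s \<simeq>\<^sub>g K5" "\<not> br s \<simeq>\<^sub>g K222"
proof -
  have simple_s: "simple_graph (br s)" using names_brick(1)[OF s(1)] by (simp add: brick_def)
  have len: "length K5_es = 10" "length K222_es = 12" "length K5m_es = 9" "length K222m_es = 11"
    "length K5t_es = 7" "length K222t_es = 9" "length K5b_es = 10" "length K222b_es = 12" "length K3_es = 3"
    by (simp_all add: es_defs)
  note size = card_copy[of 5 K5t_es "br s"] card_copy[of 6 K222t_es "br s"] card_copy[of 6 K5b_es "br s"]
    card_copy[of 7 K222b_es "br s"] card_copy[of 3 K3_es "br s"]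
  have sz: "(card (verts (br s)), card (edges (br s))) \<in> {(5, 7), (6, 9), (6, 10), (7, 12), (3, 3)}"
    using tri_other_shape[OF t s] size by (elim disjE) (simp_all add: len)
  have no: "\<not> copy 5 K5_es (br s)" "\<not> copy 6 K222_es (br s)" "\<not> copy 5 K5m_es (br s)"
    "\<not> copy 6 K222m_es (br s)"
    using sz card_copy[of 5 K5_es "br s"] card_copy[of 6 K222_es "br s"] card_copy[of 5 K5m_es "br s"]
      card_copy[of 6 K222m_es "br s"] by (auto simp: len)
  then show "\<not> is_minus K5 (br s)" "\<not> is_minus K222 (br s)" "\<not> br s \<simeq>\<^sub>g K5" "\<not> br s \<simeq>\<^sub>g K222"
    by (simp_all add: is_minus_K5_iff[OF simple_s] is_minus_K222_iff[OF simple_s]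
        iso_K5_iff[OF simple_s] iso_K222_iff[OF simple_s])
qed

text \<open>If \<open>s\<close> were a triangle, it would share the edge \<open>x y\<close> with
  \<open>t\<close>. In a triangle-deleted brick \<open>x\<close> and \<open>y\<close> would have a
  common neighbour in \<open>T\<close>, hence a second triangle on the edge \<open>x y\<close>. Only
  the bowties remain.\<close>

lemma tri_same_other:
  assumes t: "tri t" "x \<in> t" "y \<in> t" "x \<noteq> y" and s: "s \<in> names" "s \<noteq> t" "x \<in> en s" "y \<in> en s"
  shows "is_bowtie K5 (br s) \<or> is_bowtie K222 (br s)"
proof -
  have simple_s: "simple_graph (br s)" using names_brick(1)[OF s(1)] by (simp add: brick_def)
  have tn: "t \<in> names" using t by (simp add: names_def)
  have xy: "E x y" using tri_adj[OF t] .
  have nt: "\<not> tri s"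
  proof
    assume "tri s"
    then have "{x, y} \<in> edges (br s)" "{x, y} \<in> edges (br t)"
      using s t xy by (auto simp: br_tri)
    then show False using edge_disjoint[OF s(1) tn] s(2) by blast
  qed
  then have I: "interior s" using s by (simp add: names_def)
  have not_tri: "\<not> copy n es (br s)" if "(n, es) \<in> {(5, K5t_es), (6, K222t_es)}" for n es
  proof
    assume c: "copy n es (br s)"
    from triangle_deleted_common_nbr[OF c that names_brick(2)[OF s(1)] s(3,4)]
    obtain p where p: "p \<notin> en s" "{x, p} \<in> edges (br s)" "{y, p} \<in> edges (br s)" .
    have "p \<in> s" using p(1) br_edge(3)[OF s(1) p(2)] I by (simp add: br_interior)
    then have pT: "p \<in> T" using interior_T[OF I] by blast
    note xp = br_edge(1)[OF s(1) p(2)] and yp = br_edge(1)[OF s(1) p(3)]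
    from triE[OF t(1,2)] obtain a b where ab: "t = {x, a, b}" "E x a" "E x b" "E a b" .
    then obtain z where z: "z \<in> t" "E x z" "E y z" using t(3,4) E_sym[OF ab(4)] by auto
    have "z = p"
      using not_T_unique[OF _ _ xy z(2) xp z(3) yp] tri_mem[OF t(1,2)] by blast
    then show False using pT tri_mem[OF t(1) z(1)] by blast
  qed
  have "\<not> copy 3 K3_es (br s)"
    using nt names_brick(4)[OF s(1)] triangular_iff_copy[OF names_brick(1)[OF s(1)]] by simp
  then have "copy 6 K5b_es (br s) \<or> copy 7 K222b_es (br s)"
    using tri_other_shape[OF t(1,2) s(1-3)] not_tri[of 5 K5t_es] not_tri[of 6 K222t_es] by simp
  then show ?thesis by (simp add: is_bowtie_K5_iff[OF simple_s] is_bowtie_K222_iff[OF simple_s])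
qed

text \<open>A common vertex \<open>a\<close> of \<open>s\<close> and \<open>s'\<close> would form a
  triangle with \<open>x\<close> and \<open>y\<close>. The only triangle on the edge
  \<open>a x\<close> is \<open>s\<close>, so \<open>s\<close> would contain \<open>y\<close> and
  share the edge \<open>x y\<close> with \<open>t\<close>.\<close>

lemma tri_others_disjoint:
  assumes t: "tri t" "x \<in> t" "y \<in> t" "x \<noteq> y"
    and s: "tri s" "s \<noteq> t" "x \<in> s" and s': "tri s'" "s' \<noteq> t" "y \<in> s'"
  shows "s \<inter> s' = {}"
proof (rule ccontr)
  assume "s \<inter> s' \<noteq> {}"
  then obtain a where a: "a \<in> s" "a \<in> s'" by blast
  have n: "t \<in> names" "s \<in> names" "s' \<in> names" using t s s' by (auto simp: names_def)
  have xy: "E x y" using tri_adj[OF t] .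
  have et: "{x, y} \<in> edges (br t)" using br_tri(2)[OF t(1)] t xy by auto
  have ys: "y \<notin> s"
  proof
    assume "y \<in> s"
    then have "{x, y} \<in> edges (br s)" using br_tri(2)[OF s(1)] s xy by auto
    then show False using edge_disjoint[OF n(2,1)] et s(2) by blast
  qed
  have xs': "x \<notin> s'"
  proof
    assume "x \<in> s'"
    then have "{x, y} \<in> edges (br s')" using br_tri(2)[OF s'(1)] s' xy by auto
    then show False using edge_disjoint[OF n(3,1)] et s'(2) by blast
  qed
  have ax: "a \<noteq> x" "a \<noteq> y" using a ys xs' by auto
  have e: "E a x" "E a y" using tri_adj[OF s(1) a(1) s(3)] tri_adj[OF s'(1) a(2) s'(3)] ax by auto
  from triE[OF s(1) a(1)] obtain p q where pq: "s = {a, p, q}" "distinct [a, p, q]" "E a p" "E a q" "E p q" .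
  then obtain r where r: "r \<in> s" "E a r" "E x r" using s(3) ax(1) E_sym[OF pq(5)] by auto
  have "r = y" using not_T_unique[OF _ _ e(1) r(2) e(2) r(3) xy] tri_mem[OF s(1) a(1)] by blast
  then show False using r(1) ys by simp
qed

text \<open>Interiors and leftover triangles become the hyperedges. They are finitely many and are
  numbered by \<open>g\<close>, because the hyperedges of \<open>H\<close> are natural
  numbers.\<close>

lemma brick_decomposition:
  assumes nc: "\<not> cycle_square"
  shows "\<exists>(H :: ('a, nat) mhgraph) B. multihypergraph H \<and> hverts H \<noteq> {} \<and> connected_mhgraph H \<and>
       (\<forall>x\<in>hverts H. 2 \<le> hdegree H x) \<and> (\<forall>e\<in>hedges H. card (ends H e) \<in> {1, 2, 3}) \<and>
       arises_from G H B \<and> TB H B"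
proof -
  define m where "m = card names"
  obtain g where g: "bij_betw g {0..<m} names"
    using ex_bij_betw_nat_finite[OF finite_names] by (auto simp: m_def)
  have gi: "g i \<in> names" if "i < m" for i using bij_betw_apply[OF g] that by simp
  have ginj: "g i = g j \<longleftrightarrow> i = j" if "i < m" "j < m" for i j
    using bij_betw_imp_inj_on[OF g] that by (auto dest: inj_onD)
  have gs: "\<exists>i<m. s = g i" if "s \<in> names" for s
  proof -
    have "s \<in> g ` {0..<m}" using bij_betw_imp_surj_on[OF g] that by simp
    then show ?thesis by auto
  qed
  define H where "H = \<lparr>hverts = (\<Union>s\<in>names. en s), hedges = {0..<m}, ends = (\<lambda>i. en (g i))\<rparr>"
  define B where "B i = br (g i)" for i
  have H: "hverts H = (\<Union>s\<in>names. en s)" "hedges H = {0..<m}" "\<And>i. ends H i = en (g i)"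
    by (simp_all add: H_def)
  have simple_br: "simple_graph (br s)" if "s \<in> names" for s
    using names_brick(1)[OF that] by (simp add: brick_def)
  \<comment> \<open>A vertex in two bricks is an end of each, so being an end does not depend on the
    brick in which the vertex is viewed.\<close>
  have en_en: "x \<in> en s'" if "s \<in> names" "x \<in> en s" "s' \<in> names" "x \<in> verts (br s')" for s s' x
  proof (cases "s = s'")
    case False
    have "x \<in> verts (br s)" using en_subset that by blast
    then show ?thesis using shared_iff_en[OF nc that(3,4)] that(1) False by blast
  qed (use that in simp)
  have vcover: "\<exists>s\<in>names. v \<in> verts (br s)" if v: "v \<in> verts G" for v
  proof -
    have "4 \<le> card (N v)" using in_C v by (simp add: class_C_iff)
    then have "N v \<noteq> {}" by (metis card.empty not_numeral_le_zero)
    then obtain y where "E v y" by auto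
    from cover[OF nc this] obtain s where "s \<in> names" "{v, y} \<in> edges (br s)" .
    then show ?thesis using br_edge by blast
  qed
  have en_ne: "en s \<noteq> {}" if "s \<in> names" for s
    using names_brick(3)[OF that] by auto
  have "multihypergraph H"
    unfolding multihypergraph_def
  proof (intro conjI ballI)
    have "finite (en s)" if "s \<in> names" for s
      using finite_subset[OF en_subset[OF that]] simple_br[OF that] by (simp add: simple_graph_def)
    then show "finite (hverts H)" unfolding H using finite_names by blast
    show "finite (hedges H)" by (simp add: H)
    fix e assume "e \<in> hedges H"
    then show "ends H e \<subseteq> hverts H" using gi unfolding H by auto
  qed
  moreover have "hverts H \<noteq> {}"
  proof -
    obtain v where "v \<in> verts G" using conn by (auto simp: connected_graph_def)
    then obtain s where "s \<in> names" using vcover by blast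
    then show ?thesis unfolding H using en_ne by blast
  qed
  moreover have "connected_mhgraph H"
    unfolding connected_mhgraph_def
  proof (intro ballI)
    fix x y assume x: "x \<in> hverts H" and y: "y \<in> hverts H"
    have hadjI: "(a, b) \<in> hadj H" if "s \<in> names" "a \<in> en s" "b \<in> en s" for s a b
      using gs[OF that(1)] that(2,3) by (auto simp: hadj_def H)
    obtain sx where sx: "sx \<in> names" "x \<in> en sx" using x unfolding H by blast
    \<comment> \<open>Induction along a walk in \<open>G\<close> with the invariant that the ends of
      every brick at the current vertex are reachable in \<open>H\<close>. A step stays inside one
      brick \<open>s0\<close>; any other brick at \<open>w\<close> shares \<open>w\<close> with
      \<open>s0\<close>, so \<open>w\<close> is an end of both and links them in
      \<open>H\<close>.\<close>
    have reach: "\<forall>s\<in>names. u \<in> verts (br s) \<longrightarrow> (\<forall>z\<in>en s. (x, z) \<in> (hadj H)\<^sup>*)"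
      if "(x, u) \<in> (adj G)\<^sup>*" for u
      using that
    proof induction
      case base
      show ?case
      proof (intro ballI impI)
        fix s z assume "s \<in> names" "x \<in> verts (br s)" "z \<in> en s"
        then have "(x, z) \<in> hadj H" using hadjI en_en[OF sx] by blast
        then show "(x, z) \<in> (hadj H)\<^sup>*" by (rule r_into_rtrancl)
      qed
    next
      case (step u w)
      then have "E u w" by (simp add: adj_def)
      from cover[OF nc this] obtain s0 where s0: "s0 \<in> names" "{u, w} \<in> edges (br s0)" .
      note b = br_edge[OF s0]
      have IH: "(x, z) \<in> (hadj H)\<^sup>*" if "z \<in> en s0" for z using step.IH s0(1) b(2) that by blast
      show ?case
      proof (intro ballI impI)
        fix s z assume s: "s \<in> names" "w \<in> verts (br s)" and z: "z \<in> en s"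
        show "(x, z) \<in> (hadj H)\<^sup>*"
        proof (cases "s = s0")
          case False
          then have "w \<in> en s0" using shared_iff_en[OF nc s0(1) b(3)] s by blast
          moreover from this have "w \<in> en s" using en_en[OF s0(1) _ s] by blast
          ultimately have "(x, w) \<in> (hadj H)\<^sup>*" "(w, z) \<in> hadj H" using IH hadjI[OF s(1) _ z] by blast+
          then show ?thesis by (rule rtrancl_into_rtrancl)
        qed (use IH z in blast)
      qed
    qed
    obtain sy where sy: "sy \<in> names" "y \<in> en sy" using y unfolding H by blast
    have inV: "a \<in> verts G" if "s \<in> names" "a \<in> en s" for s a
      using br_vertex en_subset that by blast
    have "(x, y) \<in> (adj G)\<^sup>*"
      using conn inV[OF sx] inV[OF sy] unfolding connected_graph_def by blast
    from reach[OF this] show "(x, y) \<in> (hadj H)\<^sup>*" using sy en_subset by blast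
  qed
  moreover have "\<forall>x\<in>hverts H. 2 \<le> hdegree H x"
  proof
    fix x assume "x \<in> hverts H"
    then obtain s where s: "s \<in> names" "x \<in> en s" unfolding H by blast
    from en_other[OF nc s] obtain s' where s': "s' \<in> names" "s' \<noteq> s" "x \<in> verts (br s')" .
    have xs': "x \<in> en s'" using en_en[OF s s'(1,3)] .
    obtain i j where ij: "i < m" "s = g i" "j < m" "s' = g j" using gs[OF s(1)] gs[OF s'(1)] by blast
    have "{i, j} \<subseteq> {e \<in> hedges H. x \<in> ends H e}" using ij s xs' by (auto simp: H)
    moreover have "finite {e \<in> hedges H. x \<in> ends H e}" by (simp add: H)
    ultimately have "card {i, j} \<le> hdegree H x" unfolding hdegree_def by (rule card_mono[rotated])
    moreover have "i \<noteq> j" using ij s'(2) by blast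
    ultimately show "2 \<le> hdegree H x" by simp
  qed
  moreover have "\<forall>e\<in>hedges H. card (ends H e) \<in> {1, 2, 3}"
    using names_brick(3) gi by (simp add: H)
  moreover have "arises_from G H B"
    unfolding arises_from_def
  proof (intro conjI ballI)
    fix e assume "e \<in> hedges H"
    then have e: "e < m" by (simp add: H)
    note ge = gi[OF e]
    show "brick (B e)" "attachment (B e) (ends H e)" using names_brick[OF ge] by (auto simp: B_def H)
    have ex: "(\<exists>f\<in>hedges H. f \<noteq> e \<and> x \<in> verts (B f)) \<longleftrightarrow>
      (\<exists>s\<in>names. s \<noteq> g e \<and> x \<in> verts (br s))" for x
    proof
      assume "\<exists>f\<in>hedges H. f \<noteq> e \<and> x \<in> verts (B f)"
      then obtain f where f: "f < m" "f \<noteq> e" "x \<in> verts (br (g f))" by (auto simp: H B_def)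
      then have "g f \<noteq> g e" using ginj[of f e] e by simp
      then show "\<exists>s\<in>names. s \<noteq> g e \<and> x \<in> verts (br s)" using gi[OF f(1)] f(3) by blast
    next
      assume "\<exists>s\<in>names. s \<noteq> g e \<and> x \<in> verts (br s)"
      then obtain s where s: "s \<in> names" "s \<noteq> g e" "x \<in> verts (br s)" by blast
      from gs[OF s(1)] obtain f where "f < m" "s = g f" by blast
      then show "\<exists>f\<in>hedges H. f \<noteq> e \<and> x \<in> verts (B f)" using s by (auto simp: H B_def)
    qed
    have "x \<in> {x \<in> verts (B e). \<exists>f\<in>hedges H. f \<noteq> e \<and> x \<in> verts (B f)} \<longleftrightarrow> x \<in> ends H e" for x
    proof -
      have "x \<in> {x \<in> verts (B e). \<exists>f\<in>hedges H. f \<noteq> e \<and> x \<in> verts (B f)} \<longleftrightarrow>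
          x \<in> verts (br (g e)) \<and> (\<exists>s\<in>names. s \<noteq> g e \<and> x \<in> verts (br s))"
        using ex[of x] by (simp add: B_def)
      also have "\<dots> \<longleftrightarrow> x \<in> en (g e)" using shared_iff_en[OF nc ge] en_subset[OF ge] by blast
      finally show ?thesis by (simp add: H)
    qed
    then show "{x \<in> verts (B e). \<exists>f\<in>hedges H. f \<noteq> e \<and> x \<in> verts (B f)} = ends H e"
      by (rule set_eqI)
    show "{d \<in> edges (B e). \<exists>f\<in>hedges H. f \<noteq> e \<and> d \<in> edges (B f)} = {}"
    proof (rule ccontr)
      assume "{d \<in> edges (B e). \<exists>f\<in>hedges H. f \<noteq> e \<and> d \<in> edges (B f)} \<noteq> {}"
      then obtain d f where d: "d \<in> edges (br (g e))" "f < m" "f \<noteq> e" "d \<in> edges (br (g f))"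
        by (auto simp: H B_def)
      obtain u v where "d = {u, v}" using simple_edgeE[OF simple_br[OF ge] d(1)] by metis
      then have "g e = g f" using edge_disjoint[OF ge gi[OF d(2)]] d by blast
      then show False using ginj e d by blast
    qed
  next
    have im: "names = g ` hedges H" using bij_betw_imp_surj_on[OF g] by (simp add: H)
    have B_UN: "(\<Union>e\<in>hedges H. verts (B e)) = (\<Union>s\<in>names. verts (br s))"
      "(\<Union>e\<in>hedges H. edges (B e)) = (\<Union>s\<in>names. edges (br s))"
      unfolding im by (simp_all add: B_def)
    have "verts G = (\<Union>s\<in>names. verts (br s))" using vcover br_vertex by blast
    moreover have "(\<Union>s\<in>names. en s) \<subseteq> (\<Union>s\<in>names. verts (br s))" using en_subset by blast
    ultimately have V: "verts G = hverts H \<union> (\<Union>e\<in>hedges H. verts (B e))"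
      unfolding B_UN unfolding H by blast
    have "edges G = (\<Union>s\<in>names. edges (br s))"
    proof (intro subset_antisym subsetI)
      fix e assume e: "e \<in> edges G"
      then obtain u v where uv: "e = {u, v}" using simple_edgeE[OF simple] by metis
      then have "E u v" using e by simp
      from cover[OF nc this] obtain s where "s \<in> names" "{u, v} \<in> edges (br s)" .
      then show "e \<in> (\<Union>s\<in>names. edges (br s))" using uv by blast
    next
      fix e assume "e \<in> (\<Union>s\<in>names. edges (br s))"
      then show "e \<in> edges G" by (auto simp: br_def sub_def split: if_splits)
    qed
    then have "edges G = (\<Union>e\<in>hedges H. edges (B e))" unfolding B_UN .
    with V show "G = \<lparr>verts = hverts H \<union> (\<Union>e\<in>hedges H. verts (B e)),
          edges = (\<Union>e\<in>hedges H. edges (B e))\<rparr>" by simp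
  qed
  moreover have "TB H B"
    unfolding TB_def
  proof (intro ballI impI)
    fix e assume "e \<in> hedges H" and tr: "triangular (B e)"
    then have e: "e < m" by (simp add: H)
    note ge = gi[OF e]
    have t: "tri (g e)" using tr names_brick(4)[OF ge] by (simp add: B_def)
    have ends_e: "ends H e = g e" using br_tri(3)[OF t] by (simp add: H)
    \<comment> \<open>\<open>en_other\<close> gives a second brick at \<open>x\<close>, and
      \<open>tri_other_unique\<close> excludes a third.\<close>
    have "\<exists>j. {k \<in> hedges H. k \<noteq> e \<and> x \<in> ends H k} = {j}" if x: "x \<in> ends H e" for x
    proof -
      have xe: "x \<in> en (g e)" "x \<in> g e" using x ends_e by (auto simp: H)
      from en_other[OF nc ge xe(1)] obtain s' where s': "s' \<in> names" "s' \<noteq> g e" "x \<in> verts (br s')" .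
      from gs[OF s'(1)] obtain j where j: "j < m" "s' = g j" by blast
      have "{k \<in> hedges H. k \<noteq> e \<and> x \<in> ends H k} = {j}"
      proof (intro subset_antisym subsetI)
        fix k assume "k \<in> {k \<in> hedges H. k \<noteq> e \<and> x \<in> ends H k}"
        then have k: "k < m" "k \<noteq> e" "x \<in> en (g k)" by (auto simp: H)
        have "g k \<noteq> g e" "x \<in> verts (br (g k))" using ginj k e en_subset[OF gi] by blast+
        then have "g k = s'" using tri_other_unique[OF t xe(2) gi[OF k(1)] _ _ s'] by blast
        then show "k \<in> {j}" using ginj k(1) j by blast
      next
        fix k assume "k \<in> {j}"
        then show "k \<in> {k \<in> hedges H. k \<noteq> e \<and> x \<in> ends H k}"
          using j s' en_en[OF ge xe(1) s'(1,3)] by (auto simp: H)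
      qed
      then show ?thesis by blast
    qed
    then obtain f where f: "\<And>x. x \<in> ends H e \<Longrightarrow> {k \<in> hedges H. k \<noteq> e \<and> x \<in> ends H k} = {f x}"
      by metis
    have fx: "f x < m" "g (f x) \<in> names" "g (f x) \<noteq> g e" "x \<in> en (g (f x))" "x \<in> g e"
      if x: "x \<in> ends H e" for x
    proof -
      have "f x \<in> {k \<in> hedges H. k \<noteq> e \<and> x \<in> ends H k}" using f[OF x] by blast
      then show "f x < m" "g (f x) \<noteq> g e" "x \<in> en (g (f x))" using ginj e by (auto simp: H)
      then show "g (f x) \<in> names" by (simp add: gi)
      show "x \<in> g e" using x ends_e by simp
    qed
    show "\<exists>f. (\<forall>x\<in>ends H e.
                {g \<in> hedges H. g \<noteq> e \<and> x \<in> ends H g} = {f x} \<and>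
                \<not> is_minus K5 (B (f x)) \<and> \<not> is_minus K222 (B (f x)) \<and>
                \<not> B (f x) \<simeq>\<^sub>g K5 \<and> \<not> B (f x) \<simeq>\<^sub>g K222) \<and>
             (\<forall>x\<in>ends H e. \<forall>y\<in>ends H e. x \<noteq> y \<longrightarrow>
                (ends H (f x) \<inter> ends H (f y) \<noteq> {} \<longrightarrow>
                   \<not> (triangular (B (f x)) \<and> triangular (B (f y)))) \<and>
                (f x = f y \<longrightarrow> is_bowtie K5 (B (f x)) \<or> is_bowtie K222 (B (f x))))"
    proof (intro exI[of _ f] conjI ballI impI)
      fix x assume x: "x \<in> ends H e"
      note F = fx[OF x]
      show "{g \<in> hedges H. g \<noteq> e \<and> x \<in> ends H g} = {f x}" using f[OF x] .
      show "\<not> is_minus K5 (B (f x))" "\<not> is_minus K222 (B (f x))"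
        "\<not> B (f x) \<simeq>\<^sub>g K5" "\<not> B (f x) \<simeq>\<^sub>g K222"
        using tri_other_not_minus[OF t F(5) F(2,3,4)] by (simp_all add: B_def)
    next
      fix x y assume x: "x \<in> ends H e" and y: "y \<in> ends H e" and xy: "x \<noteq> y"
      note X = fx[OF x] and Y = fx[OF y]
      {
        assume ne: "ends H (f x) \<inter> ends H (f y) \<noteq> {}"
        show "\<not> (triangular (B (f x)) \<and> triangular (B (f y)))"
        proof
          assume "triangular (B (f x)) \<and> triangular (B (f y))"
          then have tt: "tri (g (f x))" "tri (g (f y))"
            using names_brick(4) X(2) Y(2) by (auto simp: B_def)
          have "g (f x) \<inter> g (f y) = {}"
            using tri_others_disjoint[OF t X(5) Y(5) xy tt(1) X(3) _ tt(2) Y(3)] X(4) Y(4)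
              br_tri(3)[OF tt(1)] br_tri(3)[OF tt(2)] by simp
          then show False using ne br_tri(3)[OF tt(1)] br_tri(3)[OF tt(2)] by (simp add: H)
        qed
      next
        assume "f x = f y"
        then have "y \<in> en (g (f x))" using Y(4) by simp
        from tri_same_other[OF t X(5) Y(5) xy X(2,3,4) this]
        show "is_bowtie K5 (B (f x)) \<or> is_bowtie K222 (B (f x))" by (simp add: B_def)
      }
    qed
  qed
  ultimately show ?thesis by blast
qed

end

theorem theorem5:
  fixes G :: "'a ugraph"
  shows "minimal_critical G \<longleftrightarrow>
    (\<exists>C n. is_cycle C n \<and> 5 \<le> n \<and> G = square C) \<or>
    (\<exists>(H :: ('a, nat) mhgraph) (B :: nat \<Rightarrow> 'a ugraph).
       multihypergraph H \<and> hverts H \<noteq> {} \<and> connected_mhgraph H \<and>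
       (\<forall>x\<in>hverts H. 2 \<le> hdegree H x) \<and>
       (\<forall>e\<in>hedges H. card (ends H e) \<in> {1, 2, 3}) \<and>
       arises_from G H B \<and> TB H B)"
proof (rule iffI, goal_cases)
  case 1
  then interpret crit_graph G by unfold_locales (simp_all add: minimal_critical_iff)
  show ?case using brick_decomposition cycle_square_def by blast
next
  case 2
  then show ?case
  proof (elim disjE exE conjE)
    fix C n assume "is_cycle C n" "5 \<le> n" "G = square C"
    then show ?thesis using square_of_cycle_minimal_critical by blast
  next
    fix H :: "('a, nat) mhgraph" and B :: "nat \<Rightarrow> 'a ugraph"
    assume *: "multihypergraph H" "hverts H \<noteq> {}" "connected_mhgraph H"
      "\<forall>x\<in>hverts H. 2 \<le> hdegree H x" "\<forall>e\<in>hedges H. card (ends H e) \<in> {1, 2, 3}"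
      "arises_from G H B" "TB H B"
    have "ends H e \<noteq> {}" if "e \<in> hedges H" for e using *(5) that by auto
    then show ?thesis using bricks_minimal_critical[OF *(1-3) _ _ *(6,7)] *(4) by blast
  qed
qed

end
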